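(* Let $H\colon \mathbf{T}^N\times\mathbf{R}^N\to\mathbf{R}$ be continuous on $\mathbf{T}^N\times\mathbf{R}^N$ and quasiconvex in $p$, i.e. $H(x,\theta p+(1-\theta)q)\le\max\{H(x,p),H(x,q)\}$ for all $p,q\in\mathbf{R}^N$, $0\le\theta\le1$ and $x\in\mathbf{T}^N$. Then $$ c^+(H)=\inf_{u\in \mathrm{Lip}(\mathbf{T}^N)}\ \sup_{(x,p)\in\nabla u}H(x,p)=\inf_{u\in C^\infty(\mathbf{T}^N)}\ \sup_{(x,p)\in\nabla u}H(x,p). $$ In particular, if in addition $H$ is coercive, i.e. $\liminf_{|p|\to\infty}\inf_{x\in\mathbf{T}^N}H(x,p)=+\infty$, then these quantities are equal to the critical value $c(H)$, the unique eigenvalue of the problem $H(x,Du)=a$ in $\mathbf{T}^N$.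
   Context: $\mathbf{T}^N=\mathbf{R}^N/\mathbf{Z}^N$ is the flat torus, and $\mathrm{Lip}(\mathbf{T}^N)$ is the set of real-valued Lipschitz continuous functions on $\mathbf{T}^N$. For points $x,y$ of the torus that are close, $y-x$ denotes the small representative in $\mathbf{R}^N$ (equivalently, functions on $\mathbf{T}^N$ are regarded as $\mathbf{Z}^N$-periodic functions on $\mathbf{R}^N$). For $u\colon\mathbf{T}^N\to\mathbf{R}$ define the graphs $$\nabla u=\{(x,p)\in\mathbf{T}^N\times\mathbf{R}^N \mid u(y)=u(x)+p\cdot(y-x)+o(|y-x|)\text{ as }y\to x\},$$ $$D^+u=\{(x,p)\in\mathbf{T}^N\times\mathbf{R}^N \mid u(y)\le u(x)+p\cdot(y-x)+o(|y-x|)\text{ as }y\to x\},$$ $$D^-u=\{(x,p)\in\mathbf{T}^N\times\mathbf{R}^N \mid u(y)\ge u(x)+p\cdot(y-x)+o(|y-x|)\text{ as }y\to x\}.$$ For $G\subset\mathbf{T}^N\times\mathbf{R}^N$ write $\sup_G H=\sup_{(x,p)\in G}H(x,p)$ and similarly for $\inf$. For $a\in\mathbf{R}$, a function $u\in\mathrm{Lip}(\mathbf{T}^N)$ is a viscosity subsolution, supersolution, or solution of $H(x,Du)=a$ in $\mathbf{T}^N$ if $\sup_{D^+u}H\le a$, $\inf_{D^-u}H\ge a$, or $\sup_{D^+u}H\le a\le\inf_{D^-u}H$, respectively. A constant $a\in\mathbf{R}$ is a subeigenvalue, supereigenvalue, or eigenvalue if there is at least one viscosity subsolution, supersolution, or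 solution (in $\mathrm{Lip}(\mathbf{T}^N)$) of $H(x,Du)=a$, respectively. Set $$c^+(H)=\inf\{a\in\mathbf{R}\mid a\text{ is a subeigenvalue}\},\qquad c^-(H)=\sup\{a\in\mathbf{R}\mid a\text{ is a supereigenvalue}\}.$$ It is well known that if $H$ is continuous and coercive then $c^-(H)=c^+(H)$ and this common value is the unique eigenvalue; it is called the critical value and denoted $c(H)$. *)

theory Defs
  imports "HOL-Analysis.Analysis" "HOL-Library.Landau_Symbols"
begin

text \<open>
  The flat torus is represented by its universal cover: functions on the torus
  are functions on \<open>real^'n\<close> that are periodic with respect to the lattice of integer
  vectors.  Correspondingly, subsets of (torus \<open>\<times>\<close> \<open>real^'n\<close>) appear below as subsets of
  \<open>(real^'n) \<times> (real^'n)\<close> that are lattice-periodic in the first component, and suprema and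
  infima over the torus are suprema and infima over all of \<open>real^'n\<close>.
\<close>

definition int_lattice :: "(real^'n) set" where
  "int_lattice = {k. \<forall>i. k $ i \<in> \<int>}"

definition torus_fun :: "(real^'n \<Rightarrow> real) \<Rightarrow> bool" where
  "torus_fun u \<longleftrightarrow> (\<forall>x. \<forall>k\<in>int_lattice. u (x + k) = u x)"

definition Lip_torus :: "(real^'n \<Rightarrow> real) set" where
  "Lip_torus = {u. torus_fun u \<and> (\<exists>L. L-lipschitz_on UNIV u)}"

text \<open>
  \<open>k\<close> times continuously differentiable functions: differentiable, with every directional
  derivative \<open>k - 1\<close> times continuously differentiable.
\<close>

primrec Ck_fun :: "nat \<Rightarrow> (real^'n \<Rightarrow> real) \<Rightarrow> bool" where
  "Ck_fun 0 u \<longleftrightarrow> continuous_on UNIV u"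
| "Ck_fun (Suc k) u \<longleftrightarrow>
     (\<forall>x. u differentiable (at x)) \<and> (\<forall>v. Ck_fun k (\<lambda>x. frechet_derivative u (at x) v))"

definition Cinf_torus :: "(real^'n \<Rightarrow> real) set" where
  "Cinf_torus = {u. torus_fun u \<and> (\<forall>k. Ck_fun k u)}"

definition grad_graph :: "(real^'n \<Rightarrow> real) \<Rightarrow> ((real^'n) \<times> (real^'n)) set" where
  "grad_graph u = {(x, p). \<exists>r. r \<in> o[at x](\<lambda>y. norm (y - x)) \<and>
     (\<forall>\<^sub>F y in at x. u y = u x + p \<bullet> (y - x) + r y)}"

definition superdiff_graph :: "(real^'n \<Rightarrow> real) \<Rightarrow> ((real^'n) \<times> (real^'n)) set" where
  "superdiff_graph u = {(x, p). \<exists>r. r \<in> o[at x](\<lambda>y. norm (y - x)) \<and>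
     (\<forall>\<^sub>F y in at x. u y \<le> u x + p \<bullet> (y - x) + r y)}"

definition subdiff_graph :: "(real^'n \<Rightarrow> real) \<Rightarrow> ((real^'n) \<times> (real^'n)) set" where
  "subdiff_graph u = {(x, p). \<exists>r. r \<in> o[at x](\<lambda>y. norm (y - x)) \<and>
     (\<forall>\<^sub>F y in at x. u y \<ge> u x + p \<bullet> (y - x) + r y)}"

definition sup_on :: "((real^'n) \<times> (real^'n)) set \<Rightarrow> ((real^'n) \<times> (real^'n) \<Rightarrow> real) \<Rightarrow> ereal" where
  "sup_on G H = (SUP z\<in>G. ereal (H z))"

definition inf_on :: "((real^'n) \<times> (real^'n)) set \<Rightarrow> ((real^'n) \<times> (real^'n) \<Rightarrow> real) \<Rightarrow> ereal" where
  "inf_on G H = (INF z\<in>G. ereal (H z))"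

definition viscosity_subsolution ::
    "((real^'n) \<times> (real^'n) \<Rightarrow> real) \<Rightarrow> real \<Rightarrow> (real^'n \<Rightarrow> real) \<Rightarrow> bool" where
  "viscosity_subsolution H a u \<longleftrightarrow>
     u \<in> Lip_torus \<and> sup_on (superdiff_graph u) H \<le> ereal a"

definition viscosity_supersolution ::
    "((real^'n) \<times> (real^'n) \<Rightarrow> real) \<Rightarrow> real \<Rightarrow> (real^'n \<Rightarrow> real) \<Rightarrow> bool" where
  "viscosity_supersolution H a u \<longleftrightarrow>
     u \<in> Lip_torus \<and> inf_on (subdiff_graph u) H \<ge> ereal a"

definition viscosity_solution ::
    "((real^'n) \<times> (real^'n) \<Rightarrow> real) \<Rightarrow> real \<Rightarrow> (real^'n \<Rightarrow> real) \<Rightarrow> bool" where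
  "viscosity_solution H a u \<longleftrightarrow>
     u \<in> Lip_torus \<and> sup_on (superdiff_graph u) H \<le> ereal a
       \<and> ereal a \<le> inf_on (subdiff_graph u) H"

definition subeigenvalue :: "((real^'n) \<times> (real^'n) \<Rightarrow> real) \<Rightarrow> real \<Rightarrow> bool" where
  "subeigenvalue H a \<longleftrightarrow> (\<exists>u. viscosity_subsolution H a u)"

definition supereigenvalue :: "((real^'n) \<times> (real^'n) \<Rightarrow> real) \<Rightarrow> real \<Rightarrow> bool" where
  "supereigenvalue H a \<longleftrightarrow> (\<exists>u. viscosity_supersolution H a u)"

definition eigenvalue :: "((real^'n) \<times> (real^'n) \<Rightarrow> real) \<Rightarrow> real \<Rightarrow> bool" where
  "eigenvalue H a \<longleftrightarrow> (\<exists>u. viscosity_solution H a u)"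

definition c_plus :: "((real^'n) \<times> (real^'n) \<Rightarrow> real) \<Rightarrow> ereal" where
  "c_plus H = (INF a\<in>{a. subeigenvalue H a}. ereal a)"

definition c_minus :: "((real^'n) \<times> (real^'n) \<Rightarrow> real) \<Rightarrow> ereal" where
  "c_minus H = (SUP a\<in>{a. supereigenvalue H a}. ereal a)"

text \<open>
  The critical value: the common value of \<open>c_minus\<close> and \<open>c_plus\<close>, being the unique
  eigenvalue.
\<close>

definition is_critical_value :: "((real^'n) \<times> (real^'n) \<Rightarrow> real) \<Rightarrow> real \<Rightarrow> bool" where
  "is_critical_value H c \<longleftrightarrow>
     c_minus H = ereal c \<and> c_plus H = ereal c \<and>
     eigenvalue H c \<and> (\<forall>a. eigenvalue H a \<longrightarrow> a = c)"

definition hamiltonian_periodic :: "((real^'n) \<times> (real^'n) \<Rightarrow> real) \<Rightarrow> bool" where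
  "hamiltonian_periodic H \<longleftrightarrow> (\<forall>p. torus_fun (\<lambda>x. H (x, p)))"

definition quasiconvex_in_p :: "((real^'n) \<times> (real^'n) \<Rightarrow> real) \<Rightarrow> bool" where
  "quasiconvex_in_p H \<longleftrightarrow> (\<forall>x p q \<theta>. 0 \<le> \<theta> \<and> \<theta> \<le> 1 \<longrightarrow>
     H (x, \<theta> *\<^sub>R p + (1 - \<theta>) *\<^sub>R q) \<le> max (H (x, p)) (H (x, q)))"

definition coercive :: "((real^'n) \<times> (real^'n) \<Rightarrow> real) \<Rightarrow> bool" where
  "coercive H \<longleftrightarrow> Liminf at_infinity (\<lambda>p. INF x. ereal (H (x, p))) = \<infinity>"

end

theory Submission
  imports Defs "HOL-Complex_Analysis.Great_Picard"
begin

text \<open>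
  A smooth function has the same gradient graph and superdifferential graph, and the gradient graph is
  always contained in the superdifferential graph; so everything reduces to approximating a Lipschitz
  function by smooth ones without raising the supremum of \<open>H\<close> over the gradient graph by more than
  \<open>\<epsilon>\<close>. Mollification does this: by Rademacher's theorem the gradient of the mollified function is an
  average of gradients at nearby points, and the sublevel sets of \<open>H(x, \<cdot>)\<close> are convex.

  Comparing a supersolution with a smooth almost optimal subsolution at a minimum of their difference
  gives \<open>c_minus H \<le> c_plus H\<close>. Since every eigenvalue \<open>a\<close> satisfies \<open>c_plus H \<le> a \<le> c_minus H\<close>, the coercive
  case only needs the existence of one eigenvalue; it comes from Perron's method applied to
  \<open>\<lambda> u + H(x, Du) = 0\<close> and the limit \<open>\<lambda> \<longrightarrow> 0\<close> along equi-Lipschitz solutions.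
\<close>

section \<open>Directional derivatives of Lipschitz functions\<close>

text \<open>The obstacle is that the gradient graph sees a Lipschitz function only almost
  everywhere, whereas a subsolution is tested at every superdifferential. Averaging bridges the gap,
  but convexity applies at a single base point while the averaged gradients sit at nearby ones.
  Uniform continuity of \<open>H\<close> over bounded momenta pays for this with the \<epsilon>; it
  is uniform because the torus is compact and the gradients are bounded by the Lipschitz constant.
  In the coercive case, the discount turns the constants \<open>- M / l\<close> and
  \<open>K / l\<close> into a sub- and a supersolution, between which a supremum can be taken.
  Coercivity makes all competitors Lipschitz with one constant \<open>R\<close>, the same for every
  discount, so the supremum is itself Lipschitz and compactness is available in the limit.\<close>

text \<open>Vitali's theorem selects disjoint intervals of small slope inside an open superset of
  nearly the same measure, covering \<open>E\<close> up to a null set. Their images are intervals at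
  most \<open>r\<close> times as long, and the image of the exceptional null set is null because
  \<open>g\<close> is Lipschitz.\<close>

lemma emeasure_image_small_slopes:
  fixes g :: "real \<Rightarrow> real"
  assumes mono: "strict_mono g" and lip: "K-lipschitz_on UNIV g"
    and E: "E \<in> lmeasurable" and gE: "g ` E \<in> sets lebesgue"
    and r: "0 \<le> r"
    and slopes: "\<And>x d. x \<in> E \<Longrightarrow> 0 < d \<Longrightarrow> \<exists>a b. a < b \<and> x \<in> {a..b} \<and> b - a < d \<and> g b - g a \<le> r * (b - a)"
  shows "emeasure lebesgue (g ` E) \<le> ennreal r * emeasure lebesgue E"
proof -
  have less: "g x < g y \<longleftrightarrow> x < y" for x y
    using mono by (simp add: strict_mono_less)
  have le: "g x \<le> g y \<longleftrightarrow> x \<le> y" for x y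
    using mono by (simp add: strict_mono_less_eq)
  have *: "emeasure lebesgue (g ` E) \<le> ennreal r * (emeasure lebesgue E + ennreal e)" if "e > 0" for e
  proof -
    obtain T where T: "open T" "E \<subseteq> T" "(T - E) \<in> lmeasurable" "emeasure lebesgue (T - E) < ennreal e"
      using sets_lebesgue_outer_open[OF _ \<open>e > 0\<close>] E by (metis fmeasurableD)
    have Tm: "T \<in> sets lebesgue" using T(1) by (simp add: borel_open)
    \<comment> \<open>Intervals are indexed by their pairs of endpoints. Staying inside
      \<open>T\<close> bounds the total length of a disjoint selection by the measure of
      \<open>T\<close>.\<close>
    define I where "I = {p::real\<times>real. fst p < snd p \<and> {fst p..snd p} \<subseteq> T \<and> g (snd p) - g (fst p) \<le> r * (snd p - fst p)}"
    have cb: "cball ((fst p + snd p)/2) ((snd p - fst p)/2) = {fst p..snd p}" for p :: "real\<times>real"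
      by (simp add: cball_eq_atLeastAtMost field_simps)
    obtain C where C: "countable C" "C \<subseteq> I"
      "pairwise (\<lambda>i j. disjnt (cball ((fst i + snd i)/2) ((snd i - fst i)/2)) (cball ((fst j + snd j)/2) ((snd j - fst j)/2))) C"
      "negligible(E - (\<Union>i \<in> C. cball ((fst i + snd i)/2) ((snd i - fst i)/2)))"
    proof (rule Vitali_covering_theorem_cballs[of I "\<lambda>p. (snd p - fst p)/2" E "\<lambda>p. (fst p + snd p)/2"])
      show "0 < (snd p - fst p)/2" if "p \<in> I" for p using that by (auto simp: I_def)
      fix x d :: real assume x: "x \<in> E" and d: "0 < d"
      then obtain e' where e': "e' > 0" "cball x e' \<subseteq> T"
        using T(1,2) by (meson open_contains_cball subsetD)
      obtain a b where ab: "a < b" "x \<in> {a..b}" "b - a < min d e'" "g b - g a \<le> r * (b - a)"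
        using slopes[OF x, of "min d e'"] d e' by auto
      have "{a..b} \<subseteq> cball x e'" using ab by (auto simp: dist_real_def)
      then have "(a,b) \<in> I" using ab e' by (auto simp: I_def)
      then show "\<exists>i. i \<in> I \<and> x \<in> cball ((fst i + snd i)/2) ((snd i - fst i)/2) \<and> (snd i - fst i)/2 < d"
        using ab cb[of "(a,b)"] by (intro exI[of _ "(a,b)"]) (simp del: mem_cball)
    qed
    define Z where "Z = E - (\<Union>i\<in>C. {fst i..snd i})"
    have Z: "negligible Z" using C(4) by (simp add: cb Z_def)
    have gZ: "negligible (g ` Z)"
    proof (rule negligible_locally_Lipschitz_image[OF _ Z])
      show "\<exists>T B. open T \<and> x \<in> T \<and> (\<forall>y\<in>Z \<inter> T. norm (g y - g x) \<le> B * norm (y - x))" if "x \<in> Z" for x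
        using lipschitz_onD[OF lip] by (intro exI[of _ UNIV] exI[of _ K]) (auto simp: dist_norm)
    qed simp
    have disj: "{fst i..snd i} \<inter> {fst j..snd j} = {}" if "i \<in> C" "j \<in> C" "i \<noteq> j" for i j
      using C(3) that unfolding pairwise_def by (auto simp: cb disjnt_def)
    have disjg: "disjoint_family_on (\<lambda>i. {g (fst i)..g (snd i)}) C"
    proof (unfold disjoint_family_on_def, intro ballI impI, rule ccontr)
      fix i j assume ij: "i \<in> C" "j \<in> C" "i \<noteq> j"
        and "{g (fst i)..g (snd i)} \<inter> {g (fst j)..g (snd j)} \<noteq> {}"
      then obtain z where "z \<in> {g (fst i)..g (snd i)} \<inter> {g (fst j)..g (snd j)}" by blast
      then have z: "g (fst i) \<le> z" "g (fst j) \<le> z" "z \<le> g (snd i)" "z \<le> g (snd j)"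
        by auto
      then have "fst i \<le> snd j" "fst j \<le> snd i"
        using le order_trans by blast+
      moreover have "fst i \<le> snd i" "fst j \<le> snd j" using C(2) ij by (auto simp: I_def)
      ultimately have "max (fst i) (fst j) \<in> {fst i..snd i} \<inter> {fst j..snd j}" by auto
      then show False using disj[OF ij] by auto
    qed
    have "g ` E \<subseteq> g ` Z \<union> (\<Union>i\<in>C. {g (fst i)..g (snd i)})"
      using le by (auto simp: Z_def)
    moreover have "g ` Z \<in> null_sets lebesgue" using gZ by (simp add: negligible_iff_null_sets)
    moreover have U: "(\<Union>i\<in>C. {g (fst i)..g (snd i)}) \<in> sets lebesgue"
      using C(1) by (intro sets.countable_UN') auto
    moreover have "emeasure lebesgue (g ` E) \<le> emeasure lebesgue ((\<Union>i\<in>C. {g (fst i)..g (snd i)}) \<union> g ` Z)"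
      using U calculation(1) null_setsD2[OF calculation(2)] by (intro emeasure_mono sets.Un) auto
    ultimately have "emeasure lebesgue (g ` E) \<le> emeasure lebesgue (\<Union>i\<in>C. {g (fst i)..g (snd i)})"
      by (simp add: emeasure_Un_null_set)
    also have "\<dots> = (\<integral>\<^sup>+i. emeasure lebesgue {g (fst i)..g (snd i)} \<partial>count_space C)"
      by (rule emeasure_UN_countable[OF _ C(1) disjg]) auto
    also have "\<dots> \<le> (\<integral>\<^sup>+i. ennreal r * emeasure lebesgue {fst i..snd i} \<partial>count_space C)"
    proof (rule nn_integral_mono)
      fix i assume "i \<in> space (count_space C)"
      then have i: "fst i < snd i" "g (snd i) - g (fst i) \<le> r * (snd i - fst i)"
        using C(2) by (auto simp: I_def)
      then have "g (fst i) \<le> g (snd i)" by (simp add: le)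
      with i r show "emeasure lebesgue {g (fst i)..g (snd i)} \<le> ennreal r * emeasure lebesgue {fst i..snd i}"
        by (simp add: ennreal_mult[symmetric] ennreal_leI)
    qed
    also have "\<dots> = ennreal r * (\<integral>\<^sup>+i. emeasure lebesgue {fst i..snd i} \<partial>count_space C)"
      by (rule nn_integral_cmult) simp
    also have "(\<integral>\<^sup>+i. emeasure lebesgue {fst i..snd i} \<partial>count_space C) = emeasure lebesgue (\<Union>i\<in>C. {fst i..snd i})"
      by (rule emeasure_UN_countable[symmetric, OF _ C(1)]) (use disj in \<open>auto simp: disjoint_family_on_def\<close>)
    also have "\<dots> \<le> emeasure lebesgue T"
      using C(2) Tm by (intro emeasure_mono) (auto simp: I_def)
    also have "emeasure lebesgue T \<le> emeasure lebesgue E + emeasure lebesgue (T - E)"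
      using T E by (metis Diff_partition emeasure_subadditive fmeasurableD)
    also have "\<dots> \<le> emeasure lebesgue E + ennreal e"
      using T(4) by (intro add_left_mono) auto
    finally show ?thesis by (simp add: mult_left_mono)
  qed
  obtain m where m: "emeasure lebesgue E = ennreal m" "m \<ge> 0"
    using E by (metis emeasure_eq_measure2 measure_nonneg)
  have **: "emeasure lebesgue (g ` E) \<le> ennreal (r * m) + ennreal e" if "e > 0" for e
  proof -
    \<comment> \<open>Dividing by \<open>r + 1\<close> covers \<open>r = 0\<close> as well: the
      error \<open>r * (e / (r + 1))\<close> is at most \<open>e\<close>.\<close>
    have "emeasure lebesgue (g ` E) \<le> ennreal r * (ennreal m + ennreal (e / (r + 1)))"
      using *[of "e / (r+1)"] that r m by simp
    also have "\<dots> = ennreal (r * m + r * (e / (r + 1)))"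
      using r m that by (simp add: ennreal_mult[symmetric] ennreal_plus[symmetric] distrib_left del: ennreal_plus)
    also have "\<dots> \<le> ennreal (r * m + e)"
      using r that by (intro ennreal_leI) (simp add: field_simps)
    finally show ?thesis using r m that by simp
  qed
  then have "emeasure lebesgue (g ` E) \<le> ennreal (r * m)"
    by (rule ennreal_le_epsilon)
  then show ?thesis using m r by (simp add: ennreal_mult)
qed

text \<open>The points where, at arbitrarily small scales, the difference quotient along
  \<open>v\<close> falls below \<open>r\<close> and also exceeds \<open>s\<close>. A bounded
  quotient that fails to converge puts its point into such a set for some rational
  \<open>r < s\<close>.\<close>

definition slope_gap :: "('a::real_normed_vector \<Rightarrow> real) \<Rightarrow> 'a \<Rightarrow> real \<Rightarrow> real \<Rightarrow> 'a set" where
  "slope_gap u v r s = {x. \<forall>d>0. (\<exists>h. h \<noteq> 0 \<and> \<bar>h\<bar> < d \<and> (u (x + h *\<^sub>R v) - u x) / h < r)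
     \<and> (\<exists>h. h \<noteq> 0 \<and> \<bar>h\<bar> < d \<and> s < (u (x + h *\<^sub>R v) - u x) / h)}"

text \<open>The scales \<open>1 / Suc n\<close> suffice, which leaves a countable intersection. The
  unions over \<open>h\<close> are uncountable but consist of open sets, by continuity of
  \<open>u\<close>.\<close>

lemma slope_gap_borel:
  fixes u :: "'a::real_normed_vector \<Rightarrow> real"
  assumes u: "continuous_on UNIV u"
  shows "slope_gap u v r s \<in> sets borel"
proof -
  define q where "q h x = (u (x + h *\<^sub>R v) - u x) / h" for h :: real and x
  have cq: "continuous_on UNIV (q h)" for h
    unfolding q_def by (cases "h = 0") (auto intro!: continuous_intros continuous_on_compose2[OF u])
  have op: "open {x. q h x < r}" "open {x. s < q h x}" for h r s
    using cq by (auto intro!: open_Collect_less continuous_intros)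
  have eq: "slope_gap u v r s = (\<Inter>n::nat. (\<Union>h\<in>{h. h \<noteq> 0 \<and> \<bar>h\<bar> < 1 / Suc n}. {x. q h x < r}) \<inter>
      (\<Union>h\<in>{h. h \<noteq> 0 \<and> \<bar>h\<bar> < 1 / Suc n}. {x. s < q h x}))" (is "_ = ?R")
  proof (intro set_eqI iffI)
    fix x assume "x \<in> ?R"
    then have R: "(\<exists>h. h \<noteq> 0 \<and> \<bar>h\<bar> < 1 / Suc n \<and> q h x < r) \<and> (\<exists>h. h \<noteq> 0 \<and> \<bar>h\<bar> < 1 / Suc n \<and> s < q h x)" for n :: nat
      by blast
    show "x \<in> slope_gap u v r s"
      unfolding slope_gap_def mem_Collect_eq q_def[symmetric]
    proof (intro allI impI)
      fix d :: real assume "0 < d"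
      then obtain n where "1 / Suc n < d" using nat_approx_posE by blast
      with R[of n] show "(\<exists>h. h \<noteq> 0 \<and> \<bar>h\<bar> < d \<and> q h x < r) \<and> (\<exists>h. h \<noteq> 0 \<and> \<bar>h\<bar> < d \<and> s < q h x)"
        by (meson less_trans)
    qed
  next
    fix x assume x: "x \<in> slope_gap u v r s"
    show "x \<in> ?R"
    proof (rule INT_I)
      fix n :: nat
      have "(0::real) < 1 / Suc n" by simp
      then show "x \<in> (\<Union>h\<in>{h. h \<noteq> 0 \<and> \<bar>h\<bar> < 1 / Suc n}. {x. q h x < r}) \<inter>
          (\<Union>h\<in>{h. h \<noteq> 0 \<and> \<bar>h\<bar> < 1 / Suc n}. {x. s < q h x})"
        using x unfolding slope_gap_def mem_Collect_eq q_def[symmetric] by blast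
    qed
  qed
  show ?thesis unfolding eq
    by (intro sets.countable_INT' image_subsetI borel_open open_Int open_UN ballI op) auto
qed

text \<open>After adding a linear term, \<open>f\<close> becomes an increasing bi-Lipschitz map \<open>g\<close>. Covering the gap set
  \<open>A\<close> by intervals of small slope bounds the measure of \<open>g ` A\<close> by \<open>r'\<close> times that of \<open>A\<close>; covering
  \<open>g ` A\<close> in the same way for \<open>inv g\<close> bounds the measure of \<open>A\<close> by \<open>1 / s'\<close> times that of \<open>g ` A\<close>.\<close>

lemma negligible_slope_gap_real:
  fixes f :: "real \<Rightarrow> real"
  assumes lip: "K-lipschitz_on UNIV f" and "r < s"
  shows "negligible (slope_gap f 1 r s)"
proof (cases "r + K + 1 > 0")
  case False
  \<comment> \<open>Slopes of \<open>f\<close> are at least \<open>- K\<close>, so none lies below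
    an \<open>r\<close> with \<open>r \<le> - K - 1\<close>.\<close>
  have "slope_gap f 1 r s = {}"
  proof (rule ccontr)
    assume "slope_gap f 1 r s \<noteq> {}"
    then obtain x where "x \<in> slope_gap f 1 r s" by blast
    then have "\<forall>d>0. \<exists>h. h \<noteq> 0 \<and> \<bar>h\<bar> < d \<and> (f (x + h) - f x) / h < r"
      unfolding slope_gap_def by simp
    then obtain h where h: "h \<noteq> 0" "(f (x + h) - f x) / h < r"
      using zero_less_one by blast
    have "\<bar>f (x + h) - f x\<bar> \<le> K * \<bar>h\<bar>"
      using lipschitz_onD[OF lip, of "x+h" x] by (simp add: dist_real_def)
    then have "\<bar>(f (x + h) - f x) / h\<bar> \<le> K" using h(1) by (simp add: abs_divide divide_le_eq)
    with h(2) False show False by linarith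
  qed
  then show ?thesis by simp
next
  case True
  \<comment> \<open>The slopes of \<open>g\<close> lie between \<open>1\<close> and
    \<open>2 * K + 1\<close>, so \<open>g\<close> is an increasing bijection of the line with a
    \<open>1\<close>-Lipschitz inverse. Both thresholds move up by \<open>K + 1\<close> and become
    positive.\<close>
  define g where "g x = f x + (K + 1) * x" for x
  define r' where "r' = r + K + 1"
  define s' where "s' = s + K + 1"
  have rs: "0 < r'" "r' < s'" using True assms(2) by (auto simp: r'_def s'_def)
  have K: "K \<ge> 0" using lip by (simp add: lipschitz_on_def)
  have fl: "\<bar>f y - f x\<bar> \<le> K * \<bar>y - x\<bar>" for x y
    using lipschitz_onD[OF lip, of y x] by (simp add: dist_real_def)
  have up: "g y - g x \<le> (2 * K + 1) * (y - x)" if "x \<le> y" for x y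
    using fl[of y x] that by (simp add: g_def algebra_simps)
  have lo: "y - x \<le> g y - g x" if "x \<le> y" for x y
    using fl[of y x] that by (simp add: g_def algebra_simps)
  have mono: "strict_mono g"
    using lo by (intro strict_monoI) (meson diff_gt_0_iff_gt less_le_not_le less_le_trans)
  have less: "g x < g y \<longleftrightarrow> x < y" and le: "g x \<le> g y \<longleftrightarrow> x \<le> y" for x y
    using mono by (simp_all add: strict_mono_less strict_mono_less_eq)
  have glip: "(2*K+1)-lipschitz_on UNIV g"
  proof (rule lipschitz_onI)
    fix x y show "dist (g x) (g y) \<le> (2 * K + 1) * dist x y"
      using up[of x y] up[of y x] le[of x y] le[of y x] by (auto simp: dist_real_def abs_if algebra_simps)
  qed (use K in simp)
  have cont: "continuous_on UNIV g"
    using glip by (rule lipschitz_on_continuous_on)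
  have surj: "\<exists>x. g x = y" for y
  proof -
    define m where "m = \<bar>y - g 0\<bar>"
    have "g (-m) \<le> y" "y \<le> g m" "-m \<le> m"
      using lo[of 0 m] lo[of "-m" 0] by (auto simp: m_def)
    then show ?thesis
      using IVT'[of g "-m" y m] continuous_on_subset[OF cont] by auto
  qed
  define k where "k = inv g"
  have kg[simp]: "k (g x) = x" for x
    using mono by (simp add: k_def strict_mono_imp_inj_on)
  have gk[simp]: "g (k y) = y" for y
    unfolding k_def using surj[of y] by (metis f_inv_into_f rangeI)
  have kmono: "strict_mono k"
    by (rule strict_monoI) (metis gk less)
  have klip: "1-lipschitz_on UNIV k"
  proof (rule lipschitz_onI)
    fix x y show "dist (k x) (k y) \<le> 1 * dist x y"
      using lo[of "k x" "k y"] lo[of "k y" "k x"] linear[of x y]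
        strict_mono_less_eq[OF kmono, of x y] strict_mono_less_eq[OF kmono, of y x]
      by (auto simp: dist_real_def)
  qed simp
  have kcont: "continuous_on UNIV k"
    using klip by (rule lipschitz_on_continuous_on)
  have fcont: "continuous_on UNIV f"
    using lip by (rule lipschitz_on_continuous_on)
  have slope: "(g (x + h) - g x) / h = (f (x + h) - f x) / h + (K + 1)" if "h \<noteq> 0" for x h
    using that by (simp add: g_def field_simps)
  have null: "emeasure lebesgue (slope_gap f 1 r s \<inter> {-real n..real n}) = 0" for n
  proof -
    \<comment> \<open>Truncation makes the measure \<open>m\<close> of the set finite, so that the
      two covering bounds, combined to \<open>m \<le> 1 / s' * (r' * m)\<close> with
      \<open>r' < s'\<close>, force \<open>m = 0\<close>.\<close>
    define A where "A = slope_gap f 1 r s \<inter> {-real n..real n}"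
    have Ab: "A \<in> sets borel" unfolding A_def
      by (intro sets.Int slope_gap_borel fcont) auto
    have Afin: "emeasure lebesgue A \<le> ennreal (2 * n)"
    proof -
      have "emeasure lebesgue A \<le> emeasure lebesgue {-real n..real n}"
        unfolding A_def by (intro emeasure_mono) auto
      then show ?thesis by simp
    qed
    have Al: "A \<in> lmeasurable"
      using Ab Afin by (intro fmeasurableI) (auto simp: le_less_trans)
    have gA: "g ` A = k -` A \<inter> space borel"
      by (auto simp: image_iff) (metis gk)
    have gAb: "g ` A \<in> sets borel" unfolding gA
      by (intro measurable_sets[OF _ Ab] borel_measurable_continuous_onI kcont)
    have 1: "emeasure lebesgue (g ` A) \<le> ennreal r' * emeasure lebesgue A"
    proof (rule emeasure_image_small_slopes[OF mono glip Al])
      fix x d :: real assume "x \<in> A" "0 < d"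
      then obtain h where h: "h \<noteq> 0" "\<bar>h\<bar> < d" "(f (x + h) - f x) / h < r"
        by (auto simp: A_def slope_gap_def)
      then have "(g (x + h) - g x) / h < r'" by (simp add: slope r'_def)
      then show "\<exists>a b. a < b \<and> x \<in> {a..b} \<and> b - a < d \<and> g b - g a \<le> r' * (b - a)"
        using h(1,2)
        by (intro exI[of _ "min x (x+h)"] exI[of _ "max x (x+h)"])
           (auto simp: min_def max_def field_simps split: if_splits)
    qed (use gAb rs in auto)
    have fin1: "emeasure lborel (g ` A) \<le> ennreal (r' * (2 * n))"
      using order_trans[OF 1 mult_left_mono[OF Afin]] rs gAb by (simp add: ennreal_mult)
    have "g ` A \<in> lmeasurable"
      using gAb by (intro fmeasurableI) (auto intro: le_less_trans[OF fin1])
    then have 2: "emeasure lebesgue (k ` (g ` A)) \<le> ennreal (1 / s') * emeasure lebesgue (g ` A)"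
    proof (rule emeasure_image_small_slopes[OF kmono klip])
      fix y d :: real assume "y \<in> g ` A" "0 < d"
      then obtain x where x: "x \<in> A" "y = g x" by auto
      \<comment> \<open>Since \<open>g\<close> stretches lengths by at most
        \<open>2 * K + 1\<close>, this step size keeps the image interval shorter than
        \<open>d\<close>.\<close>
      have "d / (2*K+1) > 0" using \<open>0 < d\<close> K by simp
      with x(1) obtain h where h: "h \<noteq> 0" "\<bar>h\<bar> < d / (2*K+1)" "s < (f (x + h) - f x) / h"
        by (auto simp: A_def slope_gap_def)
      define a b where "a = min x (x+h)" and "b = max x (x+h)"
      have ab: "a < b" "x \<in> {a..b}" "b - a = \<bar>h\<bar>" using h(1) by (auto simp: a_def b_def)
      have "s' < (g (x + h) - g x) / h" using h by (simp add: slope s'_def)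
      then have "s' * (b - a) \<le> g b - g a"
        using h(1) by (auto simp: a_def b_def min_def max_def field_simps split: if_splits)
      moreover have "g b - g a < d"
      proof -
        have "g b - g a \<le> (2*K+1) * \<bar>h\<bar>" using up[of a b] ab by simp
        also have "\<dots> < d" using h(2) K by (simp add: field_simps)
        finally show ?thesis .
      qed
      ultimately show "\<exists>a b. a < b \<and> y \<in> {a..b} \<and> b - a < d \<and> k b - k a \<le> 1 / s' * (b - a)"
        using ab x(2) rs by (intro exI[of _ "g a"] exI[of _ "g b"]) (auto simp: less le field_simps)
    qed (use Ab rs in \<open>auto simp: image_image\<close>)
    obtain m where m: "emeasure lebesgue A = ennreal m" "m \<ge> 0"
      using Al by (metis emeasure_eq_measure2 measure_nonneg)
    have "ennreal m \<le> ennreal (1 / s') * emeasure lebesgue (g ` A)"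
      using 2 m by (simp add: image_image)
    also have "\<dots> \<le> ennreal (1 / s') * (ennreal r' * ennreal m)"
      using 1 m by (intro mult_left_mono) auto
    also have "\<dots> = ennreal (1 / s' * (r' * m))"
      using rs m by (simp add: ennreal_mult[symmetric])
    finally have "m \<le> 1 / s' * (r' * m)"
      using rs m by (subst (asm) ennreal_le_iff) auto
    then have "(s' - r') * m \<le> 0" using rs by (simp add: field_simps)
    then have "m = 0" using rs m by (simp add: mult_le_0_iff)
    then show ?thesis using m by (simp add: A_def)
  qed
  have eq: "slope_gap f 1 r s = (\<Union>n. slope_gap f 1 r s \<inter> {-real n..real n})"
  proof -
    have "\<exists>n. x \<in> {-real n..real n}" for x
    proof -
      obtain n where "\<bar>x\<bar> \<le> real n" using real_arch_simple by blast
      then show ?thesis by (intro exI[of _ n]) auto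
    qed
    then show ?thesis by blast
  qed
  show ?thesis
    unfolding negligible_iff_null_sets by (subst eq, rule null_sets_UN)
      (use null slope_gap_borel[OF fcont] in \<open>auto intro!: null_setsI\<close>)
qed

text \<open>Reduction to lines: integrate the indicator of \<open>{(x, t). x + t *\<^sub>R v \<in> B \<and> 0 \<le> t \<and> t \<le> 1}\<close> in both orders.
  This avoids choosing coordinates adapted to \<open>v\<close>.\<close>

lemma AE_slope_gap:
  fixes u :: "'a::euclidean_space \<Rightarrow> real"
  assumes lip: "K-lipschitz_on UNIV u" and "r < s"
  shows "AE x in lborel. x \<notin> slope_gap u v r s"
proof -
  define B where "B = slope_gap u v r s"
  have K: "K \<ge> 0" using lip by (simp add: lipschitz_on_def)
  have B[measurable]: "B \<in> sets borel"
    unfolding B_def by (rule slope_gap_borel) (rule lipschitz_on_continuous_on[OF lip])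
  \<comment> \<open>The cutoff \<open>{0..1}\<close> has length one: integrated over
    \<open>x\<close> first, each \<open>t\<close> in it contributes exactly the measure of
    \<open>B\<close>; integrated over \<open>t\<close> first, every line contributes zero.\<close>
  define f :: "'a \<Rightarrow> real \<Rightarrow> ennreal" where "f x t = indicator B (x + t *\<^sub>R v) * indicator {0..1} t" for x t
  have [measurable]: "case_prod f \<in> borel_measurable (lborel \<Otimes>\<^sub>M lborel)"
    unfolding f_def by measurable
  have swap: "(\<integral>\<^sup>+t. \<integral>\<^sup>+x. f x t \<partial>lborel \<partial>lborel) = (\<integral>\<^sup>+x. \<integral>\<^sup>+t. f x t \<partial>lborel \<partial>lborel)"
    by (rule lborel_pair.Fubini') measurable
  have "(\<integral>\<^sup>+t. f x t \<partial>lborel) = 0" for x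
  proof -
    have "(K * norm v)-lipschitz_on UNIV (\<lambda>t. u (x + t *\<^sub>R v))"
    proof (rule lipschitz_onI)
      fix t t' :: real
      show "dist (u (x + t *\<^sub>R v)) (u (x + t' *\<^sub>R v)) \<le> K * norm v * dist t t'"
        using lipschitz_onD[OF lip, of "x + t *\<^sub>R v" "x + t' *\<^sub>R v"]
        by (simp add: dist_norm scaleR_diff_left[symmetric] mult.assoc mult.commute[of "norm v"])
    qed (use K in simp)
    then have "negligible (slope_gap (\<lambda>t. u (x + t *\<^sub>R v)) 1 r s)"
      by (rule negligible_slope_gap_real) fact
    moreover have "slope_gap (\<lambda>t. u (x + t *\<^sub>R v)) 1 r s = {t. x + t *\<^sub>R v \<in> B}"
      by (auto simp: slope_gap_def B_def algebra_simps)
    moreover have "{t. x + t *\<^sub>R v \<in> B} \<in> sets borel" by measurable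
    ultimately have "emeasure lborel {t. x + t *\<^sub>R v \<in> B} = 0"
      by (simp add: negligible_iff_null_sets null_sets_def)
    moreover have "(\<integral>\<^sup>+t. f x t \<partial>lborel) \<le> (\<integral>\<^sup>+t. indicator {t. x + t *\<^sub>R v \<in> B} t \<partial>lborel)"
      by (rule nn_integral_mono) (auto simp: f_def indicator_def)
    moreover have "(\<integral>\<^sup>+t. indicator {t. x + t *\<^sub>R v \<in> B} t \<partial>lborel) = emeasure lborel {t. x + t *\<^sub>R v \<in> B}"
      by (rule nn_integral_indicator) measurable
    ultimately show ?thesis by simp
  qed
  moreover have "(\<integral>\<^sup>+x. f x t \<partial>lborel) = emeasure lborel B * indicator {0..1} t" for t
  proof -
    have "(\<integral>\<^sup>+x. f x t \<partial>lborel) = (\<integral>\<^sup>+x. indicator B (t *\<^sub>R v + x) \<partial>lborel) * indicator {0..1} t"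
      unfolding f_def by (subst nn_integral_multc) (auto simp: add.commute)
    also have "(\<integral>\<^sup>+x. indicator B (t *\<^sub>R v + x) \<partial>lborel) = (\<integral>\<^sup>+x. indicator B x \<partial>(distr lborel borel ((+) (t *\<^sub>R v))))"
      by (subst nn_integral_distr) auto
    also have "\<dots> = emeasure lborel B"
      by (simp add: lborel_distr_plus)
    finally show ?thesis .
  qed
  ultimately have "emeasure lborel B = 0"
    using swap by (simp add: nn_integral_cmult)
  then show ?thesis
    by (intro AE_I[of _ _ B]) (auto simp: B_def[symmetric])
qed

text \<open>If the lower limit at zero were below the upper one, two rationals between them would
  contradict \<open>gap\<close>. Rational thresholds keep the number of exceptional sets countable,
  and \<open>M\<close> makes the common limit finite.\<close>

lemma slope_tendsto:
  fixes q :: "real \<Rightarrow> real"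
  assumes bd: "\<And>h. \<bar>q h\<bar> \<le> M"
    and gap: "\<And>r s :: rat. r < s \<Longrightarrow> \<not> (\<forall>d>0. (\<exists>h. h \<noteq> 0 \<and> \<bar>h\<bar> < d \<and> q h < of_rat r) \<and> (\<exists>h. h \<noteq> 0 \<and> \<bar>h\<bar> < d \<and> of_rat s < q h))"
  shows "\<exists>l. (q \<longlongrightarrow> l) (at 0)"
proof -
  define A where "A = Liminf (at 0) (\<lambda>h. ereal (q h))"
  define B where "B = Limsup (at 0) (\<lambda>h. ereal (q h))"
  have bd': "- M \<le> q h" "q h \<le> M" for h using bd[of h] by auto
  have AB: "A \<le> B" unfolding A_def B_def by (rule Liminf_le_Limsup) simp
  have AM: "ereal (-M) \<le> A" unfolding A_def by (rule Liminf_bounded) (use bd' in simp)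
  have BM: "B \<le> ereal M" unfolding B_def by (rule Limsup_bounded) (use bd' in simp)
  have "\<not> A < B"
  proof
    assume "A < B"
    then obtain x where x: "A < ereal x" "ereal x < B" using ereal_dense2 by blast
    then obtain y where y: "ereal x < ereal y" "ereal y < B" using ereal_dense2 by blast
    have "x < y" using y by simp
    then obtain r where r: "x < of_rat r" "of_rat r < y" using of_rat_dense by blast
    then obtain s where s: "of_rat r < (of_rat s :: real)" "of_rat s < y" using of_rat_dense by blast
    have fr: "\<exists>h. h \<noteq> 0 \<and> \<bar>h\<bar> < d \<and> q h < of_rat r" if "d > 0" for d
    proof (rule ccontr)
      assume "\<not> ?thesis"
      then have "eventually (\<lambda>h. ereal (of_rat r) \<le> ereal (q h)) (at 0)"
        unfolding eventually_at using that by (intro exI[of _ d]) (auto simp: dist_real_def not_less)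
      then have "ereal (of_rat r) \<le> A" unfolding A_def by (rule Liminf_bounded)
      then show False using x(1) r(1) by (meson ereal_less_eq(3) leD less_eq_ereal_def less_le_trans order.strict_trans2 less_imp_le)
    qed
    have fs: "\<exists>h. h \<noteq> 0 \<and> \<bar>h\<bar> < d \<and> of_rat s < q h" if "d > 0" for d
    proof (rule ccontr)
      assume "\<not> ?thesis"
      then have "eventually (\<lambda>h. ereal (q h) \<le> ereal (of_rat s)) (at 0)"
        unfolding eventually_at using that by (intro exI[of _ d]) (auto simp: dist_real_def not_less)
      then have "B \<le> ereal (of_rat s)" unfolding B_def by (rule Limsup_bounded)
      also have "\<dots> < ereal y" using s by simp
      finally show False using y(2) by simp
    qed
    have "r < s" using s(1) by (simp add: of_rat_less)
    from gap[OF this] fr fs show False by blast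
  qed
  with AB have eq: "A = B" by simp
  obtain l where l: "A = ereal l"
    using AM BM eq by (cases A) auto
  have "((\<lambda>h. ereal (q h)) \<longlongrightarrow> ereal l) (at 0)"
    by (rule Liminf_eq_Limsup) (use l eq in \<open>simp_all add: A_def B_def\<close>)
  then show ?thesis by (auto intro!: exI[of _ l])
qed

lemma AE_directional_derivative:
  fixes u :: "'a::euclidean_space \<Rightarrow> real"
  assumes lip: "K-lipschitz_on UNIV u"
  shows "AE x in lborel. \<exists>l. ((\<lambda>h. (u (x + h *\<^sub>R v) - u x) / h) \<longlongrightarrow> l) (at 0)"
proof -
  have "AE x in lborel. \<forall>r s :: rat. r < s \<longrightarrow> x \<notin> slope_gap u v (of_rat r) (of_rat s)"
    unfolding AE_all_countable
  proof (intro allI)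
    fix r s :: rat
    show "AE x in lborel. r < s \<longrightarrow> x \<notin> slope_gap u v (of_rat r) (of_rat s)"
      using AE_slope_gap[OF lip, of "of_rat r" "of_rat s" v]
      by (cases "r < s") (auto simp: of_rat_less)
  qed
  then show ?thesis
  proof (eventually_elim)
    case (elim x)
    show ?case
    proof (rule slope_tendsto)
      fix h :: real
      have "\<bar>u (x + h *\<^sub>R v) - u x\<bar> \<le> K * (\<bar>h\<bar> * norm v)"
        using lipschitz_onD[OF lip, of "x + h *\<^sub>R v" x] by (simp add: dist_norm)
      then show "\<bar>(u (x + h *\<^sub>R v) - u x) / h\<bar> \<le> K * norm v"
        using lipschitz_on_nonneg[OF lip]
        by (cases "h = 0") (auto simp: abs_divide divide_le_eq mult_ac)
    qed (use elim in \<open>auto simp: slope_gap_def\<close>)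
  qed
qed

section \<open>Mollification and Rademacher's theorem\<close>

text \<open>The index \<open>m\<close> makes the family closed under differentiation up to linear combinations.\<close>

definition flat_exp :: "nat \<Rightarrow> real \<Rightarrow> real" where
  "flat_exp m t = (if t \<le> 0 then 0 else exp (- inverse t) * inverse t ^ m)"

lemma flat_exp_nonneg: "0 \<le> flat_exp m t"
  by (simp add: flat_exp_def)

lemma flat_exp_0_pos: "0 < flat_exp 0 t \<longleftrightarrow> 0 < t"
  by (simp add: flat_exp_def)

lemma flat_exp_tendsto_0: "(flat_exp m \<longlongrightarrow> 0) (at 0)"
proof -
  have "((\<lambda>t::real. inverse t ^ m / exp (inverse t)) \<longlongrightarrow> 0) (at_right 0)"
    by (rule filterlim_compose[OF tendsto_power_div_exp_0 filterlim_inverse_at_top_right])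
  then have "(flat_exp m \<longlongrightarrow> 0) (at_right 0)"
    by (rule Lim_transform_eventually)
       (auto simp: flat_exp_def eventually_at_filter exp_minus field_simps)
  moreover have "(flat_exp m \<longlongrightarrow> 0) (at_left 0)"
    by (rule Lim_transform_eventually[OF tendsto_const])
       (auto simp: flat_exp_def eventually_at_filter)
  ultimately show ?thesis by (simp add: filterlim_split_at)
qed

text \<open>The critical point is \<open>t = 0\<close>, where the difference quotient of
  \<open>flat_exp m\<close> is \<open>flat_exp (m + 1)\<close> itself, which tends to zero.\<close>

lemma flat_exp_has_derivative:
  "(flat_exp m has_real_derivative flat_exp (m + 2) t - m * flat_exp (m + 1) t) (at t)"
proof (cases t "0 :: real" rule: linorder_cases)
  case less
  have D: "((\<lambda>t::real. 0) has_real_derivative flat_exp (m + 2) t - m * flat_exp (m + 1) t) (at t)"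
    using less by (simp add: flat_exp_def)
  have "\<forall>\<^sub>F s in nhds t. s < 0"
    using less by (intro eventually_nhds_in_open[of "{..<0}", simplified]) auto
  then have ev: "\<forall>\<^sub>F s in nhds t. 0 = flat_exp m s"
    by eventually_elim (simp add: flat_exp_def)
  show ?thesis
    using D unfolding DERIV_cong_ev[OF refl ev refl] .
next
  case equal
  have "(\<lambda>h. (flat_exp m (0 + h) - flat_exp m 0) / h) \<midarrow>0\<rightarrow> 0"
    by (rule Lim_transform_eventually[OF flat_exp_tendsto_0[of "m+1"]])
       (auto simp: flat_exp_def eventually_at_filter field_simps)
  then show ?thesis using equal by (simp add: DERIV_def flat_exp_def)
next
  case greater
  have D: "((\<lambda>t. exp (- inverse t) * inverse t ^ m) has_real_derivative flat_exp (m + 2) t - m * flat_exp (m + 1) t) (at t)"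
    using greater
    by (auto intro!: derivative_eq_intros simp: flat_exp_def) (cases m; simp add: field_simps power2_eq_square)
  have "\<forall>\<^sub>F s in nhds t. 0 < s"
    using greater by (intro eventually_nhds_in_open[of "{0<..}", simplified]) auto
  then have ev: "\<forall>\<^sub>F s in nhds t. exp (- inverse s) * inverse s ^ m = flat_exp m s"
    by eventually_elim (simp add: flat_exp_def)
  show ?thesis
    using D unfolding DERIV_cong_ev[OF refl ev refl] .
qed

lemma continuous_on_flat_exp: "continuous_on A (flat_exp m)"
  by (rule DERIV_continuous_on) (rule has_field_derivative_at_within[OF flat_exp_has_derivative])

text \<open>The standard mollifier profile composed with a polynomial, hence smooth. The factor
  \<open>c\<close> sharpens it: as \<open>c\<close> grows, the bump tends to the indicator of the
  open ball of radius \<rho>.\<close>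

definition bump :: "real \<Rightarrow> real \<Rightarrow> 'a::euclidean_space \<Rightarrow> real" where
  "bump c \<rho> x = flat_exp 0 (c * (\<rho>^2 - x \<bullet> x))"

lemma integrable_compact_support:
  fixes f :: "'a::euclidean_space \<Rightarrow> real"
  assumes "continuous_on UNIV f" and "\<And>x. norm x > \<rho> \<Longrightarrow> f x = 0"
  shows "integrable lborel f"
proof -
  have "integrable lborel (\<lambda>x. indicator (cball 0 \<rho>) x *\<^sub>R f x)"
    by (rule borel_integrable_compact) (use assms in \<open>auto intro: continuous_on_subset\<close>)
  also have "(\<lambda>x. indicator (cball 0 \<rho>) x *\<^sub>R f x) = f"
    using assms(2) by (auto simp: indicator_def fun_eq_iff not_le)
  finally show ?thesis .
qed

lemma lborel_distr_minus: "distr lborel borel (\<lambda>y. x - y) = (lborel :: 'a::euclidean_space measure)"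
  using lborel_affine[of "-1" x] by (simp add: density_1)

lemma integral_lborel_reflect:
  fixes f :: "'a::euclidean_space \<Rightarrow> real"
  assumes [measurable]: "f \<in> borel_measurable borel"
  shows "(\<integral>y. f (x - y) \<partial>lborel) = (\<integral>y. f y \<partial>lborel)"
proof -
  have "(\<integral>y. f y \<partial>lborel) = (\<integral>y. f y \<partial>(distr lborel borel (\<lambda>y. x - y)))"
    by (simp only: lborel_distr_minus)
  also have "\<dots> = (\<integral>y. f (x - y) \<partial>lborel)"
    by (rule integral_distr) auto
  finally show ?thesis by simp
qed

lemma AE_lborel_reflect:
  fixes P :: "'a::euclidean_space \<Rightarrow> bool"
  assumes "AE y in lborel. P y"
  shows "AE y in lborel. P (x - y)"
proof -
  from assms obtain N where N: "{y \<in> space lborel. \<not> P y} \<subseteq> N" "emeasure lborel N = 0" "N \<in> sets lborel"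
    by (rule AE_E)
  have "emeasure lborel ((\<lambda>y. x - y) -` N) = emeasure (distr lborel borel (\<lambda>y. x - y)) N"
    using N(3) by (subst emeasure_distr) auto
  also have "\<dots> = 0" using N(2) by (simp only: lborel_distr_minus)
  finally show ?thesis
    by (rule AE_I[rotated]) (use N measurable_sets[of "\<lambda>y. x - y" borel borel N] in auto)
qed

section \<open>Convolution with test functions of compact support\<close>

definition conv :: "('a::euclidean_space \<Rightarrow> real) \<Rightarrow> ('a \<Rightarrow> real) \<Rightarrow> 'a \<Rightarrow> real" where
  "conv u \<phi> x = (\<integral>y. u (x - y) * \<phi> y \<partial>lborel)"

text \<open>Continuously differentiable functions supported in a ball. The derivative is a
  parameter, so that both the explicit formula for a bump and an abstract
  \<open>frechet_derivative\<close> can be plugged in.\<close>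

locale test_fun =
  fixes \<phi> :: "'a::euclidean_space \<Rightarrow> real" and \<phi>' :: "'a \<Rightarrow> 'a \<Rightarrow> real" and \<rho> :: real
  assumes deriv: "\<And>x. (\<phi> has_derivative \<phi>' x) (at x)"
    and deriv_cont: "\<And>v. continuous_on UNIV (\<lambda>x. \<phi>' x v)"
    and support: "\<And>x. norm x > \<rho> \<Longrightarrow> \<phi> x = 0"
begin

lemma cont: "continuous_on UNIV \<phi>"
  by (rule has_derivative_continuous_on) (rule has_derivative_at_withinI[OF deriv])

lemma deriv_support: "\<phi>' x v = 0" if "norm x > \<rho>"
proof -
  have "(\<phi> has_derivative (\<lambda>_. 0)) (at x)"
  proof (rule has_derivative_transform_within_open[of "\<lambda>_. 0" _ _ _ "{x. norm x > \<rho>}"])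
    show "open {x::'a. \<rho> < norm x}" by (intro open_Collect_less continuous_intros)
  qed (use that support in auto)
  then show ?thesis using has_derivative_unique[OF deriv] by metis
qed

lemma lin: "linear (\<phi>' x)"
  by (rule has_derivative_linear[OF deriv])

lemma deriv_bounded: obtains M where "0 < M" "\<And>x v. \<bar>\<phi>' x v\<bar> \<le> M * norm v"
proof -
  have "\<exists>m. \<forall>x. \<bar>\<phi>' x b\<bar> \<le> m" for b
  proof -
    have "compact ((\<lambda>x. \<phi>' x b) ` cball 0 \<rho>)"
      by (intro compact_continuous_image continuous_on_subset[OF deriv_cont]) auto
    then obtain m where m: "\<forall>y\<in>(\<lambda>x. \<phi>' x b) ` cball 0 \<rho>. norm y \<le> m"
      using compact_imp_bounded bounded_iff by metis
    have "\<bar>\<phi>' x b\<bar> \<le> max m 0" for x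
      using m deriv_support[of x b] by (cases "norm x > \<rho>") (auto intro: max.coboundedI1)
    then show ?thesis by blast
  qed
  then obtain m where m: "\<And>b x. \<bar>\<phi>' x b\<bar> \<le> m b" by metis
  have "\<bar>\<phi>' x v\<bar> \<le> (\<Sum>b\<in>Basis. m b + 1) * norm v" for x v
  proof -
    have "\<phi>' x v = \<phi>' x (\<Sum>b\<in>Basis. (v \<bullet> b) *\<^sub>R b)" by (simp add: euclidean_representation)
    also have "\<dots> = (\<Sum>b\<in>Basis. (v \<bullet> b) * \<phi>' x b)"
      by (simp add: linear_sum[OF lin] linear_cmul[OF lin])
    finally have "\<bar>\<phi>' x v\<bar> \<le> (\<Sum>b\<in>Basis. \<bar>(v \<bullet> b) * \<phi>' x b\<bar>)" by simp
    also have "\<dots> \<le> (\<Sum>b\<in>Basis. (m b + 1) * norm v)"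
    proof (rule sum_mono)
      fix b :: 'a assume "b \<in> Basis"
      then have "\<bar>v \<bullet> b\<bar> * \<bar>\<phi>' x b\<bar> \<le> norm v * (m b + 1)"
        using m[of x b] by (intro mult_mono) (auto simp: Basis_le_norm)
      then show "\<bar>(v \<bullet> b) * \<phi>' x b\<bar> \<le> (m b + 1) * norm v" by (simp add: abs_mult mult.commute)
    qed
    finally show ?thesis by (simp add: sum_distrib_right)
  qed
  moreover have "(\<Sum>b\<in>(Basis::'a set). m b + 1) > 0"
  proof (rule sum_pos)
    show "0 < m b + 1" for b using m[of 0 b] by linarith
  qed auto
  ultimately show ?thesis using that by blast
qed

lemma integrable_deriv:
  fixes u :: "'a \<Rightarrow> real"
  assumes "continuous_on UNIV u"
  shows "integrable lborel (\<lambda>y. u y * \<phi>' (x - y) v)"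
proof (rule integrable_compact_support)
  show "continuous_on UNIV (\<lambda>y. u y * \<phi>' (x - y) v)"
    by (intro continuous_intros assms continuous_on_compose2[OF deriv_cont]) auto
  fix y :: 'a assume "norm y > norm x + \<rho>"
  then have "norm (x - y) > \<rho>" using norm_triangle_ineq2[of y x] by (simp add: norm_minus_commute)
  then show "u y * \<phi>' (x - y) v = 0" by (simp add: deriv_support)
qed

lemma integrable_conv:
  fixes u :: "'a \<Rightarrow> real"
  assumes "continuous_on UNIV u"
  shows "integrable lborel (\<lambda>y. u y * \<phi> (x - y))"
proof (rule integrable_compact_support)
  show "continuous_on UNIV (\<lambda>y. u y * \<phi> (x - y))"
    by (intro continuous_intros assms continuous_on_compose2[OF cont]) auto
  fix y :: 'a assume "norm y > norm x + \<rho>"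
  then have "norm (x - y) > \<rho>" using norm_triangle_ineq2[of y x] by (simp add: norm_minus_commute)
  then show "u y * \<phi> (x - y) = 0" by (simp add: support)
qed

lemma integrable_conv':
  fixes u :: "'a \<Rightarrow> real"
  assumes "continuous_on UNIV u"
  shows "integrable lborel (\<lambda>y. u (x - y) * \<phi> y)"
  by (rule integrable_compact_support[of _ \<rho>])
    (auto intro!: continuous_intros cont continuous_on_compose2[OF assms] simp: support)

text \<open>Reflection moves \<open>x\<close> from \<open>u\<close> to \<phi>. The defining form
  shows periodicity and the difference quotients of \<open>u\<close>; this form lets \<phi> carry
  the derivative.\<close>

lemma conv_altdef:
  fixes u :: "'a \<Rightarrow> real"
  assumes "continuous_on UNIV u"
  shows "conv u \<phi> x = (\<integral>y. u y * \<phi> (x - y) \<partial>lborel)"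
proof -
  have [measurable]: "u \<in> borel_measurable borel" "\<phi> \<in> borel_measurable borel"
    using assms cont by (auto intro: borel_measurable_continuous_onI)
  show ?thesis
    unfolding conv_def using integral_lborel_reflect[of "\<lambda>y. u y * \<phi> (x - y)" x] by simp
qed

text \<open>Differentiation under the integral along an arbitrary sequence of increments. The
  normalised remainder of \<phi> tends to zero pointwise and is bounded by \<open>2 * M\<close>:
  once \<open>M\<close> from the Lipschitz bound on \<phi>, once from its derivative.\<close>

lemma conv_has_derivative:
  fixes u :: "'a \<Rightarrow> real"
  assumes u: "continuous_on UNIV u"
  shows "(conv u \<phi> has_derivative (\<lambda>v. \<integral>y. u y * \<phi>' (x - y) v \<partial>lborel)) (at x)"
proof -
  define D where "D v = (\<integral>y. u y * \<phi>' (x - y) v \<partial>lborel)" for v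
  obtain M where M: "0 < M" "\<And>x v. \<bar>\<phi>' x v\<bar> \<le> M * norm v" by (rule deriv_bounded) blast
  have [measurable]: "u \<in> borel_measurable borel" "\<phi> \<in> borel_measurable borel" "\<And>v. (\<lambda>x. \<phi>' x v) \<in> borel_measurable borel"
    using u cont deriv_cont by (auto intro: borel_measurable_continuous_onI)
  have lip: "\<bar>\<phi> a - \<phi> b\<bar> \<le> M * norm (a - b)" for a b
  proof -
    have "norm (\<phi> a - \<phi> b) \<le> M * norm (a - b)"
    proof (rule differentiable_bound[of UNIV \<phi> \<phi>'])
      show "onorm (\<phi>' x) \<le> M" for x using M by (intro onorm_le) auto
    qed (use deriv in auto)
    then show ?thesis by simp
  qed
  have "linear D"
    by (rule linearI) (simp_all add: D_def linear_add[OF lin] linear_cmul[OF lin] distrib_left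
        integrable_deriv[OF u] mult.left_commute)
  then have "bounded_linear D" by (rule linear_conv_bounded_linear[THEN iffD1])
  moreover have "((\<lambda>h. norm (conv u \<phi> (x + h) - conv u \<phi> x - D h) / norm h) \<longlongrightarrow> 0) (at 0)"
    unfolding tendsto_at_iff_sequentially
  proof (intro allI impI)
    fix X :: "nat \<Rightarrow> 'a" assume X: "\<forall>i. X i \<in> UNIV - {0}" "X \<longlonglongrightarrow> 0"
    define F where "F n y = u y * ((\<phi> (x + X n - y) - \<phi> (x - y) - \<phi>' (x - y) (X n)) / norm (X n))" for n y
    have int: "(\<integral>y. F n y \<partial>lborel) = (conv u \<phi> (x + X n) - conv u \<phi> x - D (X n)) / norm (X n)" for n
    proof -
      have "F n = (\<lambda>y. (u y * \<phi> (x + X n - y) - u y * \<phi> (x - y) - u y * \<phi>' (x - y) (X n)) / norm (X n))"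
        by (auto simp: F_def fun_eq_iff algebra_simps diff_divide_distrib)
      then show ?thesis
        by (simp add: conv_altdef[OF u] D_def integrable_conv[OF u] integrable_deriv[OF u])
    qed
    have bX: "\<exists>B. \<forall>n. norm (X n) \<le> B"
      using convergent_imp_Bseq[OF convergentI[OF X(2)]] by (auto simp: Bseq_def)
    then obtain B where B: "\<And>n. norm (X n) \<le> B" by blast
    \<comment> \<open>Outside this radius both \<open>x - y\<close> and \<open>x + X n - y\<close>
      lie off the support for every \<open>n\<close>, since \<open>B\<close> bounds all
      increments.\<close>
    define R where "R = norm x + \<rho> + B"
    have "(\<lambda>n. \<integral>y. F n y \<partial>lborel) \<longlonglongrightarrow> (\<integral>y. 0 \<partial>(lborel :: 'a measure))"
    proof (rule integral_dominated_convergence[where w = "\<lambda>y. indicator (cball 0 R) y *\<^sub>R (2 * M * \<bar>u y\<bar>)"])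
      show "integrable lborel (\<lambda>y. indicator (cball 0 R) y *\<^sub>R (2 * M * \<bar>u y\<bar>))"
        by (rule borel_integrable_compact) (auto intro!: continuous_intros continuous_on_subset[OF u])
      show "F n \<in> borel_measurable lborel" for n
        unfolding F_def by measurable
      show "AE y in lborel. (\<lambda>n. F n y) \<longlonglongrightarrow> 0"
      proof (rule AE_I2)
        fix y :: 'a
        have "((\<lambda>h. norm (\<phi> (x - y + h) - \<phi> (x - y) - \<phi>' (x - y) h) / norm h) \<longlongrightarrow> 0) (at 0)"
          using deriv[of "x - y"] by (simp add: has_derivative_at)
        then have "(\<lambda>n. norm (\<phi> (x - y + X n) - \<phi> (x - y) - \<phi>' (x - y) (X n)) / norm (X n)) \<longlonglongrightarrow> 0"
          unfolding tendsto_at_iff_sequentially using X by (auto simp: o_def)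
        then have "(\<lambda>n. \<bar>u y\<bar> * (norm (\<phi> (x - y + X n) - \<phi> (x - y) - \<phi>' (x - y) (X n)) / norm (X n))) \<longlonglongrightarrow> \<bar>u y\<bar> * 0"
          by (rule tendsto_mult_left)
        moreover have eq: "x - y + X n = x + X n - y" for n by simp
        ultimately have "(\<lambda>n. \<bar>F n y\<bar>) \<longlonglongrightarrow> 0"
          by (simp add: F_def abs_mult abs_divide eq)
        then show "(\<lambda>n. F n y) \<longlonglongrightarrow> 0" by (simp add: tendsto_rabs_zero_iff)
      qed
      show "AE y in lborel. norm (F n y) \<le> indicator (cball 0 R) y *\<^sub>R (2 * M * \<bar>u y\<bar>)" for n
      proof (rule AE_I2)
        fix y :: 'a
        show "norm (F n y) \<le> indicator (cball 0 R) y *\<^sub>R (2 * M * \<bar>u y\<bar>)"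
        proof (cases "y \<in> cball 0 R")
          case True
          have nz: "norm (X n) > 0" using X by auto
          have "\<bar>\<phi> (x + X n - y) - \<phi> (x - y) - \<phi>' (x - y) (X n)\<bar> \<le> M * norm (X n) + M * norm (X n)"
            using lip[of "x + X n - y" "x - y"] M(2)[of "x - y" "X n"]
            by (simp add: algebra_simps)
          then have "\<bar>\<phi> (x + X n - y) - \<phi> (x - y) - \<phi>' (x - y) (X n)\<bar> / norm (X n) \<le> 2 * M"
            using nz by (simp add: divide_le_eq)
          then have "\<bar>u y\<bar> * (\<bar>\<phi> (x + X n - y) - \<phi> (x - y) - \<phi>' (x - y) (X n)\<bar> / norm (X n)) \<le> \<bar>u y\<bar> * (2 * M)"
            by (rule mult_left_mono) simp
          then show ?thesis using True by (simp add: F_def abs_mult mult_ac)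
        next
          case False
          then have y: "norm y > norm x + \<rho> + B" by (simp add: R_def)
          have "B \<ge> 0" using B[of 0] norm_ge_zero order_trans by blast
          then have "norm (x - y) > \<rho>" using y norm_triangle_ineq2[of y x] by (simp add: norm_minus_commute)
          moreover have "norm (x + X n - y) > \<rho>"
            using y B[of n] norm_triangle_ineq2[of y "x + X n"] norm_triangle_ineq[of x "X n"]
            by (simp add: norm_minus_commute)
          ultimately show ?thesis using False by (simp add: F_def support deriv_support)
        qed
      qed
    qed simp
    then have "(\<lambda>n. norm (\<integral>y. F n y \<partial>lborel)) \<longlonglongrightarrow> 0"
      by (simp add: tendsto_rabs_zero)
    then show "((\<lambda>h. norm (conv u \<phi> (x + h) - conv u \<phi> x - D h) / norm h) \<circ> X) \<longlonglongrightarrow> 0"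
      by (simp add: int o_def abs_divide)
  qed
  ultimately show ?thesis
    unfolding D_def[symmetric] has_derivative_at by blast
qed

end

lemma test_fun_bump:
  "test_fun (bump c \<rho> :: 'a::euclidean_space \<Rightarrow> real) (\<lambda>x v. flat_exp 2 (c * (\<rho>^2 - x \<bullet> x)) * (c * (- 2 * (x \<bullet> v)))) \<rho>"
  if "c > 0" "\<rho> > 0"
proof
  have flat: "(flat_exp 0 has_real_derivative flat_exp 2 t) (at t)" for t
    using flat_exp_has_derivative[of 0 t] by (simp add: numeral_2_eq_2)
  fix x :: 'a
  have "((\<lambda>x. c * (\<rho>^2 - x \<bullet> x)) has_derivative (\<lambda>v. c * (- 2 * (x \<bullet> v)))) (at x)"
    by (auto intro!: derivative_eq_intros simp: inner_commute algebra_simps)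
  then have "((\<lambda>x. flat_exp 0 (c * (\<rho>^2 - x \<bullet> x))) has_derivative
      (\<lambda>v. c * (- 2 * (x \<bullet> v)) * flat_exp 2 (c * (\<rho>^2 - x \<bullet> x)))) (at x)"
    by (rule DERIV_compose_FDERIV[OF flat])
  then show "(bump c \<rho> has_derivative (\<lambda>v. flat_exp 2 (c * (\<rho>^2 - x \<bullet> x)) * (c * (- 2 * (x \<bullet> v))))) (at x)"
    by (simp only: bump_def[abs_def] mult.commute[of "flat_exp 2 (c * (\<rho>^2 - x \<bullet> x))"])
next
  fix v :: 'a
  show "continuous_on UNIV (\<lambda>x. flat_exp 2 (c * (\<rho>^2 - x \<bullet> x)) * (c * (- 2 * (x \<bullet> v))))"
    by (intro continuous_intros continuous_on_compose2[OF continuous_on_flat_exp[of UNIV 2]]) auto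
next
  fix x :: 'a assume "\<rho> < norm x"
  then have "\<rho>^2 < x \<bullet> x"
    using that by (simp add: power2_norm_eq_inner[symmetric] power_strict_mono)
  then show "bump c \<rho> x = 0"
    using that by (simp add: bump_def flat_exp_def mult_le_0_iff)
qed

text \<open>A limit along one fixed sequence is defined everywhere and Borel measurable as a
  function of \<open>x\<close>; where the two-sided directional derivative exists, it agrees with
  it.\<close>

definition dir_deriv :: "('a::real_normed_vector \<Rightarrow> real) \<Rightarrow> 'a \<Rightarrow> 'a \<Rightarrow> real" where
  "dir_deriv u v x = lim (\<lambda>n. (u (x + inverse (Suc n) *\<^sub>R v) - u x) / inverse (Suc n))"

lemma dir_deriv_measurable:
  fixes u :: "'a::euclidean_space \<Rightarrow> real"
  assumes "continuous_on UNIV u"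
  shows "dir_deriv u v \<in> borel_measurable borel"
proof -
  have [measurable]: "u \<in> borel_measurable borel"
    using assms by (rule borel_measurable_continuous_onI)
  show ?thesis
    unfolding dir_deriv_def[abs_def] by (rule borel_measurable_lim_metric) measurable
qed

lemma inverse_Suc_at_0: "filterlim (\<lambda>n. inverse (real (Suc n))) (at 0) sequentially"
  using LIMSEQ_inverse_real_of_nat by (auto simp: filterlim_at)

lemma AE_dir_deriv:
  fixes u :: "'a::euclidean_space \<Rightarrow> real"
  assumes lip: "K-lipschitz_on UNIV u"
  shows "AE x in lborel. ((\<lambda>h. (u (x + h *\<^sub>R v) - u x) / h) \<longlongrightarrow> dir_deriv u v x) (at 0)"
  using AE_directional_derivative[OF lip, of v]
proof eventually_elim
  case (elim x)
  then obtain l where l: "((\<lambda>h. (u (x + h *\<^sub>R v) - u x) / h) \<longlongrightarrow> l) (at 0)" by blast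
  have "dir_deriv u v x = l"
    unfolding dir_deriv_def by (rule limI) (rule filterlim_compose[OF l inverse_Suc_at_0])
  with l show ?case by simp
qed

lemma slope_limit_bound:
  fixes u :: "'a::euclidean_space \<Rightarrow> real"
  assumes lip: "K-lipschitz_on UNIV u"
    and lim: "((\<lambda>h. (u (x + h *\<^sub>R v) - u x) / h) \<longlongrightarrow> l) (at 0)"
  shows "\<bar>l\<bar> \<le> K * norm v"
proof (rule tendsto_upperbound[OF tendsto_rabs[OF lim]])
  have "\<bar>(u (x + h *\<^sub>R v) - u x) / h\<bar> \<le> K * norm v" if "h \<noteq> 0" for h
    using lipschitz_onD[OF lip, of "x + h *\<^sub>R v" x] that
    by (simp add: dist_norm abs_divide divide_le_eq mult_ac)
  then show "\<forall>\<^sub>F h in at 0. \<bar>(u (x + h *\<^sub>R v) - u x) / h\<bar> \<le> K * norm v"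
    by (auto simp: eventually_at_filter)
qed simp

lemma has_derivative_imp_slope_limit:
  fixes u :: "'a::euclidean_space \<Rightarrow> real"
  assumes "(u has_derivative D) (at x)"
  shows "((\<lambda>h. (u (x + h *\<^sub>R v) - u x) / h) \<longlongrightarrow> D v) (at 0)"
proof -
  have "((\<lambda>h. u (x + h *\<^sub>R v)) has_derivative (\<lambda>h. D (h *\<^sub>R v))) (at 0)"
    by (rule has_derivative_compose[of "\<lambda>h. x + h *\<^sub>R v" _ 0 UNIV])
      (auto intro!: derivative_eq_intros assms)
  moreover have "(\<lambda>h. D (h *\<^sub>R v)) = (*) (D v)"
    using linear_cmul[OF has_derivative_linear[OF assms]] by (auto simp: mult.commute)
  ultimately have "((\<lambda>h. u (x + h *\<^sub>R v)) has_real_derivative D v) (at 0)"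
    by (simp add: has_field_derivative_def)
  then show ?thesis by (simp add: DERIV_def)
qed

text \<open>The slope bound is tested in the direction \<open>p\<close> itself, where the slope is
  \<open>p \<bullet> p\<close>.\<close>

lemma gradient_norm_le:
  fixes u :: "'a::euclidean_space \<Rightarrow> real"
  assumes "K-lipschitz_on UNIV u" "(u has_derivative (\<lambda>v. p \<bullet> v)) (at x)"
  shows "norm p \<le> K"
proof -
  have "norm p * norm p \<le> K * norm p"
    using slope_limit_bound[OF assms(1) has_derivative_imp_slope_limit[OF assms(2), of p]]
    by (simp add: power2_norm_eq_inner[symmetric] power2_eq_square)
  then show ?thesis
    using lipschitz_on_nonneg[OF assms(1)] by (cases "p = 0") auto
qed

text \<open>Integration by parts: both sides are the limit of the difference quotients of
  \<open>conv u \<phi>\<close> along \<open>v\<close>. On the left the limit is taken as a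
  derivative falling on \<phi>; on the right the quotient stays on \<open>u\<close>, where the
  Lipschitz constant dominates it.\<close>

lemma (in test_fun) conv_dir_deriv:
  fixes u :: "'a \<Rightarrow> real"
  assumes lip: "K-lipschitz_on UNIV u"
  shows "integrable lborel (\<lambda>y. dir_deriv u v (x - y) * \<phi> y)" (is ?A)
    and "(\<integral>y. u y * \<phi>' (x - y) v \<partial>lborel) = (\<integral>y. dir_deriv u v (x - y) * \<phi> y \<partial>lborel)" (is ?B)
proof -
  define t where "t n = inverse (real (Suc n))" for n
  have t: "t n > 0" for n by (simp add: t_def)
  have t0: "filterlim t (at 0) sequentially"
    unfolding t_def by (rule inverse_Suc_at_0)
  have u: "continuous_on UNIV u" using lip by (rule lipschitz_on_continuous_on)
  have [measurable]: "u \<in> borel_measurable borel" "\<phi> \<in> borel_measurable borel" "dir_deriv u v \<in> borel_measurable borel"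
    using u cont dir_deriv_measurable by (auto intro: borel_measurable_continuous_onI)
  define F where "F n y = (u (x - y + t n *\<^sub>R v) - u (x - y)) / t n * \<phi> y" for n y
  have int: "(\<integral>y. F n y \<partial>lborel) = (conv u \<phi> (x + t n *\<^sub>R v) - conv u \<phi> x) / t n" for n
  proof -
    have "F n = (\<lambda>y. (u (x + t n *\<^sub>R v - y) * \<phi> y - u (x - y) * \<phi> y) / t n)"
      by (auto simp: F_def fun_eq_iff algebra_simps diff_divide_distrib)
    then show ?thesis by (simp add: conv_def integrable_conv'[OF u])
  qed
  have K: "K \<ge> 0" using lip by (rule lipschitz_on_nonneg)
  have F_lim: "AE y in lborel. (\<lambda>n. F n y) \<longlonglongrightarrow> dir_deriv u v (x - y) * \<phi> y"
    using AE_lborel_reflect[OF AE_dir_deriv[OF lip, of v], of x]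
  proof eventually_elim
    case (elim y)
    from filterlim_compose[OF elim t0] show ?case
      unfolding F_def by (intro tendsto_mult tendsto_const)
  qed
  have dom: "integrable lborel (\<lambda>y. K * norm v * \<bar>\<phi> y\<bar>)"
    by (rule integrable_compact_support[of _ \<rho>]) (auto intro!: continuous_intros cont simp: support)
  have bd: "AE y in lborel. norm (F n y) \<le> K * norm v * \<bar>\<phi> y\<bar>" for n
  proof (rule AE_I2)
    fix y
    have "\<bar>(u (x - y + t n *\<^sub>R v) - u (x - y)) / t n\<bar> \<le> K * norm v"
      using lipschitz_onD[OF lip, of "x - y + t n *\<^sub>R v" "x - y"] t[of n]
      by (simp add: dist_norm abs_divide divide_le_eq mult_ac)
    then show "norm (F n y) \<le> K * norm v * \<bar>\<phi> y\<bar>"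
      unfolding F_def real_norm_def abs_mult by (rule mult_right_mono) simp
  qed
  have Fm: "F n \<in> borel_measurable lborel" for n
    unfolding F_def by measurable
  have gm: "(\<lambda>y. dir_deriv u v (x - y) * \<phi> y) \<in> borel_measurable lborel" by measurable
  show ?A
    by (rule integrable_dominated_convergence[OF gm Fm dom F_lim bd])
  have 1: "(\<lambda>n. \<integral>y. F n y \<partial>lborel) \<longlonglongrightarrow> (\<integral>y. dir_deriv u v (x - y) * \<phi> y \<partial>lborel)"
    by (rule integral_dominated_convergence[OF gm Fm dom F_lim bd])
  define D where "D = (\<lambda>v. \<integral>y. u y * \<phi>' (x - y) v \<partial>lborel)"
  have hd: "(conv u \<phi> has_derivative D) (at x)"
    unfolding D_def by (rule conv_has_derivative[OF u])
  have "((\<lambda>h. (conv u \<phi> (x + h *\<^sub>R v) - conv u \<phi> x) / h) \<longlongrightarrow> D v) (at 0)"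
    by (rule has_derivative_imp_slope_limit[OF hd])
  from filterlim_compose[OF this t0] have "(\<lambda>n. \<integral>y. F n y \<partial>lborel) \<longlonglongrightarrow> D v"
    by (simp add: int)
  from LIMSEQ_unique[OF this 1] show ?B by (simp add: D_def)
qed

text \<open>The positive and the negative part of \<open>g\<close> are densities of two measures
  that agree on balls. Vitali's theorem extends this to open sets, which form an intersection-stable
  generator as balls do not, and uniqueness of densities then identifies the two parts.\<close>

lemma AE_zero_if_ball_integrals_zero:
  fixes g :: "'a::euclidean_space \<Rightarrow> real"
  assumes g[measurable]: "g \<in> borel_measurable borel"
    and int: "\<And>x \<rho>. 0 < \<rho> \<Longrightarrow> integrable lborel (\<lambda>y. indicator (ball x \<rho>) y * g y)"
    and zero: "\<And>x \<rho>. 0 < \<rho> \<Longrightarrow> (\<integral>y. indicator (ball x \<rho>) y * g y \<partial>lborel) = 0"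
  shows "AE x in lborel. g x = 0"
proof -
  \<comment> \<open>\<open>ennreal\<close> sends negative numbers to zero, so the two densities are
    the positive and the negative part of \<open>g\<close>.\<close>
  define M1 where "M1 = density lborel (\<lambda>x. ennreal (g x))"
  define M2 where "M2 = density lborel (\<lambda>x. ennreal (- g x))"
  have sets[simp, measurable_cong]: "sets M1 = sets borel" "sets M2 = sets borel"
    by (simp_all add: M1_def M2_def)
  have ball: "emeasure M1 (ball x \<rho>) = emeasure M2 (ball x \<rho>)" "emeasure M1 (ball x \<rho>) < top" if "\<rho> > 0" for x \<rho>
  proof -
    let ?f = "\<lambda>y. indicator (ball x \<rho>) y * g y"
    have fin: "(\<integral>\<^sup>+y. ennreal (?f y) \<partial>lborel) < top" "(\<integral>\<^sup>+y. ennreal (- ?f y) \<partial>lborel) < top"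
      using int[OF that, of x] by (auto simp: real_integrable_def top.not_eq_extremum)
    have "(\<integral>\<^sup>+y. ennreal (?f y) \<partial>lborel) = (\<integral>\<^sup>+y. ennreal (- ?f y) \<partial>lborel)"
    proof -
      have "enn2real (\<integral>\<^sup>+y. ennreal (?f y) \<partial>lborel) = enn2real (\<integral>\<^sup>+y. ennreal (- ?f y) \<partial>lborel)"
        using zero[OF that, of x] real_lebesgue_integral_def[OF int[OF that, of x]] by simp
      then show ?thesis using fin by (metis ennreal_enn2real)
    qed
    moreover have "emeasure M1 (ball x \<rho>) = (\<integral>\<^sup>+y. ennreal (?f y) \<partial>lborel)"
      unfolding M1_def by (subst emeasure_density) (auto intro!: nn_integral_cong simp: indicator_def)
    moreover have "emeasure M2 (ball x \<rho>) = (\<integral>\<^sup>+y. ennreal (- ?f y) \<partial>lborel)"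
      unfolding M2_def by (subst emeasure_density) (auto intro!: nn_integral_cong simp: indicator_def)
    ultimately show "emeasure M1 (ball x \<rho>) = emeasure M2 (ball x \<rho>)" "emeasure M1 (ball x \<rho>) < top"
      using fin by auto
  qed
  have op: "emeasure M1 T = emeasure M2 T" if "open T" for T
  proof -
    \<comment> \<open>These balls form a fine cover of \<open>T\<close>; a disjoint countable
      subfamily fills \<open>T\<close> up to a Lebesgue null set, which both measures
      ignore.\<close>
    define K where "K = {p :: 'a \<times> real. 0 < snd p \<and> ball (fst p) (snd p) \<subseteq> T}"
    obtain C where C: "countable C" "C \<subseteq> K"
      "pairwise (\<lambda>i j. disjnt (ball (fst i) (snd i)) (ball (fst j) (snd j))) C"
      "negligible (T - (\<Union>i\<in>C. ball (fst i) (snd i)))"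
    proof (rule Vitali_covering_theorem_balls[of T K fst snd])
      fix x and d :: real assume "x \<in> T" "0 < d"
      then obtain e where e: "e > 0" "ball x e \<subseteq> T" using \<open>open T\<close> openE by blast
      then show "\<exists>i. i \<in> K \<and> x \<in> ball (fst i) (snd i) \<and> snd i < d"
        using \<open>0 < d\<close> by (intro exI[of _ "(x, min e (d/2))"]) (auto simp: K_def)
    qed
    define V where "V = (\<Union>i\<in>C. ball (fst i) (snd i))"
    have V[measurable]: "V \<in> sets borel"
      unfolding V_def by (intro borel_open open_UN) auto
    have VT: "V \<subseteq> T" using C(2) by (auto simp: V_def K_def)
    have T[measurable]: "T \<in> sets borel" using that by (rule borel_open)
    have "emeasure lebesgue (T - V) = 0"
      using C(4) by (simp add: negligible_iff_null_sets null_sets_def V_def)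
    then have null: "T - V \<in> null_sets lborel"
      by (auto simp: null_sets_def)
    have eqTV: "emeasure M T = emeasure M V" if "sets M = sets borel" "T - V \<in> null_sets M" for M
    proof -
      have "emeasure M (V \<union> (T - V)) = emeasure M V"
        using that V by (intro emeasure_Un_null_set) auto
      also have "V \<union> (T - V) = T" using VT by blast
      finally show ?thesis .
    qed
    have ae: "AE x in lborel. x \<notin> T - V" using null by (rule AE_not_in)
    have "T - V \<in> null_sets M1" "T - V \<in> null_sets M2"
      unfolding M1_def M2_def using ae by (auto simp: null_sets_density_iff elim!: eventually_mono)
    then have "emeasure M1 T = emeasure M1 V" "emeasure M2 T = emeasure M2 V"
      using eqTV by auto
    moreover have "emeasure M1 V = emeasure M2 V"
    proof -
      have dj: "disjoint_family_on (\<lambda>i. ball (fst i) (snd i)) C"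
        using C(3) by (auto simp: disjoint_family_on_def pairwise_def disjnt_def)
      have "emeasure M1 V = (\<integral>\<^sup>+i. emeasure M1 (ball (fst i) (snd i)) \<partial>count_space C)"
        unfolding V_def by (rule emeasure_UN_countable[OF _ C(1) dj]) auto
      also have "\<dots> = (\<integral>\<^sup>+i. emeasure M2 (ball (fst i) (snd i)) \<partial>count_space C)"
        using C(2) by (intro nn_integral_cong ball) (auto simp: K_def)
      also have "\<dots> = emeasure M2 V"
        unfolding V_def by (rule emeasure_UN_countable[OF _ C(1) dj, symmetric]) auto
      finally show ?thesis .
    qed
    ultimately show ?thesis by simp
  qed
  have "M1 = M2"
  proof (rule measure_eqI_generator_eq[where A = "\<lambda>i::nat. ball 0 (Suc i)" and \<Omega> = UNIV and E = "{S. open S}"])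
    show "Int_stable {S::'a set. open S}" by (auto simp: Int_stable_def)
    show "sets M1 = sigma_sets UNIV {S. open S}" "sets M2 = sigma_sets UNIV {S. open S}"
      by (simp_all add: borel_def)
    show "(\<Union>i::nat. ball (0::'a) (Suc i)) = UNIV"
    proof -
      have "\<exists>i::nat. norm x < 1 + real i" for x :: 'a
        using reals_Archimedean2[of "norm x"] by (meson add_strict_increasing less_imp_le zero_less_one)
      then show ?thesis by (auto simp: UNIV_def[symmetric] intro!: set_eqI)
    qed
    show "emeasure M1 (ball 0 (Suc i)) \<noteq> \<infinity>" for i :: nat
      using ball(2)[of "Suc i" 0] by simp
  qed (use op in auto)
  then have "AE x in lborel. ennreal (g x) = ennreal (- g x)"
    unfolding M1_def M2_def
    by (intro sigma_finite_measure.density_unique[OF lborel.sigma_finite_measure_axioms]) auto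
  then show ?thesis
  proof eventually_elim
    case (elim x)
    then show ?case by (cases "0 \<le> g x") (auto simp: ennreal_neg)
  qed
qed

lemma bump_nonneg: "0 \<le> bump c \<rho> x"
  by (simp add: bump_def flat_exp_nonneg)

lemma bump_le_1: "bump c \<rho> x \<le> 1"
proof -
  have "flat_exp 0 t \<le> 1" for t by (simp add: flat_exp_def)
  then show ?thesis by (simp add: bump_def)
qed

lemma bump_pos_iff: "0 < c \<Longrightarrow> 0 < \<rho> \<Longrightarrow> 0 < bump c \<rho> x \<longleftrightarrow> norm x < \<rho>"
  by (simp add: bump_def flat_exp_0_pos zero_less_mult_iff power2_norm_eq_inner[symmetric])
    (metis norm_ge_zero order_less_imp_le power2_less_imp_less power_strict_mono zero_less_numeral)

lemma bump_eq_0: "0 < c \<Longrightarrow> 0 < \<rho> \<Longrightarrow> \<rho> \<le> norm x \<Longrightarrow> bump c \<rho> x = 0"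
  using bump_pos_iff[of c \<rho> x] bump_nonneg[of c \<rho> x] by linarith

lemma bump_tendsto:
  assumes "0 < \<rho>"
  shows "(\<lambda>n. bump (real (Suc n)) \<rho> x) \<longlonglongrightarrow> indicator (ball 0 \<rho>) x"
proof (cases "norm x < \<rho>")
  case True
  define s where "s = \<rho>^2 - x \<bullet> x"
  have s: "s > 0" using True assms
    by (simp add: s_def power2_norm_eq_inner[symmetric] power_strict_mono)
  have "(\<lambda>n. exp (- (inverse (real (Suc n)) * inverse s))) \<longlonglongrightarrow> exp (- (0 * inverse s))"
    by (intro tendsto_intros LIMSEQ_inverse_real_of_nat)
  also have "(\<lambda>n. exp (- (inverse (real (Suc n)) * inverse s))) = (\<lambda>n. bump (real (Suc n)) \<rho> x)"
    using s by (auto simp: bump_def flat_exp_def s_def[symmetric] mult_le_0_iff fun_eq_iff)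
  finally show ?thesis using True by simp
next
  case False
  then show ?thesis using assms by (simp add: bump_eq_0)
qed

text \<open>Testing against a bump moves the derivative onto the bump, where it is linear in the direction.\<close>

lemma AE_dir_deriv_linear:
  fixes u :: "'a::euclidean_space \<Rightarrow> real"
  assumes lip: "K-lipschitz_on UNIV u"
  shows "AE x in lborel. dir_deriv u v x = (\<Sum>b\<in>Basis. (v \<bullet> b) * dir_deriv u b x)"
proof -
  define g where "g x = dir_deriv u v x - (\<Sum>b\<in>Basis. (v \<bullet> b) * dir_deriv u b x)" for x
  have u: "continuous_on UNIV u" using lip by (rule lipschitz_on_continuous_on)
  have [measurable]: "dir_deriv u v \<in> borel_measurable borel" for v
    using u by (rule dir_deriv_measurable)
  have g[measurable]: "g \<in> borel_measurable borel" unfolding g_def by measurable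
  define C where "C = K * norm v + (\<Sum>b\<in>(Basis::'a set). \<bar>v \<bullet> b\<bar> * (K * norm b))"
  have gC: "AE x in lborel. \<bar>g x\<bar> \<le> C"
  proof -
    have "AE x in lborel. \<forall>b\<in>Basis. \<bar>dir_deriv u b x\<bar> \<le> K * norm b"
      by (intro AE_finite_allI finite_Basis eventually_mono[OF AE_dir_deriv[OF lip] slope_limit_bound[OF lip]])
    moreover have "AE x in lborel. \<bar>dir_deriv u v x\<bar> \<le> K * norm v"
      by (rule eventually_mono[OF AE_dir_deriv[OF lip] slope_limit_bound[OF lip]])
    ultimately show ?thesis
    proof eventually_elim
      case (elim x)
      have "\<bar>\<Sum>b\<in>Basis. (v \<bullet> b) * dir_deriv u b x\<bar> \<le> (\<Sum>b\<in>Basis. \<bar>(v \<bullet> b) * dir_deriv u b x\<bar>)" by simp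
      also have "\<dots> \<le> (\<Sum>b\<in>Basis. \<bar>v \<bullet> b\<bar> * (K * norm b))"
        using elim(1) by (intro sum_mono) (auto simp: abs_mult intro!: mult_left_mono)
      finally show ?case using elim(2) unfolding g_def C_def by linarith
    qed
  qed
  have int_bump: "(\<integral>y. g (x - y) * bump c \<rho> y \<partial>lborel) = 0" if "c > 0" "\<rho> > 0" for c \<rho> x
  proof -
    interpret test_fun "bump c \<rho>" "\<lambda>x v. flat_exp 2 (c * (\<rho>^2 - x \<bullet> x)) * (c * (- 2 * (x \<bullet> v)))" \<rho>
      using that by (rule test_fun_bump)
    \<comment> \<open>By \<open>conv_dir_deriv\<close>, \<open>D w\<close> is the weighted average
      of \<open>dir_deriv u w\<close>. It is linear in \<open>w\<close> because it is the derivative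
      of the mollified function at \<open>x\<close>.\<close>
    define D where "D = (\<lambda>v. \<integral>y. u y * (flat_exp 2 (c * (\<rho>^2 - (x - y) \<bullet> (x - y))) * (c * (- 2 * ((x - y) \<bullet> v)))) \<partial>lborel)"
    have lD: "linear D"
      using has_derivative_linear[OF conv_has_derivative[OF u, of x]] by (simp add: D_def)
    have D: "(\<integral>y. dir_deriv u w (x - y) * bump c \<rho> y \<partial>lborel) = D w" for w
      using conv_dir_deriv(2)[OF lip, of x w] by (simp add: D_def)
    have "(\<integral>y. g (x - y) * bump c \<rho> y \<partial>lborel) =
      (\<integral>y. dir_deriv u v (x - y) * bump c \<rho> y - (\<Sum>b\<in>Basis. (v \<bullet> b) * (dir_deriv u b (x - y) * bump c \<rho> y)) \<partial>lborel)"
      by (simp add: g_def left_diff_distrib sum_distrib_right mult.assoc)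
    also have "\<dots> = D v - (\<Sum>b\<in>Basis. (v \<bullet> b) * D b)"
      using conv_dir_deriv(1)[OF lip, of _ x] by (simp add: D)
    also have "(\<Sum>b\<in>Basis. (v \<bullet> b) * D b) = D (\<Sum>b\<in>Basis. (v \<bullet> b) *\<^sub>R b)"
      by (simp add: linear_sum[OF lD] linear_cmul[OF lD])
    finally show ?thesis by (simp add: euclidean_representation)
  qed
  have intg: "integrable lborel (\<lambda>y. indicator (ball x \<rho>) y * g y)" for x \<rho>
  proof (rule Bochner_Integration.integrable_bound)
    show "integrable lborel (\<lambda>y. C * indicator (ball x \<rho>) y)"
      by (intro integrable_mult_right integrable_real_indicator emeasure_bounded_finite bounded_ball) auto
    show "AE y in lborel. norm (indicator (ball x \<rho>) y * g y) \<le> norm (C * indicator (ball x \<rho>) y)"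
      using gC by eventually_elim (auto simp: indicator_def)
    have [measurable]: "ball x \<rho> \<in> sets borel" by simp
    show "(\<lambda>y. indicator (ball x \<rho>) y * g y) \<in> borel_measurable lborel" by measurable
  qed
  have "AE x in lborel. g x = 0"
  proof (rule AE_zero_if_ball_integrals_zero[OF g intg])
    fix x :: 'a and \<rho> :: real assume \<rho>: "0 < \<rho>"
    \<comment> \<open>Letting the bumps sharpen to the indicator of the ball turns vanishing
      weighted averages into vanishing integrals over balls.\<close>
    have "(\<lambda>n. \<integral>y. g (x - y) * bump (real (Suc n)) \<rho> y \<partial>lborel) \<longlonglongrightarrow> (\<integral>y. g (x - y) * indicator (ball 0 \<rho>) y \<partial>lborel)"
    proof (rule integral_dominated_convergence[where w = "\<lambda>y. C * indicator (ball 0 \<rho>) y"])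
      show "integrable lborel (\<lambda>y. C * indicator (ball 0 \<rho>) y)"
        by (intro integrable_mult_right integrable_real_indicator emeasure_bounded_finite bounded_ball) auto
      show "(\<lambda>y. g (x - y) * bump (real (Suc n)) \<rho> y) \<in> borel_measurable lborel" for n
      proof -
        have "continuous_on UNIV (bump (real (Suc n)) \<rho> :: 'a \<Rightarrow> real)"
          by (rule test_fun.cont[OF test_fun_bump]) (use \<rho> in auto)
        then have [measurable]: "(bump (real (Suc n)) \<rho> :: 'a \<Rightarrow> real) \<in> borel_measurable borel"
          by (rule borel_measurable_continuous_onI)
        show ?thesis by measurable
      qed
      show "AE y in lborel. (\<lambda>n. g (x - y) * bump (real (Suc n)) \<rho> y) \<longlonglongrightarrow> g (x - y) * indicator (ball 0 \<rho>) y"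
        by (intro AE_I2 tendsto_mult tendsto_const bump_tendsto \<rho>)
      show "AE y in lborel. norm (g (x - y) * bump (real (Suc n)) \<rho> y) \<le> C * indicator (ball 0 \<rho>) y" for n
        using AE_lborel_reflect[OF gC, of x]
      proof eventually_elim
        case (elim y)
        show ?case
        proof (cases "norm y < \<rho>")
          case True
          have "\<bar>g (x - y)\<bar> * \<bar>bump (real (Suc n)) \<rho> y\<bar> \<le> C * 1"
            using elim bump_nonneg[of "real (Suc n)" \<rho> y] bump_le_1[of "real (Suc n)" \<rho> y]
            by (intro mult_mono) auto
          then show ?thesis using True by (simp add: abs_mult)
        qed (use \<rho> in \<open>simp add: bump_eq_0\<close>)
      qed
      have [measurable]: "ball 0 \<rho> \<in> sets (borel :: 'a measure)" by simp
      show "(\<lambda>y. g (x - y) * indicator (ball 0 \<rho>) y) \<in> borel_measurable lborel" by measurable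
    qed
    then have "(\<integral>y. g (x - y) * indicator (ball 0 \<rho>) y \<partial>lborel) = 0"
      using int_bump[OF _ \<rho>] by (simp add: LIMSEQ_const_iff)
    moreover have "(\<integral>y. g (x - y) * indicator (ball 0 \<rho>) y \<partial>lborel) = (\<integral>y. indicator (ball x \<rho>) (x - y) * g (x - y) \<partial>lborel)"
      by (intro Bochner_Integration.integral_cong) (auto simp: indicator_def dist_norm)
    moreover have [measurable]: "ball x \<rho> \<in> sets borel" by simp
    have "(\<integral>y. indicator (ball x \<rho>) (x - y) * g (x - y) \<partial>lborel) = (\<integral>y. indicator (ball x \<rho>) y * g y \<partial>lborel)"
      by (rule integral_lborel_reflect) measurable
    ultimately show "(\<integral>y. indicator (ball x \<rho>) y * g y \<partial>lborel) = 0" by simp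
  qed
  then show ?thesis by eventually_elim (simp add: g_def)
qed

text \<open>By compactness of the unit sphere, finitely many directions of \<open>D\<close> come
  within \<open>e'\<close> of every unit vector, so one \<delta> serves them all. The Lipschitz
  bound transfers the estimate from such a direction to its neighbours.\<close>

lemma has_derivative_if_dense_dir_derivs:
  fixes u :: "'a::euclidean_space \<Rightarrow> real"
  assumes lip: "K-lipschitz_on UNIV u"
    and dense: "\<And>X. open X \<Longrightarrow> X \<noteq> {} \<Longrightarrow> \<exists>d\<in>D. d \<in> X"
    and lim: "\<And>v. v \<in> D \<Longrightarrow> ((\<lambda>h. (u (x + h *\<^sub>R v) - u x) / h) \<longlongrightarrow> p \<bullet> v) (at 0)"
  shows "(u has_derivative (\<lambda>v. p \<bullet> v)) (at x)"
  unfolding has_derivative_at_alt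
proof (intro conjI allI impI)
  show "bounded_linear (\<lambda>v. p \<bullet> v)" by (rule bounded_linear_inner_right)
  fix e :: real assume e: "e > 0"
  have K: "K \<ge> 0" using lip by (rule lipschitz_on_nonneg)
  \<comment> \<open>The constant adds three errors: \<open>K\<close> for replacing the direction
    inside \<open>u\<close>, \<open>1\<close> for the difference quotient, and \<open>norm p\<close>
    for replacing the direction in the linear term.\<close>
  define C where "C = K + 1 + norm p"
  have C: "C > 0" using K by (simp add: C_def add_nonneg_pos add_pos_nonneg)
  define e' where "e' = e / C"
  have e': "e' > 0" using e C by (simp add: e'_def)
  have "sphere (0::'a) 1 \<subseteq> (\<Union>v\<in>D. ball v e')"
  proof
    fix w :: 'a
    obtain d where "d \<in> D" "d \<in> ball w e'" using dense[of "ball w e'"] e' by auto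
    then show "w \<in> (\<Union>v\<in>D. ball v e')" by (auto simp: dist_commute)
  qed
  then obtain V where V: "V \<subseteq> D" "finite V" "sphere (0::'a) 1 \<subseteq> (\<Union>v\<in>V. ball v e')"
    by (rule compactE_image[OF compact_sphere, rotated]) auto
  have "\<exists>d>0. \<forall>h. h \<noteq> 0 \<and> \<bar>h\<bar> < d \<longrightarrow> \<bar>(u (x + h *\<^sub>R v) - u x) / h - p \<bullet> v\<bar> < e'" if "v \<in> V" for v
    using LIM_D[OF lim e'] that V(1) by auto
  then obtain d where d: "\<And>v. v \<in> V \<Longrightarrow> d v > 0"
    "\<And>v h. v \<in> V \<Longrightarrow> h \<noteq> 0 \<Longrightarrow> \<bar>h\<bar> < d v \<Longrightarrow> \<bar>(u (x + h *\<^sub>R v) - u x) / h - p \<bullet> v\<bar> < e'"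
    by metis
  define \<delta> where "\<delta> = Min (insert 1 (d ` V))"
  have "\<delta> > 0" using d(1) V(2) by (auto simp: \<delta>_def)
  moreover have \<delta>: "\<delta> \<le> d v" if "v \<in> V" for v using that V(2) by (auto simp: \<delta>_def)
  have "norm (u y - u x - p \<bullet> (y - x)) \<le> e * norm (y - x)" if y: "norm (y - x) < \<delta>" for y
  proof (cases "y = x")
    case False
    define t where "t = norm (y - x)"
    have t: "t > 0" using False by (simp add: t_def)
    define w where "w = (y - x) /\<^sub>R t"
    have w: "norm w = 1" "y = x + t *\<^sub>R w" using t by (auto simp: w_def t_def)
    then obtain v where v: "v \<in> V" "norm (v - w) < e'" using V(3) by (force simp: dist_norm)
    have 1: "\<bar>u (x + t *\<^sub>R w) - u (x + t *\<^sub>R v)\<bar> \<le> K * (t * e')"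
    proof -
      have "\<bar>u (x + t *\<^sub>R w) - u (x + t *\<^sub>R v)\<bar> \<le> K * (t * norm (w - v))"
        using lipschitz_onD[OF lip, of "x + t *\<^sub>R w" "x + t *\<^sub>R v"] t
        by (simp add: dist_norm scaleR_diff_right[symmetric])
      also have "\<dots> \<le> K * (t * e')"
        using v(2) t K by (intro mult_left_mono) (auto simp: norm_minus_commute)
      finally show ?thesis .
    qed
    have "\<bar>(u (x + t *\<^sub>R v) - u x) / t - p \<bullet> v\<bar> < e'"
      using y \<delta>[OF v(1)] t by (intro d(2)[OF v(1)]) (auto simp: t_def)
    then have "\<bar>(u (x + t *\<^sub>R v) - u x) / t - p \<bullet> v\<bar> * t \<le> e' * t"
      using t by (intro mult_right_mono) auto
    moreover have "\<bar>(u (x + t *\<^sub>R v) - u x) / t - p \<bullet> v\<bar> * t = \<bar>u (x + t *\<^sub>R v) - u x - t * (p \<bullet> v)\<bar>"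
    proof -
      have "((u (x + t *\<^sub>R v) - u x) / t - p \<bullet> v) * t = u (x + t *\<^sub>R v) - u x - t * (p \<bullet> v)"
        using t by (simp add: field_simps)
      then show ?thesis using t by (metis abs_mult abs_of_pos)
    qed
    ultimately have 2: "\<bar>u (x + t *\<^sub>R v) - u x - t * (p \<bullet> v)\<bar> \<le> e' * t" by simp
    have "\<bar>p \<bullet> (v - w)\<bar> \<le> norm p * e'"
      using Cauchy_Schwarz_ineq2[of p "v - w"] v(2)
      by (meson less_imp_le mult_left_mono norm_ge_zero order_trans)
    then have "t * \<bar>p \<bullet> (v - w)\<bar> \<le> t * (norm p * e')"
      using t by (intro mult_left_mono) auto
    then have 3: "\<bar>t * (p \<bullet> v) - t * (p \<bullet> w)\<bar> \<le> t * (norm p * e')"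
      using t by (simp add: inner_diff_right right_diff_distrib[symmetric] abs_mult)
    have "norm (u y - u x - p \<bullet> (y - x)) = \<bar>u (x + t *\<^sub>R w) - u x - t * (p \<bullet> w)\<bar>"
      using w by simp
    also have "\<dots> \<le> K * (t * e') + e' * t + t * (norm p * e')"
      using 1 2 3 by linarith
    also have "\<dots> = e' * C * t" by (simp add: C_def algebra_simps)
    also have "\<dots> = e * norm (y - x)" using C by (simp add: e'_def t_def)
    finally show ?thesis .
  qed simp
  ultimately show "\<exists>d>0. \<forall>y. norm (y - x) < d \<longrightarrow> norm (u y - u x - p \<bullet> (y - x)) \<le> e * norm (y - x)"
    by blast
qed

text \<open>A countable dense set of directions keeps the union of exceptional sets null; the
  gradient is assembled from the basis directions. The second conjunct ties it to
  \<open>dir_deriv\<close>, in terms of which the derivative of a convolution is expressed.\<close>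

theorem Rademacher:
  fixes u :: "'a::euclidean_space \<Rightarrow> real"
  assumes lip: "K-lipschitz_on UNIV u"
  shows "AE x in lborel. \<exists>p. (u has_derivative (\<lambda>v. p \<bullet> v)) (at x) \<and> (\<forall>v. dir_deriv u v x = p \<bullet> v)"
proof -
  obtain D :: "'a set" where D: "countable D" "\<And>X. open X \<Longrightarrow> X \<noteq> {} \<Longrightarrow> \<exists>d\<in>D. d \<in> X"
    using countable_dense_setE by blast
  have "AE x in lborel. \<forall>v\<in>D. ((\<lambda>h. (u (x + h *\<^sub>R v) - u x) / h) \<longlongrightarrow> dir_deriv u v x) (at 0)
      \<and> dir_deriv u v x = (\<Sum>b\<in>Basis. (v \<bullet> b) * dir_deriv u b x)"
    by (intro AE_ball_countable[OF D(1), THEN iffD2] ballI eventually_conj AE_dir_deriv[OF lip] AE_dir_deriv_linear[OF lip])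
  then show ?thesis
  proof eventually_elim
    case (elim x)
    define p where "p = (\<Sum>b\<in>Basis. dir_deriv u b x *\<^sub>R b)"
    have pv: "(\<Sum>b\<in>Basis. (v \<bullet> b) * dir_deriv u b x) = p \<bullet> v" for v
      by (simp add: p_def inner_sum_left mult.commute inner_commute[of v])
    have hd: "(u has_derivative (\<lambda>v. p \<bullet> v)) (at x)"
      by (rule has_derivative_if_dense_dir_derivs[OF lip D(2)]) (use elim pv in auto)
    have "dir_deriv u v x = p \<bullet> v" for v
      unfolding dir_deriv_def
      by (intro limI filterlim_compose[OF has_derivative_imp_slope_limit[OF hd] inverse_Suc_at_0])
    with hd show ?case by blast
  qed
qed

section \<open>Smooth approximation on the torus\<close>

lemma Ck_fun_SucI:
  assumes "\<And>x. (u has_derivative u' x) (at x)" and "\<And>v. Ck_fun k (\<lambda>x. u' x v)"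
  shows "Ck_fun (Suc k) u"
proof -
  have "frechet_derivative u (at x) = u' x" for x
    using frechet_derivative_at[OF assms(1)] by simp
  then show ?thesis using assms by (auto simp: differentiable_def)
qed

lemma Ck_fun_Suc_has_derivative:
  "Ck_fun (Suc k) u \<Longrightarrow> (u has_derivative frechet_derivative u (at x)) (at x)"
  using frechet_derivative_works by auto

lemma Ck_fun_Suc_imp_Ck_fun: "Ck_fun (Suc k) u \<Longrightarrow> Ck_fun k u"
proof (induction k arbitrary: u)
  case 0
  then show ?case
    by (auto simp: continuous_on_eq_continuous_at differentiable_imp_continuous_within)
next
  case (Suc k)
  have "Ck_fun k (\<lambda>x. frechet_derivative u (at x) v)" for v
    using Suc.IH Suc.prems Ck_fun.simps(2) by blast
  moreover have "\<forall>x. u differentiable (at x)"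
    using Suc.prems Ck_fun.simps(2) by blast
  ultimately show ?case by simp
qed

lemma Ck_fun_const: "Ck_fun k (\<lambda>x. c)"
  by (induction k arbitrary: c) (auto intro!: Ck_fun_SucI[where u' = "\<lambda>x v. 0"] simp del: Ck_fun.simps(2))

lemma Ck_fun_add: "Ck_fun k f \<Longrightarrow> Ck_fun k g \<Longrightarrow> Ck_fun k (\<lambda>x. f x + g x)"
proof (induction k arbitrary: f g)
  case 0
  then show ?case by (auto intro: continuous_intros)
next
  case (Suc k)
  show ?case
  proof (rule Ck_fun_SucI)
    show "((\<lambda>x. f x + g x) has_derivative (\<lambda>v. frechet_derivative f (at x) v + frechet_derivative g (at x) v)) (at x)" for x
      by (intro has_derivative_add Ck_fun_Suc_has_derivative[OF Suc.prems(1)] Ck_fun_Suc_has_derivative[OF Suc.prems(2)])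
    show "Ck_fun k (\<lambda>x. frechet_derivative f (at x) v + frechet_derivative g (at x) v)" for v
      using Suc.prems by (intro Suc.IH) auto
  qed
qed

lemma Ck_fun_mult: "Ck_fun k f \<Longrightarrow> Ck_fun k g \<Longrightarrow> Ck_fun k (\<lambda>x. f x * g x)"
proof (induction k arbitrary: f g)
  case 0
  then show ?case by (auto intro: continuous_intros)
next
  case (Suc k)
  show ?case
  proof (rule Ck_fun_SucI)
    show "((\<lambda>x. f x * g x) has_derivative (\<lambda>v. f x * frechet_derivative g (at x) v + frechet_derivative f (at x) v * g x)) (at x)" for x
      by (intro has_derivative_mult Ck_fun_Suc_has_derivative[OF Suc.prems(1)] Ck_fun_Suc_has_derivative[OF Suc.prems(2)])
    show "Ck_fun k (\<lambda>x. f x * frechet_derivative g (at x) v + frechet_derivative f (at x) v * g x)" for v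
      using Suc.prems by (intro Ck_fun_add Suc.IH Ck_fun_Suc_imp_Ck_fun[OF Suc.prems(1)] Ck_fun_Suc_imp_Ck_fun[OF Suc.prems(2)]) auto
  qed
qed

lemma Ck_fun_inner_const: "Ck_fun k (\<lambda>x. x \<bullet> v)"
proof (cases k)
  case (Suc j)
  show ?thesis unfolding Suc
    by (rule Ck_fun_SucI[where u' = "\<lambda>x w. w \<bullet> v"]) (auto intro!: derivative_eq_intros Ck_fun_const)
qed (auto intro: continuous_intros)

lemma Ck_fun_inner_self: "Ck_fun k (\<lambda>x :: real^'n. x \<bullet> x)"
proof (cases k)
  case (Suc j)
  show ?thesis unfolding Suc
  proof (rule Ck_fun_SucI)
    show "((\<lambda>x. x \<bullet> x) has_derivative (\<lambda>v. 2 * (x \<bullet> v))) (at x)" for x :: "real^'n"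
      by (auto intro!: derivative_eq_intros simp: inner_commute)
    show "Ck_fun j (\<lambda>x. 2 * (x \<bullet> v))" for v
      by (intro Ck_fun_mult Ck_fun_const Ck_fun_inner_const)
  qed
qed (auto intro: continuous_intros)

text \<open>The derivative of \<open>flat_exp m\<close> is a combination of two later members of the
  family, so the induction on \<open>k\<close> runs over all \<open>m\<close> at once.\<close>

lemma Ck_fun_flat_exp:
  assumes "\<And>k. Ck_fun k g"
  shows "Ck_fun k (\<lambda>x. flat_exp m (g x))"
proof (induction k arbitrary: m)
  case 0
  then show ?case
    using assms[of 0] by (auto intro: continuous_on_compose2[OF continuous_on_flat_exp[of UNIV]])
next
  case (Suc k)
  show ?case
  proof (rule Ck_fun_SucI)
    fix x
    show "((\<lambda>x. flat_exp m (g x)) has_derivative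
        (\<lambda>v. frechet_derivative g (at x) v * (flat_exp (m + 2) (g x) + (- real m) * flat_exp (m + 1) (g x)))) (at x)"
      using DERIV_compose_FDERIV[OF flat_exp_has_derivative Ck_fun_Suc_has_derivative[OF assms]] by simp
  next
    fix v
    have "Ck_fun k (\<lambda>x. frechet_derivative g (at x) v)" using assms[of "Suc k"] by simp
    then show "Ck_fun k (\<lambda>x. frechet_derivative g (at x) v * (flat_exp (m + 2) (g x) + (- real m) * flat_exp (m + 1) (g x)))"
      by (intro Ck_fun_mult Ck_fun_add Ck_fun_const Suc.IH)
  qed
qed

lemma Ck_fun_bump: "Ck_fun k (bump c \<rho>)"
proof -
  have "Ck_fun k (\<lambda>x::real^'n. c * (\<rho>^2 + (-1) * (x \<bullet> x)))" for k
    by (intro Ck_fun_mult Ck_fun_add Ck_fun_const Ck_fun_inner_self)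
  then show ?thesis unfolding bump_def[abs_def] using Ck_fun_flat_exp by fastforce
qed

lemma test_fun_Ck:
  assumes "\<And>k. Ck_fun k \<phi>" "\<And>x. norm x > \<rho> \<Longrightarrow> \<phi> x = 0"
  shows "test_fun \<phi> (\<lambda>x. frechet_derivative \<phi> (at x)) \<rho>"
proof
  show "(\<phi> has_derivative frechet_derivative \<phi> (at x)) (at x)" for x
    by (rule Ck_fun_Suc_has_derivative[OF assms(1)])
  show "continuous_on UNIV (\<lambda>x. frechet_derivative \<phi> (at x) v)" for v
    using assms(1)[of "Suc 0"] by simp
qed (rule assms(2))

text \<open>All derivatives fall on \<phi>: a directional derivative of \<open>conv u \<phi>\<close>
  is the convolution with the corresponding derivative of \<phi>, which is again smooth and
  supported in the same ball. Hence the induction generalises over \<phi>.\<close>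

lemma Ck_fun_conv:
  assumes u: "continuous_on UNIV u" and "\<And>k. Ck_fun k \<phi>" "\<And>x. norm x > \<rho> \<Longrightarrow> \<phi> x = 0"
  shows "Ck_fun k (conv u \<phi>)"
  using assms(2,3)
proof (induction k arbitrary: \<phi>)
  case 0
  interpret test_fun \<phi> "\<lambda>x. frechet_derivative \<phi> (at x)" \<rho>
    by (rule test_fun_Ck) (use 0 in auto)
  show ?case
    using conv_has_derivative[OF u] by (auto intro: has_derivative_continuous continuous_at_imp_continuous_on)
next
  case (Suc k)
  interpret test_fun \<phi> "\<lambda>x. frechet_derivative \<phi> (at x)" \<rho>
    by (rule test_fun_Ck) (use Suc.prems in auto)
  define \<psi> where "\<psi> v x = frechet_derivative \<phi> (at x) v" for v x
  have \<psi>: "Ck_fun j (\<psi> v)" "norm x > \<rho> \<Longrightarrow> \<psi> v x = 0" for j v x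
    using Suc.prems(1)[of "Suc j"] deriv_support by (auto simp: \<psi>_def[abs_def])
  have eq: "conv u (\<psi> v) x = (\<integral>y. u y * frechet_derivative \<phi> (at (x - y)) v \<partial>lborel)" for v x
  proof -
    interpret T: test_fun "\<psi> v" "\<lambda>x. frechet_derivative (\<psi> v) (at x)" \<rho>
      by (rule test_fun_Ck[OF \<psi>])
    show ?thesis using T.conv_altdef[OF u] by (simp add: \<psi>_def)
  qed
  show ?case
  proof (rule Ck_fun_SucI)
    show "(conv u \<phi> has_derivative (\<lambda>v. conv u (\<psi> v) x)) (at x)" for x
      unfolding eq by (rule conv_has_derivative[OF u])
    show "Ck_fun k (\<lambda>x. conv u (\<psi> v) x)" for v
      using Suc.IH[OF \<psi>] .
  qed
qed

section \<open>Gradient and superdifferential graphs in epsilon-delta form\<close>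

lemma grad_graph_iff:
  "(x, p) \<in> grad_graph u \<longleftrightarrow> (u has_derivative (\<lambda>v. p \<bullet> v)) (at x)"
proof
  assume "(x, p) \<in> grad_graph u"
  then obtain r where r: "r \<in> o[at x](\<lambda>y. norm (y - x))"
    "\<forall>\<^sub>F y in at x. u y = u x + p \<bullet> (y - x) + r y" by (auto simp: grad_graph_def)
  show "(u has_derivative (\<lambda>v. p \<bullet> v)) (at x)"
    unfolding has_derivative_at_alt
  proof (intro conjI allI impI bounded_linear_inner_right)
    fix e :: real assume "e > 0"
    have "\<forall>\<^sub>F y in at x. norm (r y) \<le> e * norm (norm (y - x))"
      using landau_o.smallD[OF r(1) \<open>e > 0\<close>] .
    with r(2) have "\<forall>\<^sub>F y in at x. norm (u y - u x - p \<bullet> (y - x)) \<le> e * norm (y - x)"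
      by eventually_elim auto
    then obtain d where "d > 0" "\<And>y. y \<noteq> x \<Longrightarrow> dist y x < d \<Longrightarrow> norm (u y - u x - p \<bullet> (y - x)) \<le> e * norm (y - x)"
      unfolding eventually_at by auto
    then show "\<exists>d>0. \<forall>y. norm (y - x) < d \<longrightarrow> norm (u y - u x - p \<bullet> (y - x)) \<le> e * norm (y - x)"
      by (intro exI[of _ d] conjI allI impI) (metis diff_self dist_norm inner_zero_right mult_zero_right norm_zero order_refl)+
  qed
next
  assume "(u has_derivative (\<lambda>v. p \<bullet> v)) (at x)"
  then have *: "\<exists>d>0. \<forall>y. norm (y - x) < d \<longrightarrow> norm (u y - u x - p \<bullet> (y - x)) \<le> e * norm (y - x)" if "e > 0" for e
    using that unfolding has_derivative_at_alt by blast
  have "(\<lambda>y. u y - u x - p \<bullet> (y - x)) \<in> o[at x](\<lambda>y. norm (y - x))"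
  proof (rule landau_o.smallI)
    fix c :: real assume "c > 0"
    from *[OF this] show "\<forall>\<^sub>F y in at x. norm (u y - u x - p \<bullet> (y - x)) \<le> c * norm (norm (y - x))"
      unfolding eventually_at by (auto simp: dist_norm)
  qed
  then show "(x, p) \<in> grad_graph u"
    unfolding grad_graph_def by auto
qed

lemma superdiff_graph_iff:
  "(x, p) \<in> superdiff_graph u \<longleftrightarrow>
    (\<forall>e>0. \<exists>d>0. \<forall>y. norm (y - x) < d \<longrightarrow> u y \<le> u x + p \<bullet> (y - x) + e * norm (y - x))"
proof
  assume "(x, p) \<in> superdiff_graph u"
  then obtain r where r: "r \<in> o[at x](\<lambda>y. norm (y - x))"
    "\<forall>\<^sub>F y in at x. u y \<le> u x + p \<bullet> (y - x) + r y" by (auto simp: superdiff_graph_def)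
  show "\<forall>e>0. \<exists>d>0. \<forall>y. norm (y - x) < d \<longrightarrow> u y \<le> u x + p \<bullet> (y - x) + e * norm (y - x)"
  proof (intro allI impI)
    fix e :: real assume "e > 0"
    have "\<forall>\<^sub>F y in at x. norm (r y) \<le> e * norm (norm (y - x))"
      using landau_o.smallD[OF r(1) \<open>e > 0\<close>] .
    with r(2) have "\<forall>\<^sub>F y in at x. u y \<le> u x + p \<bullet> (y - x) + e * norm (y - x)"
      by eventually_elim auto
    then obtain d where d: "d > 0" "\<And>y. y \<noteq> x \<Longrightarrow> dist y x < d \<Longrightarrow> u y \<le> u x + p \<bullet> (y - x) + e * norm (y - x)"
      unfolding eventually_at by auto
    have "u y \<le> u x + p \<bullet> (y - x) + e * norm (y - x)" if "norm (y - x) < d" for y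
      using d(2)[of y] that by (cases "y = x") (auto simp: dist_norm)
    with d(1) show "\<exists>d>0. \<forall>y. norm (y - x) < d \<longrightarrow> u y \<le> u x + p \<bullet> (y - x) + e * norm (y - x)"
      by blast
  qed
next
  assume *: "\<forall>e>0. \<exists>d>0. \<forall>y. norm (y - x) < d \<longrightarrow> u y \<le> u x + p \<bullet> (y - x) + e * norm (y - x)"
  \<comment> \<open>The deviation from the affine function may be very negative; only its positive
    part is of lower order, so that part is the remainder.\<close>
  define r where "r y = max 0 (u y - u x - p \<bullet> (y - x))" for y
  have "r \<in> o[at x](\<lambda>y. norm (y - x))"
  proof (rule landau_o.smallI)
    fix c :: real assume "c > 0"
    with * obtain d where "d > 0" "\<forall>y. norm (y - x) < d \<longrightarrow> u y \<le> u x + p \<bullet> (y - x) + c * norm (y - x)" by blast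
    then show "\<forall>\<^sub>F y in at x. norm (r y) \<le> c * norm (norm (y - x))"
      unfolding eventually_at using \<open>c > 0\<close> by (intro exI[of _ d]) (auto simp: dist_norm r_def algebra_simps)
  qed
  moreover have "u y \<le> u x + p \<bullet> (y - x) + r y" for y by (simp add: r_def)
  ultimately show "(x, p) \<in> superdiff_graph u"
    unfolding superdiff_graph_def by auto
qed

text \<open>Through this reflection, results proved for superdifferentials serve for
  subdifferentials too.\<close>

lemma subdiff_graph_iff_superdiff_graph:
  "(x, p) \<in> subdiff_graph u \<longleftrightarrow> (x, - p) \<in> superdiff_graph (\<lambda>y. - u y)"
proof
  assume "(x, p) \<in> subdiff_graph u"
  then obtain r where r: "r \<in> o[at x](\<lambda>y. norm (y - x))"
    "\<forall>\<^sub>F y in at x. u x + p \<bullet> (y - x) + r y \<le> u y" by (auto simp: subdiff_graph_def)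
  have "\<forall>\<^sub>F y in at x. - u y \<le> - u x + (- p) \<bullet> (y - x) + - r y"
    using r(2) by eventually_elim auto
  moreover have "(\<lambda>y. - r y) \<in> o[at x](\<lambda>y. norm (y - x))" using r(1) by simp
  ultimately show "(x, - p) \<in> superdiff_graph (\<lambda>y. - u y)"
    unfolding superdiff_graph_def by blast
next
  assume "(x, - p) \<in> superdiff_graph (\<lambda>y. - u y)"
  then obtain r where r: "r \<in> o[at x](\<lambda>y. norm (y - x))"
    "\<forall>\<^sub>F y in at x. - u y \<le> - u x + (- p) \<bullet> (y - x) + r y" unfolding superdiff_graph_def by blast
  have "\<forall>\<^sub>F y in at x. u x + p \<bullet> (y - x) + - r y \<le> u y"
    using r(2) by eventually_elim auto
  moreover have "(\<lambda>y. - r y) \<in> o[at x](\<lambda>y. norm (y - x))" using r(1) by simp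
  ultimately show "(x, p) \<in> subdiff_graph u"
    unfolding subdiff_graph_def by blast
qed

lemma grad_graph_subset_superdiff_graph: "grad_graph u \<subseteq> superdiff_graph u"
  unfolding grad_graph_def superdiff_graph_def by (auto elim!: eventually_mono)

text \<open>Moving from \<open>x\<close> against \<open>p - q\<close>, the upper bound with slope
  \<open>p\<close> falls below the linearisation with slope \<open>q\<close> at the rate
  \<open>norm (p - q)\<close>, which the two error terms must absorb.\<close>

lemma superdiff_graph_differentiable:
  assumes "(u has_derivative (\<lambda>v. q \<bullet> v)) (at x)" "(x, p) \<in> superdiff_graph u"
  shows "p = q"
proof -
  have "norm (p - q) \<le> e" if e: "e > 0" for e
  proof -
    obtain d where d: "d > 0" "\<And>y. norm (y - x) < d \<Longrightarrow> u y \<le> u x + p \<bullet> (y - x) + e/2 * norm (y - x)"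
      using assms(2) e unfolding superdiff_graph_iff by (meson half_gt_zero)
    obtain d' where d': "d' > 0" "\<And>y. norm (y - x) < d' \<Longrightarrow> norm (u y - u x - q \<bullet> (y - x)) \<le> e/2 * norm (y - x)"
      using assms(1) e unfolding has_derivative_at_alt by (meson half_gt_zero)
    show ?thesis
    proof (cases "p = q")
      case False
      define t where "t = min d d' / (2 * norm (p - q))"
      have t: "t > 0" using d(1) d'(1) False by (simp add: t_def)
      define y where "y = x - t *\<^sub>R (p - q)"
      have ny: "norm (y - x) = t * norm (p - q)" using t by (simp add: y_def)
      also have "\<dots> = min d d' / 2" using False by (simp add: t_def)
      also have "\<dots> < min d d'" using d(1) d'(1) by (simp add: min_def)
      finally have "norm (y - x) < min d d'" .
      then have nd: "norm (y - x) < d" "norm (y - x) < d'" by auto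
      have "u y \<le> u x + p \<bullet> (y - x) + (e * norm (y - x)) / 2"
        using d(2)[OF nd(1)] by simp
      moreover have "\<bar>u y - u x - q \<bullet> (y - x)\<bar> \<le> (e * norm (y - x)) / 2"
        using d'(2)[OF nd(2)] by simp
      ultimately have "0 \<le> (p - q) \<bullet> (y - x) + e * norm (y - x)"
        unfolding inner_diff_left by linarith
      also have "(p - q) \<bullet> (y - x) = - t * (norm (p - q))^2"
        by (simp add: y_def power2_norm_eq_inner)
      finally have "t * (norm (p - q) * norm (p - q)) \<le> t * (norm (p - q) * e)"
        by (simp add: ny power2_eq_square mult_ac)
      then have "norm (p - q) * norm (p - q) \<le> norm (p - q) * e"
        using t by simp
      then show ?thesis using False by simp
    qed (use e in simp)
  qed
  then have "norm (p - q) \<le> 0" by (rule field_le_epsilon[of _ 0, simplified]) 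
  then show ?thesis by simp
qed

section \<open>Periodicity, compactness and mollification on the torus\<close>

lemma torus_fun_reduce:
  fixes x :: "real^'n"
  obtains k where "k \<in> int_lattice" "x + k \<in> cbox 0 1"
proof
  show "- (\<chi> i. of_int \<lfloor>x $ i\<rfloor>) \<in> (int_lattice :: (real^'n) set)" by (simp add: int_lattice_def)
  have "0 \<le> t - of_int \<lfloor>t\<rfloor> \<and> t - of_int \<lfloor>t\<rfloor> \<le> 1" for t :: real
    by linarith
  then show "x + - (\<chi> i. of_int \<lfloor>x $ i\<rfloor>) \<in> cbox 0 1"
    by (simp add: mem_box_cart)
qed

text \<open>A lattice shift brings \<open>x\<close> into the unit cube without changing
  \<open>H\<close>; with \<open>p\<close> bounded, everything then happens in one compact
  set.\<close>

lemma uniform_continuity_torus: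
  fixes H :: "(real^'n) \<times> (real^'n) \<Rightarrow> real"
  assumes per: "hamiltonian_periodic H" and cont: "continuous_on UNIV H" and "0 < e"
  obtains d where "0 < d" "\<And>x y p. norm p \<le> L \<Longrightarrow> norm y < d \<Longrightarrow> \<bar>H (x, p) - H (x - y, p)\<bar> < e"
proof -
  \<comment> \<open>The cube is enlarged by the unit ball so that \<open>x + k - y\<close> still
    lies in the first factor when \<open>norm y < min d 1\<close>.\<close>
  define S where "S = {x - y | x y. x \<in> cbox (0::real^'n) 1 \<and> y \<in> cball 0 1} \<times> cball (0::real^'n) L"
  have "compact S"
    unfolding S_def by (intro compact_Times compact_differences compact_cbox compact_cball)
  then have "uniformly_continuous_on S H"
    by (intro compact_uniformly_continuous continuous_on_subset[OF cont]) auto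
  then obtain d where d: "d > 0" "\<And>z z'. z \<in> S \<Longrightarrow> z' \<in> S \<Longrightarrow> dist z' z < d \<Longrightarrow> dist (H z') (H z) < e"
    using \<open>0 < e\<close> unfolding uniformly_continuous_on_def by metis
  show ?thesis
  proof
    show "0 < min d 1" using d(1) by simp
    fix x y p :: "real^'n" assume p: "norm p \<le> L" and y: "norm y < min d 1"
    obtain k where k: "k \<in> int_lattice" and x: "x + k \<in> cbox 0 1" by (rule torus_fun_reduce)
    have H: "H (x + k, p) = H (x, p)" for x
      using per k unfolding hamiltonian_periodic_def torus_fun_def by blast
    have 1: "(x + k, p) \<in> S"
    proof -
      have "x + k = (x + k) - 0" by simp
      then show ?thesis unfolding S_def using x p by fastforce
    qed
    have 2: "(x + k - y, p) \<in> S"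
      unfolding S_def using x p y by fastforce
    have "dist (H (x + k, p)) (H (x + k - y, p)) < e"
      using d(2)[OF 2 1] y by (simp add: dist_prod_def dist_norm)
    moreover have "x + k - y = x - y + k" by simp
    ultimately show "\<bar>H (x, p) - H (x - y, p)\<bar> < e"
      using H[of x] H[of "x - y"] by (simp add: dist_real_def)
  qed
qed

lemma convex_closed_sublevel:
  fixes H :: "(real^'n) \<times> (real^'n) \<Rightarrow> real"
  assumes "continuous_on UNIV H" "quasiconvex_in_p H"
  shows "convex {p. H (x, p) \<le> a}" "closed {p. H (x, p) \<le> a}"
proof -
  show "convex {p. H (x, p) \<le> a}"
    unfolding convex_alt
  proof (intro ballI allI impI, clarify)
    fix p q and t :: real assume pq: "H (x, p) \<le> a" "H (x, q) \<le> a" and t: "0 \<le> t" "t \<le> 1"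
    have "H (x, (1 - t) *\<^sub>R p + (1 - (1 - t)) *\<^sub>R q) \<le> max (H (x, p)) (H (x, q))"
      using assms(2) t unfolding quasiconvex_in_p_def by (metis diff_ge_0_iff_ge diff_le_eq le_add_same_cancel1)
    then show "H (x, (1 - t) *\<^sub>R p + t *\<^sub>R q) \<le> a" using pq by simp
  qed
  show "closed {p. H (x, p) \<le> a}"
    by (intro closed_Collect_le continuous_on_compose2[OF assms(1)] continuous_intros) auto
qed

lemma Lip_torusD:
  assumes "u \<in> Lip_torus"
  obtains L where "L-lipschitz_on UNIV u"
  using assms unfolding Lip_torus_def by blast

text \<open>The gradient of the mollified function at \<open>x\<close> is an average of gradients of \<open>u\<close> near \<open>x\<close>, all of which
  lie in the closed convex sublevel set of \<open>H\<close> at \<open>x\<close>.\<close>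

lemma smooth_approximation:
  fixes H :: "(real^'n) \<times> (real^'n) \<Rightarrow> real"
  assumes per: "hamiltonian_periodic H" and Hc: "continuous_on UNIV H" and qc: "quasiconvex_in_p H"
    and u: "u \<in> Lip_torus" and sub: "\<And>x p. (x, p) \<in> grad_graph u \<Longrightarrow> H (x, p) \<le> a" and e: "0 < e"
  obtains w where "w \<in> Cinf_torus" "\<And>x p. (w has_derivative (\<lambda>v. p \<bullet> v)) (at x) \<Longrightarrow> H (x, p) \<le> a + e"
proof -
  obtain L where L: "L-lipschitz_on UNIV u" using u by (rule Lip_torusD)
  have uc: "continuous_on UNIV u" using L by (rule lipschitz_on_continuous_on)
  obtain d where d: "0 < d" "\<And>x y p. norm p \<le> L \<Longrightarrow> norm y < d \<Longrightarrow> \<bar>H (x, p) - H (x - y, p)\<bar> < e"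
    using uniform_continuity_torus[OF per Hc e] by blast
  interpret b: test_fun "bump 1 d :: real^'n \<Rightarrow> real" "\<lambda>x v. flat_exp 2 (1 * (d^2 - x \<bullet> x)) * (1 * (- 2 * (x \<bullet> v)))" d
    by (rule test_fun_bump) (use d in auto)
  define m where "m = (\<integral>y. bump 1 d (y :: real^'n) \<partial>lborel)"
  have bi: "integrable lborel (bump 1 d :: real^'n \<Rightarrow> real)"
    by (rule integrable_compact_support[OF b.cont b.support])
  have bm[measurable]: "(bump 1 d :: real^'n \<Rightarrow> real) \<in> borel_measurable borel"
    by (rule borel_measurable_continuous_onI[OF b.cont])
  have m: "m > 0"
  proof -
    \<comment> \<open>A zero integral would make the nonnegative bump vanish almost everywhere,
      although it is positive on a ball of positive measure.\<close>
    have "m \<noteq> 0"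
    proof
      assume "m = 0"
      then have "AE y in lborel. bump 1 d (y :: real^'n) = 0"
        unfolding m_def using integral_nonneg_eq_0_iff_AE[OF bi] bump_nonneg by auto
      then have "AE y in lborel. y \<notin> ball (0 :: real^'n) d"
        by eventually_elim (use bump_pos_iff[of 1 d] d(1) in force)
      then have "emeasure lborel (ball (0 :: real^'n) d) = 0"
        by (subst (asm) AE_iff_measurable[of "ball 0 d"]) auto
      then have "negligible (ball (0 :: real^'n) d)"
        by (simp add: negligible_iff_null_sets null_sets_def)
      then show False using d(1) by (simp add: open_not_negligible)
    qed
    moreover have "m \<ge> 0" unfolding m_def by (intro integral_nonneg_AE AE_I2 bump_nonneg)
    ultimately show ?thesis by simp
  qed
  define \<phi> where "\<phi> y = inverse m * bump 1 d y" for y :: "real^'n"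
  have \<phi>C: "Ck_fun k \<phi>" for k unfolding \<phi>_def[abs_def] by (intro Ck_fun_mult Ck_fun_const Ck_fun_bump)
  have \<phi>0: "\<phi> y = 0" if "norm y \<ge> d" for y using bump_eq_0[of 1 d y] that d(1) by (simp add: \<phi>_def)
  have \<phi>pos: "\<phi> y \<ge> 0" for y using m bump_nonneg[of 1 d y] by (simp add: \<phi>_def)
  interpret test_fun \<phi> "\<lambda>x. frechet_derivative \<phi> (at x)" d
    by (rule test_fun_Ck[OF \<phi>C]) (simp add: \<phi>0)
  have \<phi>int: "(\<integral>y. \<phi> y \<partial>lborel) = 1" "integrable lborel \<phi>"
    using m bi by (simp_all add: \<phi>_def[abs_def] m_def[symmetric])
  define w where "w = conv u \<phi>"
  have "torus_fun w"
    unfolding torus_fun_def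
  proof (intro allI ballI)
    fix x k :: "real^'n" assume "k \<in> int_lattice"
    then have "u ((x - y) + k) = u (x - y)" for y
      using u unfolding Lip_torus_def torus_fun_def by blast
    then have "u (x + k - y) = u (x - y)" for y
      by (simp add: algebra_simps)
    then show "w (x + k) = w x" by (simp add: w_def conv_def)
  qed
  moreover have "Ck_fun k w" for k
    unfolding w_def by (rule Ck_fun_conv[OF uc \<phi>C, of d]) (simp add: \<phi>0)
  ultimately have "w \<in> Cinf_torus" by (simp add: Cinf_torus_def)
  moreover have "H (x, p) \<le> a + e" if p: "(w has_derivative (\<lambda>v. p \<bullet> v)) (at x)" for x p
  proof (rule ccontr)
    let ?K = "{q. H (x, q) \<le> a + e}"
    assume "\<not> ?thesis"
    then have "p \<notin> ?K" by simp
    \<comment> \<open>Separation reduces an average of vectors to one scalar integral: along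
      \<open>v\<close>, every averaged gradient lies above \<open>b\<close>, while \<open>p\<close>
      lies below.\<close>
    then obtain v b where vb: "v \<bullet> p < b" "\<And>q. q \<in> ?K \<Longrightarrow> v \<bullet> q > b"
      using separating_hyperplane_closed_point[OF convex_closed_sublevel[OF Hc qc]] by meson
    have "p \<bullet> v = (\<integral>y. u y * frechet_derivative \<phi> (at (x - y)) v \<partial>lborel)"
      by (rule fun_cong[OF has_derivative_unique[OF p[unfolded w_def] conv_has_derivative[OF uc]]])
    also have "\<dots> = (\<integral>y. dir_deriv u v (x - y) * \<phi> y \<partial>lborel)"
      using conv_dir_deriv(2)[OF L] by simp
    finally have pv: "p \<bullet> v = (\<integral>y. dir_deriv u v (x - y) * \<phi> y \<partial>lborel)" .
    have "AE y in lborel. b * \<phi> y \<le> dir_deriv u v (x - y) * \<phi> y"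
      using AE_lborel_reflect[OF Rademacher[OF L], of x]
    proof eventually_elim
      case (elim y)
      then obtain q where q: "(u has_derivative (\<lambda>v. q \<bullet> v)) (at (x - y))" "dir_deriv u v (x - y) = q \<bullet> v" by auto
      show ?case
      proof (cases "norm y < d")
        case True
        have "H (x - y, q) \<le> a" using q(1) by (intro sub) (simp add: grad_graph_iff)
        moreover have "norm q \<le> L" by (rule gradient_norm_le[OF L q(1)])
        \<comment> \<open>Passing from the base point \<open>x - y\<close> to \<open>x\<close> costs
          less than \<open>e\<close>, which is the slack in the level \<open>a + e\<close>.\<close>
        ultimately have "q \<in> ?K" using d(2)[of q y x] True by auto
        then have "b < q \<bullet> v" using vb(2) by (simp add: inner_commute)
        then show ?thesis unfolding q(2) using \<phi>pos by (intro mult_right_mono) auto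
      qed (simp add: \<phi>0)
    qed
    then have "(\<integral>y. b * \<phi> y \<partial>lborel) \<le> (\<integral>y. dir_deriv u v (x - y) * \<phi> y \<partial>lborel)"
      using conv_dir_deriv(1)[OF L] \<phi>int by (intro integral_mono_AE) auto
    then have "b \<le> p \<bullet> v" using \<phi>int by (simp add: pv)
    then show False using vb(1) by (simp add: inner_commute)
  qed
  ultimately show ?thesis using that by blast
qed

lemma torus_fun_bounded:
  fixes f :: "real^'n \<Rightarrow> real"
  assumes "torus_fun f" "continuous_on UNIV f"
  obtains x y where "\<And>z. f x \<le> f z" "\<And>z. f z \<le> f y"
proof -
  have ne: "cbox (0::real^'n) 1 \<noteq> {}" by (auto simp: interval_ne_empty_cart)
  have c: "continuous_on (cbox 0 1) f" by (rule continuous_on_subset[OF assms(2)]) simp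
  obtain x where x: "\<forall>z\<in>cbox 0 1. f x \<le> f z"
    using continuous_attains_inf[OF compact_cbox ne c] by blast
  obtain y where y: "\<forall>z\<in>cbox 0 1. f z \<le> f y"
    using continuous_attains_sup[OF compact_cbox ne c] by blast
  have red: "\<exists>z'\<in>cbox 0 1. f z = f z'" for z
    using torus_fun_reduce[of z] assms(1) unfolding torus_fun_def by metis
  show ?thesis
    by (rule that[of x y]) (use x y red in metis)+
qed

text \<open>Periodicity passes to the derivative, so each partial derivative is bounded by its
  extremes over the unit cube. The sum of these bounds serves as gradient bound and, by the mean
  value inequality, as Lipschitz constant.\<close>

lemma Cinf_torus_bounded_gradient:
  fixes w :: "real^'n \<Rightarrow> real"
  assumes "w \<in> Cinf_torus"
  obtains L where "L-lipschitz_on UNIV w" "\<And>x. \<exists>p. (w has_derivative (\<lambda>v. p \<bullet> v)) (at x) \<and> norm p \<le> L"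
proof -
  have tw: "torus_fun w" and Ck: "Ck_fun (Suc 0) w" using assms by (auto simp: Cinf_torus_def simp del: Ck_fun.simps)
  define D where "D x = frechet_derivative w (at x)" for x
  have hd: "(w has_derivative D x) (at x)" for x
    unfolding D_def by (rule Ck_fun_Suc_has_derivative[OF Ck])
  have tD: "torus_fun (\<lambda>x. D x v)" for v
    unfolding torus_fun_def
  proof (intro allI ballI)
    fix x k :: "real^'n" assume k: "k \<in> int_lattice"
    have "((\<lambda>y. w (y + k)) has_derivative D (x + k)) (at x)"
      by (rule has_derivative_compose[of "\<lambda>y. y + k" "\<lambda>v. v" x UNIV w "D (x + k)"])
        (auto intro!: derivative_eq_intros hd)
    moreover have "(\<lambda>y. w (y + k)) = w" using tw k by (auto simp: torus_fun_def)
    ultimately have "D (x + k) = D x" using hd has_derivative_unique by metis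
    then show "D (x + k) v = D x v" by simp
  qed
  have cD: "continuous_on UNIV (\<lambda>x. D x v)" for v using Ck by (simp add: D_def)
  have "\<exists>m. \<forall>x. \<bar>D x v\<bar> \<le> m" for v
  proof -
    obtain a b where ab: "\<And>z. D a v \<le> D z v" "\<And>z. D z v \<le> D b v"
      using torus_fun_bounded[OF tD cD] by metis
    have "\<bar>D z v\<bar> \<le> \<bar>D a v\<bar> + \<bar>D b v\<bar>" for z
      using ab[of z] by linarith
    then show ?thesis by blast
  qed
  then obtain m where m: "\<And>v x. \<bar>D x v\<bar> \<le> m v" by metis
  define L where "L = (\<Sum>b\<in>(Basis::(real^'n) set). m b)"
  define p where "p x = (\<Sum>b\<in>Basis. D x b *\<^sub>R b)" for x
  have Dp: "D x = (\<lambda>v. p x \<bullet> v)" for x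
  proof
    fix v
    have l: "linear (D x)" using hd by (rule has_derivative_linear)
    have "D x v = D x (\<Sum>b\<in>Basis. (v \<bullet> b) *\<^sub>R b)" by (simp add: euclidean_representation)
    also have "\<dots> = p x \<bullet> v"
      by (simp add: p_def linear_sum[OF l] linear_cmul[OF l] inner_sum_left mult.commute inner_commute[of v])
    finally show "D x v = p x \<bullet> v" .
  qed
  have pL: "norm (p x) \<le> L" for x
  proof -
    have "norm (p x) \<le> (\<Sum>b\<in>Basis. norm (D x b *\<^sub>R b))" unfolding p_def by (rule norm_sum)
    also have "\<dots> \<le> L" unfolding L_def by (intro sum_mono) (simp add: m)
    finally show ?thesis .
  qed
  have "L-lipschitz_on UNIV w"
  proof (rule lipschitz_onI)
    fix x y
    have "norm (w x - w y) \<le> L * norm (x - y)"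
    proof (rule differentiable_bound[of UNIV w D])
      show "onorm (D x) \<le> L" for x
      proof (rule onorm_le)
        fix v
        have "\<bar>p x \<bullet> v\<bar> \<le> norm (p x) * norm v" by (rule Cauchy_Schwarz_ineq2)
        also have "\<dots> \<le> L * norm v" by (intro mult_right_mono pL) simp
        finally show "norm (D x v) \<le> L * norm v" by (simp add: Dp)
      qed
    qed (auto intro: hd)
    then show "dist (w x) (w y) \<le> L * dist x y" by (simp add: dist_norm)
  qed (use pL[of 0] norm_ge_zero order_trans in blast)
  then show ?thesis using that hd pL unfolding Dp by blast
qed

lemma Cinf_torus_subset_Lip_torus: "Cinf_torus \<subseteq> Lip_torus"
proof
  fix w :: "real^'n \<Rightarrow> real" assume w: "w \<in> Cinf_torus"
  obtain L where "L-lipschitz_on UNIV w" using Cinf_torus_bounded_gradient[OF w] by metis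
  then show "w \<in> Lip_torus" using w by (auto simp: Lip_torus_def Cinf_torus_def)
qed

section \<open>Sub- and superdifferentials\<close>

lemma sup_on_le_iff: "sup_on G H \<le> ereal a \<longleftrightarrow> (\<forall>x p. (x, p) \<in> G \<longrightarrow> H (x, p) \<le> a)"
  unfolding sup_on_def by (auto simp: SUP_le_iff)

lemma le_inf_on_iff: "ereal a \<le> inf_on G H \<longleftrightarrow> (\<forall>x p. (x, p) \<in> G \<longrightarrow> a \<le> H (x, p))"
  unfolding inf_on_def by (auto simp: le_INF_iff)

lemma INF_Lip_torus_le_c_plus:
  "(INF u\<in>Lip_torus. sup_on (grad_graph u) H) \<le> c_plus H"
  unfolding c_plus_def
proof (rule INF_greatest)
  fix a assume "a \<in> {a. subeigenvalue H a}"
  then obtain u where u: "u \<in> Lip_torus" "sup_on (superdiff_graph u) H \<le> ereal a"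
    by (auto simp: subeigenvalue_def viscosity_subsolution_def)
  have "sup_on (grad_graph u) H \<le> sup_on (superdiff_graph u) H"
    unfolding sup_on_def by (rule SUP_subset_mono[OF grad_graph_subset_superdiff_graph]) simp
  then show "(INF u\<in>Lip_torus. sup_on (grad_graph u) H) \<le> ereal a"
    using u by (intro INF_lower2[OF u(1)]) simp
qed

lemma INF_Cinf_torus_le_INF_Lip_torus:
  fixes H :: "(real^'n) \<times> (real^'n) \<Rightarrow> real"
  assumes "hamiltonian_periodic H" "continuous_on UNIV H" "quasiconvex_in_p H"
  shows "(INF u\<in>Cinf_torus. sup_on (grad_graph u) H) \<le> (INF u\<in>Lip_torus. sup_on (grad_graph u) H)"
proof (rule INF_greatest, rule ereal_le_real)
  fix u and a :: real assume u: "u \<in> Lip_torus" and "sup_on (grad_graph u) H \<le> ereal a"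
  then have sub: "\<And>x p. (x, p) \<in> grad_graph u \<Longrightarrow> H (x, p) \<le> a"
    by (auto simp: sup_on_le_iff)
  show "(INF u\<in>Cinf_torus. sup_on (grad_graph u) H) \<le> ereal a"
  proof (rule ereal_le_epsilon2)
    fix e :: real assume "0 < e"
    obtain w where "w \<in> Cinf_torus" "\<And>x p. (w has_derivative (\<lambda>v. p \<bullet> v)) (at x) \<Longrightarrow> H (x, p) \<le> a + e"
      using smooth_approximation[OF assms u sub \<open>0 < e\<close>] by blast
    then show "(INF u\<in>Cinf_torus. sup_on (grad_graph u) H) \<le> ereal a + ereal e"
      by (intro INF_lower2[of w]) (auto simp: sup_on_le_iff grad_graph_iff)
  qed
qed

lemma c_plus_le_INF_Cinf_torus:
  fixes H :: "(real^'n) \<times> (real^'n) \<Rightarrow> real"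
  shows "c_plus H \<le> (INF u\<in>Cinf_torus. sup_on (grad_graph u) H)"
proof (rule INF_greatest, rule ereal_le_real)
  fix w and a :: real assume w: "w \<in> Cinf_torus" and a: "sup_on (grad_graph w) H \<le> ereal a"
  have "superdiff_graph w \<subseteq> grad_graph w"
  proof (clarify)
    fix x p assume "(x, p) \<in> superdiff_graph w"
    moreover obtain q where "(w has_derivative (\<lambda>v. q \<bullet> v)) (at x)"
      using Cinf_torus_bounded_gradient[OF w] by metis
    ultimately show "(x, p) \<in> grad_graph w"
      using superdiff_graph_differentiable by (auto simp: grad_graph_iff)
  qed
  then have "viscosity_subsolution H a w"
    using a w Cinf_torus_subset_Lip_torus unfolding viscosity_subsolution_def sup_on_le_iff by blast
  then show "c_plus H \<le> ereal a"
    unfolding c_plus_def subeigenvalue_def by (intro INF_lower) auto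
qed

section \<open>Touching functions and stability of superdifferentials\<close>

lemma superdiff_graph_local_max:
  fixes u f :: "real^'n \<Rightarrow> real"
  assumes f: "(f has_derivative (\<lambda>v. p \<bullet> v)) (at x)" and d: "0 < d"
    and max: "\<And>y. norm (y - x) < d \<Longrightarrow> u y - f y \<le> u x - f x"
  shows "(x, p) \<in> superdiff_graph u"
  unfolding superdiff_graph_iff
proof (intro allI impI)
  fix e :: real assume "0 < e"
  then obtain d' where d': "d' > 0" "\<And>y. norm (y - x) < d' \<Longrightarrow> norm (f y - f x - p \<bullet> (y - x)) \<le> e * norm (y - x)"
    using f unfolding has_derivative_at_alt by meson
  have "u y \<le> u x + p \<bullet> (y - x) + e * norm (y - x)" if "norm (y - x) < min d d'" for y
    using max[of y] d'(2)[of y] that by (auto simp: abs_le_iff)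
  then show "\<exists>d>0. \<forall>y. norm (y - x) < d \<longrightarrow> u y \<le> u x + p \<bullet> (y - x) + e * norm (y - x)"
    using d d'(1) by (intro exI[of _ "min d d'"]) simp
qed

lemma superdiff_graph_mono:
  assumes "(x, p) \<in> superdiff_graph u" "0 < d"
    and le: "\<And>y. norm (y - x) < d \<Longrightarrow> v y \<le> u y" and eq: "v x = u x"
  shows "(x, p) \<in> superdiff_graph v"
  unfolding superdiff_graph_iff
proof (intro allI impI)
  fix e :: real assume "0 < e"
  then obtain d' where d': "d' > 0" "\<And>y. norm (y - x) < d' \<Longrightarrow> u y \<le> u x + p \<bullet> (y - x) + e * norm (y - x)"
    using assms(1) unfolding superdiff_graph_iff by meson
  have "v y \<le> v x + p \<bullet> (y - x) + e * norm (y - x)" if "norm (y - x) < min d d'" for y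
    using le[of y] d'(2)[of y] that eq by auto
  then show "\<exists>d>0. \<forall>y. norm (y - x) < d \<longrightarrow> v y \<le> v x + p \<bullet> (y - x) + e * norm (y - x)"
    using \<open>0 < d\<close> d'(1) by (intro exI[of _ "min d d'"]) simp
qed

text \<open>If \<open>f\<close> lies above a cone with vertex at \<open>y\<close>, axis slope
  \<open>p\<close> and opening \<open>c\<close>, then stepping from \<open>y\<close> against
  \<open>q - p\<close> shows that an upper slope \<open>q\<close> cannot be further than
  \<open>c\<close> from \<open>p\<close>.\<close>

lemma superdiff_graph_cone:
  assumes q: "(y, q) \<in> superdiff_graph f"
    and lower: "\<And>z. f y + p \<bullet> (z - y) - c * norm (z - y) \<le> f z"
  shows "norm (q - p) \<le> c"
proof -
  have "norm (q - p) \<le> c + e" if e: "e > 0" for e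
  proof -
    obtain d where d: "d > 0" "\<And>z. norm (z - y) < d \<Longrightarrow> f z \<le> f y + q \<bullet> (z - y) + e * norm (z - y)"
      using q e unfolding superdiff_graph_iff by meson
    have key: "n \<le> c + e" if n: "n = norm (q - p)" "n > 0" for n
    proof -
      define t where "t = d / (2 * n)"
      have t: "t > 0" using d(1) n by (simp add: t_def)
      define z where "z = y - t *\<^sub>R (q - p)"
      have nz: "norm (z - y) = t * n" using t n by (simp add: z_def)
      also have "\<dots> < d" using n d(1) by (simp add: t_def)
      finally have "f z \<le> f y + q \<bullet> (z - y) + e * norm (z - y)" by (rule d(2))
      with lower[of z] have "0 \<le> (q - p) \<bullet> (z - y) + (c + e) * norm (z - y)"
        by (simp add: inner_diff_left distrib_right)
      also have "(q - p) \<bullet> (z - y) = - t * (n * n)"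
        by (simp add: z_def n power2_norm_eq_inner[symmetric] power2_eq_square)
      finally have "(t * n) * n \<le> (t * n) * (c + e)" unfolding nz by (simp add: algebra_simps)
      then show ?thesis using t n by simp
    qed
    \<comment> \<open>This settles \<open>q = p\<close>: the bounds at two opposite points are
      added, and the linear terms cancel.\<close>
    have "0 \<le> c + e"
    proof -
      obtain b :: "real^'a" where b: "norm b = 1" using vector_choose_size[of 1] by auto
      have nn: "norm ((d/2) *\<^sub>R b) = d / 2" using d(1) b by simp
      have "f (y + (d/2) *\<^sub>R b) \<le> f y + q \<bullet> ((d/2) *\<^sub>R b) + e * (d/2)" "f (y - (d/2) *\<^sub>R b) \<le> f y - q \<bullet> ((d/2) *\<^sub>R b) + e * (d/2)"
        using d(2)[of "y + (d/2) *\<^sub>R b"] d(2)[of "y - (d/2) *\<^sub>R b"] nn d(1) by auto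
      moreover have "f y + p \<bullet> ((d/2) *\<^sub>R b) - c * (d/2) \<le> f (y + (d/2) *\<^sub>R b)" "f y - p \<bullet> ((d/2) *\<^sub>R b) - c * (d/2) \<le> f (y - (d/2) *\<^sub>R b)"
        using lower[of "y + (d/2) *\<^sub>R b"] lower[of "y - (d/2) *\<^sub>R b"] nn by auto
      ultimately have "0 \<le> e * (d/2) + c * (d/2)" by linarith
      then have "0 \<le> (c + e) * (d/2)" by (simp add: algebra_simps)
      then show ?thesis using d(1) by (simp add: zero_le_mult_iff)
    qed
    then show ?thesis using key[OF refl] by (cases "norm (q - p) > 0") auto
  qed
  then show ?thesis by (rule field_le_epsilon)
qed

text \<open>The point \<open>y\<close> maximises \<open>f\<close> minus the affine function with slope \<open>p\<close> and a quadratic penalty; the two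
  hypotheses force the maximum over the ball to be interior.\<close>

lemma superdiff_graph_stability:
  fixes f :: "real^'n \<Rightarrow> real"
  assumes cont: "continuous_on (cball x \<delta>) f" and pos: "0 < \<delta>" "0 < \<epsilon>"
    and le: "\<And>y. norm (y - x) \<le> \<delta> \<Longrightarrow> f y \<le> A + p \<bullet> (y - x) + \<epsilon> * norm (y - x)"
    and gt: "f x > A - \<epsilon> * \<delta>"
  obtains y q where "norm (y - x) < \<delta>" "norm (q - p) \<le> 4 * \<epsilon>" "(y, q) \<in> superdiff_graph f"
proof -
  \<comment> \<open>The quadratic penalty equals \<open>2 * \<epsilon> * \<delta>\<close> on the
    sphere of radius \<delta>, pushing \<open>f - \<phi>\<close> there below its value at
    \<open>x\<close>; its gradient inside is at most \<open>4 * \<epsilon>\<close>.\<close>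
  define \<phi> where "\<phi> y = p \<bullet> (y - x) + (2 * \<epsilon> / \<delta>) * ((y - x) \<bullet> (y - x))" for y
  have "continuous_on (cball x \<delta>) (\<lambda>y. f y - \<phi> y)"
    unfolding \<phi>_def by (intro continuous_intros cont)
  then obtain y where y: "y \<in> cball x \<delta>" "\<forall>z\<in>cball x \<delta>. f z - \<phi> z \<le> f y - \<phi> y"
    using continuous_attains_sup[OF compact_cball, of x \<delta>] pos by force
  have "norm (y - x) \<noteq> \<delta>"
  proof
    assume n: "norm (y - x) = \<delta>"
    have "f x - \<phi> x \<le> f y - \<phi> y" using y(2) pos by auto
    moreover have "\<phi> x = 0" by (simp add: \<phi>_def)
    moreover have "\<phi> y = p \<bullet> (y - x) + 2 * \<epsilon> * \<delta>"
    proof -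
      have "(y - x) \<bullet> (y - x) = \<delta> * \<delta>" using n by (metis power2_norm_eq_inner power2_eq_square)
      moreover have "2 * \<epsilon> / \<delta> * (\<delta> * \<delta>) = 2 * \<epsilon> * \<delta>" using pos(1) by (simp add: field_simps)
      ultimately show ?thesis by (simp only: \<phi>_def)
    qed
    moreover have "f y \<le> A + p \<bullet> (y - x) + \<epsilon> * \<delta>" using le[of y] n by simp
    ultimately show False using gt by simp
  qed
  then have ny: "norm (y - x) < \<delta>" using y(1) by (simp add: dist_norm norm_minus_commute)
  define q where "q = p + (4 * \<epsilon> / \<delta>) *\<^sub>R (y - x)"
  have "(\<phi> has_derivative (\<lambda>v. q \<bullet> v)) (at y)"
    unfolding \<phi>_def[abs_def] q_def
    using pos by (auto intro!: derivative_eq_intros simp: inner_add_left inner_commute algebra_simps)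
  then have "(y, q) \<in> superdiff_graph f"
  proof (rule superdiff_graph_local_max)
    show "0 < \<delta> - norm (y - x)" using ny by simp
    fix z assume "norm (z - y) < \<delta> - norm (y - x)"
    then have "z \<in> cball x \<delta>"
      using norm_triangle_ineq[of "z - y" "y - x"] by (simp add: dist_norm norm_minus_commute)
    then show "f z - \<phi> z \<le> f y - \<phi> y" using y(2) by blast
  qed
  moreover have "norm (q - p) \<le> 4 * \<epsilon>"
  proof -
    have "norm (q - p) = (4 * \<epsilon> / \<delta>) * norm (y - x)" using pos by (simp add: q_def)
    also have "\<dots> \<le> (4 * \<epsilon> / \<delta>) * \<delta>" using ny pos by (intro mult_left_mono) auto
    finally show ?thesis using pos by simp
  qed
  ultimately show ?thesis using that ny by blast
qed

text \<open>If \<open>u\<close> rose faster than some \<open>r > R\<close>, then \<open>u\<close>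
  minus the cone of slope \<open>r\<close> at \<open>x\<close> would have its maximum away from the
  vertex. There the cone is differentiable with a gradient of norm \<open>r\<close>, which would lie
  in the superdifferential.\<close>

lemma lipschitz_if_superdiff_bounded:
  fixes u :: "real^'n \<Rightarrow> real"
  assumes cont: "continuous_on UNIV u" and bd: "\<And>x. \<bar>u x\<bar> \<le> B"
    and grad: "\<And>x p. (x, p) \<in> superdiff_graph u \<Longrightarrow> norm p \<le> R" and R: "0 \<le> R"
  shows "R-lipschitz_on UNIV u"
proof -
  have main: "u y \<le> u x + r * norm (y - x)" if r: "R < r" for x y r
  proof (rule ccontr)
    assume gt: "\<not> u y \<le> u x + r * norm (y - x)"
    have r0: "r > 0" using R r by simp
    have B: "B \<ge> 0" using bd[of x] by simp
    \<comment> \<open>Beyond \<open>(2 * B + 1) / r\<close> the cone exceeds the oscillation of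
      \<open>u\<close>, so a maximum over the ball is global; the summand
      \<open>norm (y - x)\<close> puts \<open>y\<close> into the ball.\<close>
    define \<rho> where "\<rho> = (2 * B + 1) / r + norm (y - x)"
    define f where "f z = u z - r * norm (z - x)" for z
    have "\<rho> > 0" using r0 B by (simp add: \<rho>_def add_pos_nonneg)
    moreover have "continuous_on (cball x \<rho>) f"
      unfolding f_def by (intro continuous_intros continuous_on_subset[OF cont]) auto
    ultimately obtain m where m: "m \<in> cball x \<rho>" "\<forall>z\<in>cball x \<rho>. f z \<le> f m"
      using continuous_attains_sup[OF compact_cball, of x \<rho> f] by force
    have "y \<in> cball x \<rho>" using r0 B by (simp add: \<rho>_def dist_norm norm_minus_commute)
    then have "f y \<le> f m" using m(2) by blast
    then have fm: "u x < f m" using gt by (simp add: f_def)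
    have glob: "f z \<le> f m" for z
    proof (cases "z \<in> cball x \<rho>")
      case False
      then have "\<rho> < norm (z - x)" by (simp add: dist_norm norm_minus_commute)
      then have "(2 * B + 1) / r \<le> norm (z - x)"
        using norm_ge_zero[of "y - x"] unfolding \<rho>_def by linarith
      then have "2 * B + 1 \<le> r * norm (z - x)"
        using r0 by (simp add: divide_le_eq mult.commute)
      then have "f z \<le> u x" using bd[of z] bd[of x] unfolding f_def by linarith
      then show ?thesis using fm by simp
    qed (use m in auto)
    have ne: "m - x \<noteq> 0" using fm by (auto simp: f_def)
    have "((\<lambda>z. r * norm (z - x)) has_derivative (\<lambda>v. (r *\<^sub>R sgn (m - x)) \<bullet> v)) (at m)"
    proof -
      have "((\<lambda>z. z - x) has_derivative (\<lambda>v. v)) (at m)" by (auto intro!: derivative_eq_intros)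
      from has_derivative_compose[OF this has_derivative_norm[OF ne]]
      have "((\<lambda>z. norm (z - x)) has_derivative (\<lambda>v. v \<bullet> sgn (m - x))) (at m)"
        by (simp add: inner_commute)
      from has_derivative_mult_right[OF this, of r] show ?thesis by (simp add: inner_commute)
    qed
    then have "(m, r *\<^sub>R sgn (m - x)) \<in> superdiff_graph u"
      by (rule superdiff_graph_local_max[of _ _ _ 1]) (use glob in \<open>auto simp: f_def\<close>)
    then have "norm (r *\<^sub>R sgn (m - x)) \<le> R" by (rule grad)
    then show False using r r0 ne by (simp add: norm_sgn)
  qed
  have le: "u y \<le> u x + R * norm (y - x)" for x y
  proof (cases "y = x")
    case False
    show ?thesis
    proof (rule field_le_epsilon)
      fix e :: real assume "0 < e"
      then show "u y \<le> u x + R * norm (y - x) + e"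
        using main[of "R + e / norm (y - x)" y x] False by (simp add: distrib_right)
    qed
  qed simp
  show ?thesis
  proof (rule lipschitz_onI[OF _ R])
    fix x y show "dist (u x) (u y) \<le> R * dist x y"
      using le[of x y] le[of y x] by (simp add: dist_norm norm_minus_commute abs_le_iff)
  qed
qed

lemma superdiff_graph_shift:
  "(x, p) \<in> superdiff_graph (\<lambda>y. u (y + k)) \<Longrightarrow> (x + k, p) \<in> superdiff_graph u"
proof -
  assume *: "(x, p) \<in> superdiff_graph (\<lambda>y. u (y + k))"
  show ?thesis
    unfolding superdiff_graph_iff
  proof (intro allI impI)
    fix e :: real assume "0 < e"
    with * obtain d where d: "d > 0" "\<And>y. norm (y - x) < d \<Longrightarrow> u (y + k) \<le> u (x + k) + p \<bullet> (y - x) + e * norm (y - x)"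
      unfolding superdiff_graph_iff by meson
    have "u y \<le> u (x + k) + p \<bullet> (y - (x + k)) + e * norm (y - (x + k))" if "norm (y - (x + k)) < d" for y
      using d(2)[of "y - k"] that by (simp add: algebra_simps)
    with d(1) show "\<exists>d>0. \<forall>y. norm (y - (x + k)) < d \<longrightarrow> u y \<le> u (x + k) + p \<bullet> (y - (x + k)) + e * norm (y - (x + k))"
      by blast
  qed
qed

text \<open>A superdifferential of the limit is approximated by superdifferentials of
  \<open>W n\<close> at nearby points, where continuity of \<open>G\<close> transfers the
  inequality. A general \<open>G\<close> lets the result be applied to negated supersolutions as
  well.\<close>

lemma superdiff_graph_uniform_limit:
  fixes W :: "nat \<Rightarrow> real^'n \<Rightarrow> real" and G :: "(real^'n) \<times> (real^'n) \<Rightarrow> real"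
  assumes cont: "\<And>n. continuous_on UNIV (W n)"
    and lim: "\<And>e. 0 < e \<Longrightarrow> \<exists>N. \<forall>n\<ge>N. \<forall>x. \<bar>W n x - w x\<bar> < e"
    and G: "continuous_on UNIV G"
    and sub: "\<And>n x p. (x, p) \<in> superdiff_graph (W n) \<Longrightarrow> G (x, p) \<le> c n"
    and c: "c \<longlonglongrightarrow> a"
    and xp: "(x, p) \<in> superdiff_graph w"
  shows "G (x, p) \<le> a"
proof (rule ccontr)
  assume neg: "\<not> ?thesis"
  define e where "e = (G (x, p) - a) / 2"
  have e: "e > 0" using neg by (simp add: e_def)
  obtain \<eta> where \<eta>: "\<eta> > 0" "\<And>z. dist z (x, p) < \<eta> \<Longrightarrow> dist (G z) (G (x, p)) < e"
    using G e unfolding continuous_on_iff by (metis UNIV_I)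
  \<comment> \<open>With \<open>\<delta> \<le> \<eta>/4\<close>, the perturbations of point and
    slope are at most \<open>\<eta>/4\<close> each and stay within the radius of continuity.\<close>
  define \<epsilon> where "\<epsilon> = \<eta> / 16"
  have \<epsilon>: "\<epsilon> > 0" using \<eta> by (simp add: \<epsilon>_def)
  obtain d where d: "d > 0" "\<And>y. norm (y - x) < d \<Longrightarrow> w y \<le> w x + p \<bullet> (y - x) + \<epsilon> * norm (y - x)"
    using xp \<epsilon> unfolding superdiff_graph_iff by meson
  define \<delta> where "\<delta> = min (d/2) (\<eta>/4)"
  have \<delta>: "\<delta> > 0" "\<delta> < d" "\<delta> \<le> \<eta>/4" using d(1) \<eta>(1) by (auto simp: \<delta>_def)
  \<comment> \<open>The uniform error enters twice, in the upper bound and at \<open>x\<close>; a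
    third of \<open>\<epsilon> * \<delta>\<close> leaves the strict inequality intact.\<close>
  define \<tau> where "\<tau> = \<epsilon> * \<delta> / 3"
  have \<tau>: "\<tau> > 0" using \<epsilon> \<delta> by (simp add: \<tau>_def)
  obtain N where N: "\<And>n y. n \<ge> N \<Longrightarrow> \<bar>W n y - w y\<bar> < \<tau>" using lim[OF \<tau>] by blast
  obtain N' where N': "\<And>n. n \<ge> N' \<Longrightarrow> \<bar>c n - a\<bar> < e"
    using LIMSEQ_D[OF c e] by auto
  define n where "n = max N N'"
  have Wn: "\<bar>W n y - w y\<bar> < \<tau>" for y using N[of n y] by (simp add: n_def)
  obtain y q where yq: "norm (y - x) < \<delta>" "norm (q - p) \<le> 4 * \<epsilon>" "(y, q) \<in> superdiff_graph (W n)"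
  proof (rule superdiff_graph_stability[of x \<delta> "W n" \<epsilon> "w x + \<tau>" p])
    show "continuous_on (cball x \<delta>) (W n)" using cont by (rule continuous_on_subset) simp
    show "W n y \<le> w x + \<tau> + p \<bullet> (y - x) + \<epsilon> * norm (y - x)" if "norm (y - x) \<le> \<delta>" for y
      using d(2)[of y] Wn[of y] that \<delta> by linarith
    have "3 * \<tau> = \<epsilon> * \<delta>" by (simp add: \<tau>_def)
    then show "w x + \<tau> - \<epsilon> * \<delta> < W n x" using Wn[of x] by linarith
  qed (use \<delta> \<epsilon> in auto)
  have "dist (y, q) (x, p) \<le> norm (y - x) + norm (q - p)"
    by (simp add: dist_prod_def dist_norm sqrt_sum_squares_le_sum)
  also have "\<dots> < \<eta>" using yq(1,2) \<delta>(3) \<eta>(1) unfolding \<epsilon>_def by linarith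
  finally have "dist (G (y, q)) (G (x, p)) < e" by (rule \<eta>(2))
  moreover have "G (y, q) \<le> c n" by (rule sub[OF yq(3)])
  moreover have "\<bar>c n - a\<bar> < e" by (rule N') (simp add: n_def)
  moreover have "G (x, p) = a + 2 * e" by (simp add: e_def field_simps)
  ultimately show False unfolding dist_real_def by linarith
qed

lemma c_minus_le_INF_Cinf_torus:
  fixes H :: "(real^'n) \<times> (real^'n) \<Rightarrow> real"
  shows "c_minus H \<le> (INF u\<in>Cinf_torus. sup_on (grad_graph u) H)"
  unfolding c_minus_def
proof (intro SUP_least INF_greatest)
  fix b and w :: "real^'n \<Rightarrow> real" assume "b \<in> {a. supereigenvalue H a}" and w: "w \<in> Cinf_torus"
  then obtain u where u: "u \<in> Lip_torus" "ereal b \<le> inf_on (subdiff_graph u) H"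
    by (auto simp: supereigenvalue_def viscosity_supersolution_def)
  obtain L where L: "L-lipschitz_on UNIV u" using u(1) by (rule Lip_torusD)
  obtain L' where L': "L'-lipschitz_on UNIV w" "\<And>x. \<exists>p. (w has_derivative (\<lambda>v. p \<bullet> v)) (at x)"
    using Cinf_torus_bounded_gradient[OF w] by metis
  have t: "torus_fun (\<lambda>x. u x - w x)"
    using u(1) w by (auto simp: torus_fun_def Lip_torus_def Cinf_torus_def)
  have c: "continuous_on UNIV (\<lambda>x. u x - w x)"
    by (intro continuous_intros lipschitz_on_continuous_on[OF L] lipschitz_on_continuous_on[OF L'(1)])
  obtain x y where x: "\<And>z. u x - w x \<le> u z - w z" and "\<And>z. u z - w z \<le> u y - w y"
    by (rule torus_fun_bounded[OF t c]) (rule that)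
  obtain p where p: "(w has_derivative (\<lambda>v. p \<bullet> v)) (at x)" using L'(2) by blast
  have "((\<lambda>y. - w y) has_derivative (\<lambda>v. (- p) \<bullet> v)) (at x)"
    using has_derivative_minus[OF p] by simp
  then have "(x, - p) \<in> superdiff_graph (\<lambda>y. - u y)"
    by (rule superdiff_graph_local_max[of _ _ _ 1]) (use x in \<open>auto simp: algebra_simps\<close>)
  then have "(x, p) \<in> subdiff_graph u" by (simp add: subdiff_graph_iff_superdiff_graph)
  then have "b \<le> H (x, p)" using u(2) by (simp add: le_inf_on_iff)
  also have "ereal (H (x, p)) \<le> sup_on (grad_graph w) H"
    unfolding sup_on_def using p by (intro SUP_upper) (simp add: grad_graph_iff)
  finally show "ereal b \<le> sup_on (grad_graph w) H" by simp
qed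

section \<open>Existence of an eigenvalue\<close>

lemma continuous_on_pairD:
  fixes H :: "'a::real_normed_vector \<times> 'b::real_normed_vector \<Rightarrow> real"
  assumes "continuous_on UNIV H" "0 < e"
  obtains \<eta> where "0 < \<eta>" "\<And>y q. norm (y - x) < \<eta> \<Longrightarrow> norm (q - p) < \<eta> \<Longrightarrow> \<bar>H (y, q) - H (x, p)\<bar> < e"
proof -
  obtain d where d: "d > 0" "\<And>z. dist z (x, p) < d \<Longrightarrow> dist (H z) (H (x, p)) < e"
    using assms unfolding continuous_on_iff by (metis UNIV_I)
  show ?thesis
  proof (rule that[of "d/2"])
    show "d/2 > 0" using d by simp
    fix y q assume "norm (y - x) < d/2" "norm (q - p) < d/2"
    moreover have "dist (y, q) (x, p) \<le> norm (y - x) + norm (q - p)"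
      by (simp add: dist_prod_def dist_norm sqrt_sum_squares_le_sum)
    ultimately have "dist (y, q) (x, p) < d" by linarith
    then show "\<bar>H (y, q) - H (x, p)\<bar> < e" using d(2) by (simp add: dist_real_def)
  qed
qed

text \<open>Perron's method for the discounted equation \<open>l u + H(x, Du) = 0\<close>. Periodicity is not imposed on the
  family: its supremum is periodic because the family is invariant under lattice shifts.\<close>

locale discounted =
  fixes H :: "(real^'n) \<times> (real^'n) \<Rightarrow> real" and l M K R :: real
  assumes per: "hamiltonian_periodic H" and cont: "continuous_on UNIV H"
    and l: "0 < l" and R: "0 \<le> R"
    and M: "\<And>x. H (x, 0) \<le> M" and K: "\<And>x. - K \<le> H (x, 0)"
    and coerc: "\<And>x p. H (x, p) \<le> M \<Longrightarrow> norm p \<le> R"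
begin

text \<open>Subsolutions between a constant subsolution and a constant supersolution. The lower
  barrier turns the differential inequality into \<open>H (x, p) \<le> M\<close>, hence into a
  gradient bound by coercivity; the upper barrier keeps the supremum finite.\<close>

definition family :: "(real^'n \<Rightarrow> real) set" where
  "family = {u. continuous_on UNIV u \<and> (\<forall>x. - M / l \<le> u x \<and> u x \<le> K / l) \<and>
     (\<forall>x p. (x, p) \<in> superdiff_graph u \<longrightarrow> l * u x + H (x, p) \<le> 0)}"

lemma family_lipschitz:
  assumes "u \<in> family"
  shows "R-lipschitz_on UNIV u"
proof (rule lipschitz_if_superdiff_bounded[OF _ _ _ R])
  show "continuous_on UNIV u" using assms by (simp add: family_def)
  have bd: "- M / l \<le> u x" "u x \<le> K / l" for x using assms by (auto simp: family_def)
  show "\<bar>u x\<bar> \<le> \<bar>- M / l\<bar> + \<bar>K / l\<bar>" for x using bd[of x] by linarith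
  fix x p assume "(x, p) \<in> superdiff_graph u"
  then have "H (x, p) \<le> - l * u x" using assms by (force simp: family_def)
  also have "\<dots> \<le> M" using bd(1)[of x] l by (simp add: field_simps)
  finally show "norm p \<le> R" by (rule coerc)
qed

lemma family_const: "(\<lambda>x. - M / l) \<in> family"
proof -
  have "- M / l \<le> K / l"
    using M[of 0] K[of 0] l by (intro divide_right_mono) auto
  moreover have "p = 0" if "(x, p) \<in> superdiff_graph (\<lambda>x. - M / l)" for x and p :: "real^'n"
    using superdiff_graph_differentiable[OF _ that, of 0] by simp
  ultimately show ?thesis using l M by (auto simp: family_def)
qed

lemma family_shift:
  assumes u: "u \<in> family" and k: "k \<in> int_lattice"
  shows "(\<lambda>x. u (x + k)) \<in> family"
proof -
  have "continuous_on UNIV (\<lambda>x. u (x + k))"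
    by (rule continuous_on_compose2[of UNIV u]) (use u in \<open>auto simp: family_def intro: continuous_intros\<close>)
  moreover have "l * u (x + k) + H (x, p) \<le> 0" if "(x, p) \<in> superdiff_graph (\<lambda>x. u (x + k))" for x p
  proof -
    have "l * u (x + k) + H (x + k, p) \<le> 0"
      using superdiff_graph_shift[OF that] u by (auto simp: family_def)
    moreover have "H (x + k, p) = H (x, p)"
      using per k by (auto simp: hamiltonian_periodic_def torus_fun_def)
    ultimately show ?thesis by simp
  qed
  ultimately show ?thesis using u by (auto simp: family_def)
qed

definition perron :: "real^'n \<Rightarrow> real" where
  "perron x = (SUP u\<in>family. u x)"

lemma bdd: "bdd_above ((\<lambda>u. u x) ` family)"
  by (rule bdd_aboveI[of _ "K / l"]) (auto simp: family_def)

lemma family_le_perron: "u \<in> family \<Longrightarrow> u x \<le> perron x"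
  unfolding perron_def by (rule cSUP_upper[OF _ bdd])

lemma perron_le: "(\<And>u. u \<in> family \<Longrightarrow> u x \<le> b) \<Longrightarrow> perron x \<le> b"
  unfolding perron_def using family_const by (intro cSUP_least) auto

lemma perron_approx:
  assumes "b < perron x"
  obtains u where "u \<in> family" "b < u x"
  using assms perron_le[of x b] by (meson not_le)

lemma perron_bounds: "- M / l \<le> perron x" "perron x \<le> K / l"
  using family_le_perron[OF family_const] by (auto intro!: perron_le simp: family_def)

lemma perron_lipschitz: "R-lipschitz_on UNIV perron"
proof (rule lipschitz_onI[OF _ R])
  have le: "perron x \<le> perron y + R * dist x y" for x y
  proof (rule perron_le)
    fix u assume u: "u \<in> family"
    show "u x \<le> perron y + R * dist x y"
      using lipschitz_onD[OF family_lipschitz[OF u], of x y] family_le_perron[OF u, of y]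
      by (simp add: dist_real_def abs_le_iff)
  qed
  fix x y show "dist (perron x) (perron y) \<le> R * dist x y"
    using le[of x y] le[of y x] by (simp add: dist_real_def abs_le_iff dist_commute)
qed

lemma perron_torus: "torus_fun perron"
  unfolding torus_fun_def
proof (intro allI ballI antisym)
  fix x k :: "real^'n" assume k: "k \<in> int_lattice"
  show "perron (x + k) \<le> perron x"
    by (rule perron_le) (use family_le_perron[OF family_shift[OF _ k]] in auto)
  have "- k \<in> int_lattice" using k by (auto simp: int_lattice_def)
  from family_le_perron[OF family_shift[OF _ this], of _ "x + k"]
  show "perron x \<le> perron (x + k)"
    by (intro perron_le) simp
qed

text \<open>A member of the family that nearly attains the supremum at \<open>x\<close> is touched
  from above nearby with almost the same slope, and its own inequality is carried back to
  \<open>x\<close>.\<close>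

lemma perron_subsolution:
  assumes xp: "(x, p) \<in> superdiff_graph perron"
  shows "l * perron x + H (x, p) \<le> 0"
proof (rule ccontr)
  assume "\<not> ?thesis"
  \<comment> \<open>The violation is \<open>2 * e\<close>. The change of \<open>H\<close> may use up
    less than \<open>e\<close>; the Lipschitz drift \<open>l * (R * \<delta>)\<close> and the gap
    \<open>l * \<tau>\<close> may use \<open>e / 2\<close> each.\<close>
  define e where "e = (l * perron x + H (x, p)) / 2"
  have e: "e > 0" using \<open>\<not> l * perron x + H (x, p) \<le> 0\<close> by (simp add: e_def)
  obtain \<eta> where \<eta>: "\<eta> > 0" "\<And>y q. norm (y - x) < \<eta> \<Longrightarrow> norm (q - p) < \<eta> \<Longrightarrow> \<bar>H (y, q) - H (x, p)\<bar> < e"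
    using continuous_on_pairD[OF cont e] by blast
  define \<epsilon> where "\<epsilon> = \<eta> / 8"
  have \<epsilon>: "\<epsilon> > 0" using \<eta> by (simp add: \<epsilon>_def)
  obtain d where d: "d > 0" "\<And>y. norm (y - x) < d \<Longrightarrow> perron y \<le> perron x + p \<bullet> (y - x) + \<epsilon> * norm (y - x)"
    using xp \<epsilon> unfolding superdiff_graph_iff by meson
  \<comment> \<open>The three terms keep the touching inequality, the continuity of \<open>H\<close>
    and the drift bound; \<open>R + 1\<close> avoids dividing by zero when
    \<open>R = 0\<close>.\<close>
  define \<delta> where "\<delta> = min (d/2) (min (\<eta>/2) (e / (2 * l * (R + 1))))"
  have "e / (2 * l * (R + 1)) > 0" using e l R by simp
  then have \<delta>: "\<delta> > 0" "\<delta> < d" "\<delta> < \<eta>" "\<delta> \<le> e / (2 * l * (R + 1))"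
    using d(1) \<eta>(1) by (auto simp: \<delta>_def)
  have R\<delta>: "l * (R * \<delta>) \<le> e / 2"
  proof -
    have "(R + 1) * \<delta> \<le> (R + 1) * (e / (2 * l * (R + 1)))" using \<delta>(4) R by (intro mult_left_mono) auto
    also have "\<dots> = e / (2 * l)" using R by simp
    finally have "R * \<delta> \<le> e / (2 * l)" using \<delta>(1) by (simp add: distrib_right)
    then have "l * (R * \<delta>) \<le> l * (e / (2 * l))" using l by (intro mult_left_mono) auto
    then show ?thesis using l by simp
  qed
  define \<tau> where "\<tau> = min (\<epsilon> * \<delta>) (e / (2 * l))"
  have \<tau>: "\<tau> > 0" "\<tau> \<le> \<epsilon> * \<delta>" "\<tau> \<le> e / (2 * l)" using \<epsilon> \<delta>(1) e l by (auto simp: \<tau>_def)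
  obtain u where u: "u \<in> family" "perron x - \<tau> < u x"
    using perron_approx[of "perron x - \<tau>" x] \<tau>(1) by auto
  obtain y q where yq: "norm (y - x) < \<delta>" "norm (q - p) \<le> 4 * \<epsilon>" "(y, q) \<in> superdiff_graph u"
  proof (rule superdiff_graph_stability[of x \<delta> u \<epsilon> "perron x" p])
    show "continuous_on (cball x \<delta>) u" using u(1) by (auto simp: family_def intro: continuous_on_subset)
    show "u y \<le> perron x + p \<bullet> (y - x) + \<epsilon> * norm (y - x)" if "norm (y - x) \<le> \<delta>" for y
      using d(2)[of y] that \<delta>(2) family_le_perron[OF u(1), of y] by linarith
    show "perron x - \<epsilon> * \<delta> < u x" using u(2) \<tau>(2) by linarith
  qed (use \<delta> \<epsilon> in auto)
  have "\<bar>H (y, q) - H (x, p)\<bar> < e"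
    by (rule \<eta>(2)) (use yq \<delta> \<eta>(1) in \<open>auto simp: \<epsilon>_def\<close>)
  moreover have "u x - R * \<delta> \<le> u y"
  proof -
    have "\<bar>u y - u x\<bar> \<le> R * norm (y - x)"
      using lipschitz_onD[OF family_lipschitz[OF u(1)], of y x] by (simp add: dist_norm)
    also have "\<dots> \<le> R * \<delta>" using yq(1) R by (intro mult_left_mono) auto
    finally show ?thesis by linarith
  qed
  then have "l * (perron x - \<tau> - R * \<delta>) \<le> l * u y"
    using u(2) l by (intro mult_left_mono) auto
  moreover have "l * \<tau> \<le> e / 2"
    using mult_left_mono[OF \<tau>(3), of l] l by simp
  moreover have "l * u y + H (y, q) \<le> 0" using u(1) yq(3) by (auto simp: family_def)
  moreover have "l * perron x + H (x, p) = 2 * e" by (simp add: e_def)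
  ultimately show False using R\<delta> by (simp add: right_diff_distrib)
qed

text \<open>If the inequality failed at \<open>x\<close>, the supremum could be lifted near
  \<open>x\<close> by gluing in a downward cone of slope about \<open>p\<close>; the result would be
  a member of the family exceeding \<open>perron\<close> at \<open>x\<close>.\<close>

lemma perron_supersolution:
  assumes xp: "(x, p) \<in> subdiff_graph perron"
  shows "0 \<le> l * perron x + H (x, p)"
proof (rule ccontr)
  assume neg: "\<not> 0 \<le> l * perron x + H (x, p)"
  have low: "\<exists>d>0. \<forall>y. norm (y - x) < d \<longrightarrow> perron x + p \<bullet> (y - x) - e * norm (y - x) \<le> perron y" if "e > 0" for e
  proof -
    have "\<exists>d>0. \<forall>y. norm (y - x) < d \<longrightarrow> - perron y \<le> - perron x + (- p) \<bullet> (y - x) + e * norm (y - x)"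
      using xp that unfolding subdiff_graph_iff_superdiff_graph superdiff_graph_iff by blast
    then obtain d where "d > 0" "\<And>y. norm (y - x) < d \<Longrightarrow> - perron y \<le> - perron x + (- p) \<bullet> (y - x) + e * norm (y - x)"
      by blast
    then show ?thesis by (intro exI[of _ d]) force
  qed
  \<comment> \<open>At the upper barrier \<open>perron\<close> would have its maximum, which forces
    \<open>p = 0\<close>, and \<open>K\<close> was chosen so that the inequality then holds.\<close>
  have "perron x \<noteq> K / l"
  proof
    assume eq: "perron x = K / l"
    have "(x, - p) \<in> superdiff_graph (\<lambda>y. - perron x)"
      by (rule superdiff_graph_mono[of _ _ "\<lambda>y. - perron y" 1])
        (use xp perron_bounds(2) eq in \<open>auto simp: subdiff_graph_iff_superdiff_graph\<close>)
    then have "- p = 0" by (rule superdiff_graph_differentiable[rotated]) simp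
    then show False using neg K[of x] eq l by simp
  qed
  then have pK: "perron x < K / l" using perron_bounds(2)[of x] by simp
  define e where "e = - (l * perron x + H (x, p)) / 2"
  have e: "e > 0" using neg by (simp add: e_def)
  obtain \<eta> where \<eta>: "\<eta> > 0" "\<And>y q. norm (y - x) < \<eta> \<Longrightarrow> norm (q - p) < \<eta> \<Longrightarrow> \<bar>H (y, q) - H (x, p)\<bar> < e"
    using continuous_on_pairD[OF cont e] by blast
  define \<epsilon> where "\<epsilon> = \<eta> / 4"
  have \<epsilon>: "\<epsilon> > 0" using \<eta> by (simp add: \<epsilon>_def)
  obtain d where d: "d > 0" "\<And>y. norm (y - x) < d \<Longrightarrow> perron x + p \<bullet> (y - x) - \<epsilon> * norm (y - x) \<le> perron y"
    using low[OF \<epsilon>] by blast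
  define C where "C = \<epsilon> + norm p"
  have C: "C > 0" using \<epsilon> by (simp add: C_def add_pos_nonneg)
  \<comment> \<open>The first bound on the lift keeps the glued function below the barrier
    \<open>K / l\<close>, the second keeps \<open>l * w\<close> within \<open>e\<close> of its value
    at \<open>x\<close>.\<close>
  define r where "r = min (K / l - perron x) (e / l)"
  have r: "r > 0" using pK e l by (simp add: r_def)
  define \<delta> where "\<delta> = min (d/2) (min (\<eta>/2) (r / C))"
  have "r / C > 0" using r C by simp
  then have \<delta>: "\<delta> > 0" "\<delta> < d" "\<delta> < \<eta>" "\<delta> \<le> r / C" using d(1) \<eta>(1) by (auto simp: \<delta>_def)
  have C\<delta>: "C * \<delta> \<le> r" using \<delta>(4) C by (simp add: field_simps)
  \<comment> \<open>The cone is lifted by \<open>\<epsilon> * \<delta> / 2\<close> and descends with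
    \<open>2 * \<epsilon>\<close>, twice the error allowed for \<open>perron\<close>. From distance
    \<open>\<delta> / 2\<close> on, the surplus descent outweighs the lift, so the gluing is
    continuous.\<close>
  define \<psi> where "\<psi> y = perron x + \<epsilon> * \<delta> / 2 + p \<bullet> (y - x) - 2 * \<epsilon> * norm (y - x)" for y
  have \<psi>_up: "\<psi> y \<le> perron x + r" if "norm (y - x) < \<delta>" for y
  proof -
    have "p \<bullet> (y - x) \<le> norm p * norm (y - x)" by (rule norm_cauchy_schwarz)
    also have "\<dots> \<le> norm p * \<delta>" using that by (intro mult_left_mono) auto
    finally have "p \<bullet> (y - x) \<le> norm p * \<delta>" .
    moreover have "0 \<le> 2 * \<epsilon> * norm (y - x)" using \<epsilon> by simp
    ultimately have "\<psi> y \<le> perron x + (\<epsilon> * \<delta> / 2 + norm p * \<delta>)"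
      unfolding \<psi>_def by linarith
    also have "\<epsilon> * \<delta> / 2 + norm p * \<delta> \<le> C * \<delta>" using \<epsilon> \<delta> by (simp add: C_def distrib_right)
    finally show ?thesis using C\<delta> by simp
  qed
  have \<psi>_out: "\<psi> y \<le> perron y" if "norm (y - x) < d" "\<delta> / 2 \<le> norm (y - x)" for y
  proof -
    have "\<epsilon> * (\<delta> / 2) \<le> \<epsilon> * norm (y - x)" using that(2) \<epsilon> by (intro mult_left_mono) auto
    then show ?thesis using d(2)[OF that(1)] by (simp add: \<psi>_def)
  qed
  define w where "w y = (if norm (y - x) < \<delta> then max (perron y) (\<psi> y) else perron y)" for y
  have w_out: "w y = perron y" if "\<delta> / 2 \<le> norm (y - x)" for y
    using \<psi>_out[OF _ that] \<delta>(2) by (auto simp: w_def)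
  have w_ge: "perron y \<le> w y" for y by (simp add: w_def)
  have pc: "continuous_on UNIV perron" using perron_lipschitz by (rule lipschitz_on_continuous_on)
  have "continuous_on UNIV w"
  proof -
    have "continuous_on (ball x \<delta>) w"
    proof (rule continuous_on_eq)
      show "continuous_on (ball x \<delta>) (\<lambda>y. max (perron y) (\<psi> y))"
        unfolding \<psi>_def by (intro continuous_intros continuous_on_subset[OF pc]) auto
    qed (auto simp: w_def dist_norm norm_minus_commute)
    moreover have "continuous_on {y. \<delta> / 2 < norm (y - x)} w"
      by (rule continuous_on_eq[OF continuous_on_subset[OF pc]]) (auto simp: w_out)
    moreover have "open {y. \<delta> / 2 < norm (y - x)}"
      by (intro open_Collect_less continuous_intros)
    ultimately have "continuous_on (ball x \<delta> \<union> {y. \<delta> / 2 < norm (y - x)}) w"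
      by (intro continuous_on_open_Un) auto
    moreover have "ball x \<delta> \<union> {y. \<delta> / 2 < norm (y - x)} = UNIV"
      using \<delta>(1) by (auto simp: dist_norm norm_minus_commute)
    ultimately show ?thesis by simp
  qed
  moreover have "- M / l \<le> w y \<and> w y \<le> K / l" for y
  proof -
    have "w y \<le> K / l"
      using \<psi>_up[of y] perron_bounds(2)[of y] by (auto simp: w_def r_def)
    then show ?thesis using w_ge[of y] perron_bounds(1)[of y] by linarith
  qed
  moreover have "l * w y + H (y, q) \<le> 0" if yq: "(y, q) \<in> superdiff_graph w" for y q
  proof (cases "w y = perron y")
    case True
    have "(y, q) \<in> superdiff_graph perron"
      by (rule superdiff_graph_mono[OF yq zero_less_one]) (use w_ge True in auto)
    then show ?thesis using perron_subsolution True by simp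
  next
    case False
    then have ny: "norm (y - x) < \<delta>" and wy: "w y = \<psi> y"
      by (auto simp: w_def max_def split: if_splits)
    have "(y, q) \<in> superdiff_graph \<psi>"
    proof (rule superdiff_graph_mono[OF yq])
      show "0 < \<delta> - norm (y - x)" using ny by simp
      fix z assume "norm (z - y) < \<delta> - norm (y - x)"
      then have "norm (z - x) < \<delta>" using norm_triangle_ineq[of "z - y" "y - x"] by simp
      then show "\<psi> z \<le> w z" by (simp add: w_def)
    qed (simp add: wy)
    then have "norm (q - p) \<le> 2 * \<epsilon>"
    proof (rule superdiff_graph_cone)
      fix z
      have "norm (z - x) \<le> norm (z - y) + norm (y - x)"
        using norm_triangle_ineq[of "z - y" "y - x"] by simp
      then have "\<epsilon> * norm (z - x) \<le> \<epsilon> * (norm (z - y) + norm (y - x))"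
        using \<epsilon> by (intro mult_left_mono) auto
      then show "\<psi> y + p \<bullet> (z - y) - 2 * \<epsilon> * norm (z - y) \<le> \<psi> z"
        by (simp add: \<psi>_def inner_diff_right algebra_simps)
    qed
    then have "\<bar>H (y, q) - H (x, p)\<bar> < e"
      using ny \<delta>(3) \<epsilon> by (intro \<eta>(2)) (auto simp: \<epsilon>_def)
    moreover have "l * w y \<le> l * (perron x + e / l)"
      using \<psi>_up[OF ny] l unfolding wy by (intro mult_left_mono) (auto simp: r_def)
    then have "l * w y \<le> l * perron x + e" using l by (simp add: distrib_left)
    moreover have "l * perron x + H (x, p) = - 2 * e" by (simp add: e_def)
    ultimately show ?thesis by linarith
  qed
  ultimately have "w \<in> family" by (simp add: family_def)
  then have "w x \<le> perron x" by (rule family_le_perron)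
  moreover have "w x \<ge> \<psi> x" using \<delta>(1) by (simp add: w_def)
  moreover have "\<psi> x > perron x" using \<epsilon> \<delta>(1) by (simp add: \<psi>_def)
  ultimately show False by simp
qed

end

section \<open>The vanishing discount limit\<close>

lemma superdiff_graph_diff_const:
  "(x, p) \<in> superdiff_graph (\<lambda>y. u y - c) \<longleftrightarrow> (x, p) \<in> superdiff_graph u"
proof -
  have "(u y - c \<le> u x - c + t + s) = (u y \<le> u x + t + s)" for y t s by auto
  then show ?thesis unfolding superdiff_graph_iff by simp
qed

lemma coercive_bound:
  fixes H :: "(real^'n) \<times> (real^'n) \<Rightarrow> real"
  assumes "coercive H"
  obtains R where "0 \<le> R" "\<And>x p. H (x, p) \<le> M \<Longrightarrow> norm p \<le> R"
proof -
  have "ereal M < Liminf at_infinity (\<lambda>p. INF x. ereal (H (x, p)))"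
    using assms by (simp add: coercive_def)
  then have "\<forall>\<^sub>F p in at_infinity. ereal M < (INF x. ereal (H (x, p)))"
    by (rule less_LiminfD)
  then obtain b where b: "\<And>p. b \<le> norm p \<Longrightarrow> ereal M < (INF x. ereal (H (x, p)))"
    unfolding eventually_at_infinity by blast
  show ?thesis
  proof (rule that[of "max b 0"])
    fix x p assume HM: "H (x, p) \<le> M"
    have "(INF x. ereal (H (x, p))) \<le> ereal (H (x, p))" by (rule INF_lower) simp
    also have "\<dots> \<le> ereal M" using HM by simp
    finally have "\<not> ereal M < (INF x. ereal (H (x, p)))" by (simp add: not_less)
    then have "\<not> b \<le> norm p" using b by blast
    then show "norm p \<le> max b 0" by simp
  qed simp
qed

text \<open>The eigenvalue is obtained by letting the discount factor \<open>l n\<close> tend to zero.\<close>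

lemma eigenvalue_exists:
  fixes H :: "(real^'n) \<times> (real^'n) \<Rightarrow> real"
  assumes per: "hamiltonian_periodic H" and cont: "continuous_on UNIV H" and co: "coercive H"
  obtains a where "eigenvalue H a"
proof -
  have H0: "torus_fun (\<lambda>x. H (x, 0))" using per by (simp add: hamiltonian_periodic_def)
  have H0c: "continuous_on UNIV (\<lambda>x. H (x, 0))"
    by (intro continuous_on_compose2[OF cont] continuous_intros) auto
  obtain x1 x2 where x12: "\<And>z. H (x1, 0) \<le> H (z, 0)" "\<And>z. H (z, 0) \<le> H (x2, 0)"
    by (rule torus_fun_bounded[OF H0 H0c]) (rule that)
  define M K where "M = H (x2, 0)" and "K = - H (x1, 0)"
  obtain R where R: "0 \<le> R" "\<And>x p. H (x, p) \<le> M \<Longrightarrow> norm p \<le> R"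
    by (rule coercive_bound[OF co, of M]) (rule that)
  define l where "l n = inverse (real (Suc n))" for n
  have l: "l n > 0" for n by (simp add: l_def)
  have disc: "discounted H (l n) M K R" for n
    by unfold_locales (use per cont l R x12 in \<open>auto simp: M_def K_def\<close>)
  define V where "V n = discounted.perron H (l n) M K" for n
  have V_lip: "R-lipschitz_on UNIV (V n)" and V_torus: "torus_fun (V n)" for n
    unfolding V_def using discounted.perron_lipschitz[OF disc] discounted.perron_torus[OF disc] by auto
  have V_bounds: "- M \<le> l n * V n x" "l n * V n x \<le> K" for n x
    using discounted.perron_bounds[OF disc[of n], of x] l[of n]
    unfolding V_def by (auto simp: field_simps)
  have V_sub: "(x, p) \<in> superdiff_graph (V n) \<Longrightarrow> l n * V n x + H (x, p) \<le> 0" for n x p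
    unfolding V_def by (rule discounted.perron_subsolution[OF disc])
  have V_super: "(x, p) \<in> subdiff_graph (V n) \<Longrightarrow> 0 \<le> l n * V n x + H (x, p)" for n x p
    unfolding V_def by (rule discounted.perron_supersolution[OF disc])
  \<comment> \<open>\<open>V n\<close> is bounded only in terms of \<open>1 / l n\<close>.
    Subtracting its value at the origin leaves functions bounded uniformly by the common Lipschitz
    constant.\<close>
  define W where "W n x = V n x - V n 0" for n x
  have W_lip: "\<bar>W n x - W n y\<bar> \<le> R * norm (x - y)" for n x y
    using lipschitz_onD[OF V_lip[of n], of x y] by (simp add: W_def dist_norm)
  have W_per: "W n (x + k) = W n x" if "k \<in> int_lattice" for n x k
    using V_torus[of n] that by (auto simp: torus_fun_def W_def)
  let ?S = "cbox (0::real^'n) 1"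
  obtain B where B: "\<And>x. x \<in> ?S \<Longrightarrow> norm x \<le> B" using bounded_cbox bounded_iff by metis
  define C where "C = R * B"
  have WS: "\<bar>W n x\<bar> \<le> C" if "x \<in> ?S" for n x
  proof -
    have "\<bar>W n x - W n 0\<bar> \<le> R * norm (x - 0)" by (rule W_lip)
    also have "\<dots> \<le> C" unfolding C_def using B[OF that] R(1) by (intro mult_left_mono) auto
    finally show ?thesis by (simp add: W_def)
  qed
  have "\<exists>k. k \<in> int_lattice \<and> x + k \<in> ?S" for x :: "real^'n"
    by (rule torus_fun_reduce[of x]) blast
  then obtain \<kappa> where \<kappa>: "\<And>x. \<kappa> x \<in> int_lattice" "\<And>x :: real^'n. x + \<kappa> x \<in> ?S" by metis
  have WC: "\<bar>W n x\<bar> \<le> C" for n x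
    using WS[OF \<kappa>(2), of n x] W_per[OF \<kappa>(1), of n x] by simp
  obtain g and k :: "nat \<Rightarrow> nat" where k: "strict_mono k"
    "\<And>e. 0 < e \<Longrightarrow> \<exists>N. \<forall>n x. n \<ge> N \<and> x \<in> ?S \<longrightarrow> norm (W (k n) x - g x) < e"
  proof (rule Arzela_Ascoli[of ?S W C])
    show "norm (W n x) \<le> C" for n x using WC by simp
    fix x :: "real^'n" and e :: real assume e: "0 < e"
    have "norm (W n x - W n y) < e" if "norm (x - y) < e / (R + 1)" for n y
    proof -
      have "R * norm (x - y) \<le> (R + 1) * norm (x - y)" by (simp add: distrib_right)
      also have "\<dots> < e" using that R(1) by (simp add: field_simps)
      finally show ?thesis using W_lip[of n x y] by simp
    qed
    then show "\<exists>d>0. \<forall>n y. y \<in> ?S \<and> norm (x - y) < d \<longrightarrow> norm (W n x - W n y) < e"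
      using e R(1) by (intro exI[of _ "e / (R + 1)"]) auto
  qed (auto intro: that)
  \<comment> \<open>These numbers stay between \<open>- M\<close> and \<open>K\<close>; the negative
    of a limit point is the eigenvalue.\<close>
  define s where "s n = l (k n) * V (k n) 0" for n
  have "bounded (range s)"
    unfolding bounded_iff
  proof (intro exI ballI)
    fix t assume "t \<in> range s"
    then obtain n where "t = s n" by blast
    then show "norm t \<le> \<bar>M\<bar> + \<bar>K\<bar>" using V_bounds[of "k n" 0] by (auto simp: s_def)
  qed
  then obtain a r where r: "strict_mono r" "(s \<circ> r) \<longlonglongrightarrow> a"
    using bounded_imp_convergent_subsequence by blast
  define m where "m n = k (r n)" for n
  \<comment> \<open>Lattice reduction extends \<open>g\<close> from the cube to the whole space.
    Whatever shifts \<kappa> picks, \<open>w\<close> is the limit of the periodic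
    \<open>W (m n)\<close>, and this gives its periodicity.\<close>
  define w where "w x = g (x + \<kappa> x)" for x
  have lim: "\<exists>N. \<forall>n\<ge>N. \<forall>x. \<bar>W (m n) x - w x\<bar> < e" if e: "0 < e" for e
  proof -
    obtain N where N: "\<And>n x. n \<ge> N \<Longrightarrow> x \<in> ?S \<Longrightarrow> norm (W (k n) x - g x) < e" using k(2)[OF e] by blast
    have "\<bar>W (m n) x - w x\<bar> < e" if "n \<ge> N" for n x
    proof -
      have "r n \<ge> N" using seq_suble[OF r(1), of n] that by simp
      from N[OF this \<kappa>(2)[of x]] show ?thesis
        using W_per[OF \<kappa>(1), of "k (r n)" x] by (simp add: m_def w_def)
    qed
    then show ?thesis by blast
  qed
  have ptw: "(\<lambda>n. W (m n) x) \<longlonglongrightarrow> w x" for x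
    unfolding LIMSEQ_iff real_norm_def using lim by blast
  have "torus_fun w"
    unfolding torus_fun_def
  proof (intro allI ballI)
    fix x q :: "real^'n" assume "q \<in> int_lattice"
    then show "w (x + q) = w x"
      using ptw[of "x + q"] ptw[of x] W_per LIMSEQ_unique by auto
  qed
  moreover have "R-lipschitz_on UNIV w"
  proof (rule lipschitz_onI[OF _ R(1)])
    fix x y
    have "(\<lambda>n. \<bar>W (m n) x - W (m n) y\<bar>) \<longlonglongrightarrow> \<bar>w x - w y\<bar>"
      by (intro tendsto_intros ptw)
    then show "dist (w x) (w y) \<le> R * dist x y"
      using W_lip by (auto simp: dist_norm intro!: LIMSEQ_le_const2)
  qed
  ultimately have "w \<in> Lip_torus" by (auto simp: Lip_torus_def)
  have Wc: "continuous_on UNIV (W n)" for n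
    unfolding W_def by (intro continuous_intros lipschitz_on_continuous_on[OF V_lip])
  have "strict_mono m" unfolding m_def using k(1) r(1) by (simp add: strict_mono_def)
  then have lm: "(\<lambda>n. l (m n)) \<longlonglongrightarrow> 0"
    using LIMSEQ_subseq_LIMSEQ[OF LIMSEQ_inverse_real_of_nat] by (simp add: l_def o_def)
  have sm: "(\<lambda>n. l (m n) * V (m n) 0) \<longlonglongrightarrow> a"
    using r(2) by (simp add: s_def m_def o_def)
  \<comment> \<open>The zeroth-order term becomes constant in the limit: its oscillation is at most
    of order \<open>l n\<close>.\<close>
  have lV: "\<bar>l n * V n x - l n * V n 0\<bar> \<le> l n * C" for n x
  proof -
    have "\<bar>l n * V n x - l n * V n 0\<bar> = l n * \<bar>W n x\<bar>"
      using l[of n] by (simp add: W_def right_diff_distrib[symmetric] abs_mult)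
    then show ?thesis using WC[of n x] l[of n] by (simp add: mult_left_mono)
  qed
  have "H (x, p) \<le> - a" if "(x, p) \<in> superdiff_graph w" for x p
  proof (rule superdiff_graph_uniform_limit[OF Wc lim cont])
    fix n x p assume "(x, p) \<in> superdiff_graph (W (m n))"
    then have "(x, p) \<in> superdiff_graph (V (m n))"
      unfolding W_def superdiff_graph_diff_const .
    from V_sub[OF this] show "H (x, p) \<le> - (l (m n) * V (m n) 0) + l (m n) * C"
      using lV[of "m n" x] by linarith
  next
    have "(\<lambda>n. - (l (m n) * V (m n) 0) + l (m n) * C) \<longlonglongrightarrow> - a + 0 * C"
      by (intro tendsto_intros sm lm)
    then show "(\<lambda>n. - (l (m n) * V (m n) 0) + l (m n) * C) \<longlonglongrightarrow> - a" by simp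
  qed (use that in auto)
  moreover have "- a \<le> H (x, p)" if "(x, p) \<in> subdiff_graph w" for x p
  proof -
    \<comment> \<open>The supersolution half is the same stability result for the negated functions
      and the Hamiltonian \<open>- H (x, - q)\<close>.\<close>
    have "- H (x, - (- p)) \<le> a"
    proof (rule superdiff_graph_uniform_limit[where W = "\<lambda>n y. - W (m n) y" and w = "\<lambda>y. - w y"
          and G = "\<lambda>z. - H (fst z, - snd z)" and x = x and p = "- p", unfolded fst_conv snd_conv])
      show "continuous_on UNIV (\<lambda>y. - W (m n) y)" for n by (intro continuous_intros Wc)
      show "\<exists>N. \<forall>n\<ge>N. \<forall>x. \<bar>- W (m n) x - - w x\<bar> < e" if "0 < e" for e
        using lim[OF that] by (simp add: abs_minus_commute)
      show "continuous_on UNIV (\<lambda>z. - H (fst z, - snd z))"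
        by (intro continuous_intros continuous_on_compose2[OF cont]) auto
      show "(x, - p) \<in> superdiff_graph (\<lambda>y. - w y)"
        using that by (simp add: subdiff_graph_iff_superdiff_graph)
    next
      fix n x q assume "(x, q) \<in> superdiff_graph (\<lambda>y. - W (m n) y)"
      then have "(x, q) \<in> superdiff_graph (\<lambda>y. - V (m n) y - (- V (m n) 0))"
        by (simp add: W_def)
      then have "(x, - q) \<in> subdiff_graph (V (m n))"
        unfolding superdiff_graph_diff_const by (simp add: subdiff_graph_iff_superdiff_graph)
      from V_super[OF this] show "- H (x, - q) \<le> l (m n) * V (m n) 0 + l (m n) * C"
        using lV[of "m n" x] by linarith
    next
      have "(\<lambda>n. l (m n) * V (m n) 0 + l (m n) * C) \<longlonglongrightarrow> a + 0 * C"
        by (intro tendsto_intros sm lm)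
      then show "(\<lambda>n. l (m n) * V (m n) 0 + l (m n) * C) \<longlonglongrightarrow> a" by simp
    qed
    then show ?thesis by simp
  qed
  ultimately have "viscosity_solution H (- a) w"
    using \<open>w \<in> Lip_torus\<close> by (auto simp: viscosity_solution_def sup_on_le_iff le_inf_on_iff)
  then show ?thesis using that by (auto simp: eigenvalue_def)
qed

theorem theorem2p5:
  fixes H :: "(real^'n) \<times> (real^'n) \<Rightarrow> real"
  assumes "hamiltonian_periodic H"
    and "continuous_on UNIV H"
    and "quasiconvex_in_p H"
  shows "c_plus H = (INF u\<in>Lip_torus. sup_on (grad_graph u) H) \<and>
    (INF u\<in>Lip_torus. sup_on (grad_graph u) H) = (INF u\<in>Cinf_torus. sup_on (grad_graph u) H) \<and>
    (coercive H \<longrightarrow> (\<exists>c. is_critical_value H c \<and>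
       c_plus H = ereal c \<and>
       (INF u\<in>Lip_torus. sup_on (grad_graph u) H) = ereal c \<and>
       (INF u\<in>Cinf_torus. sup_on (grad_graph u) H) = ereal c))"
proof -
  let ?L = "INF u\<in>Lip_torus. sup_on (grad_graph u) H" and ?C = "INF u\<in>Cinf_torus. sup_on (grad_graph u) H"
  have L: "c_plus H = ?L" and C: "?L = ?C"
    using INF_Lip_torus_le_c_plus[of H] INF_Cinf_torus_le_INF_Lip_torus[OF assms]
      c_plus_le_INF_Cinf_torus[of H] by (auto intro: antisym order_trans)
  have "\<exists>c. is_critical_value H c \<and> c_plus H = ereal c" if co: "coercive H"
  proof -
    obtain c where c: "eigenvalue H c"
      using eigenvalue_exists[OF assms(1,2) co] by blast
    have eq: "c_plus H = ereal a \<and> c_minus H = ereal a" if a: "eigenvalue H a" for a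
    proof -
      obtain u where "viscosity_solution H a u" using a by (auto simp: eigenvalue_def)
      then have "subeigenvalue H a" "supereigenvalue H a"
        by (auto simp: subeigenvalue_def supereigenvalue_def viscosity_solution_def
            viscosity_subsolution_def viscosity_supersolution_def)
      then have "c_plus H \<le> ereal a" "ereal a \<le> c_minus H"
        by (auto simp: c_plus_def c_minus_def intro: INF_lower SUP_upper)
      moreover have "c_minus H \<le> c_plus H"
        using c_minus_le_INF_Cinf_torus[of H] L C by simp
      ultimately show ?thesis by (meson antisym order_trans)
    qed
    have "a = c" if "eigenvalue H a" for a
      using eq[OF that] eq[OF c] by simp
    then have "is_critical_value H c"
      unfolding is_critical_value_def using c eq[OF c] by blast
    then show ?thesis using eq[OF c] by blast
  qed
  then show ?thesis using L C by auto
qed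

end
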